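(* Let $n\ge 2$, let $\psi\colon(0,1]\to(0,\infty)$ be a left continuous increasing function, and let $$\Omega_\psi:=\{(t,x)\in(0,1)\times\mathbb{R}^{n-1} : |x|<\psi(t)\}\cup\{(t,x)\in[1,2)\times\mathbb{R}^{n-1} : |x|<\psi(1)\}\subset\mathbb{R}^n .$$ Then for all $1<p\le\infty$ one has $W^{1,p}(\Omega_\psi)=M^{1,p}(\Omega_\psi)$ as sets, with equivalence of norms; that is, there is a constant $C\ge 1$, independent of $u$, such that $$C^{-1}\|u\|_{W^{1,p}(\Omega_\psi)}\le \|u\|_{M^{1,p}(\Omega_\psi)}\le C\|u\|_{W^{1,p}(\Omega_\psi)}$$ for all $u$ in this common space.
   Context: "Increasing" is meant in the non-strict sense ($s\le t$ implies $\psi(s)\le\psi(t)$). The set $\Omega_\psi$ is a domain (open and connected) in $\mathbb{R}^n=\mathbb{R}\times\mathbb{R}^{n-1}$. Let $\Omega\subset\mathbb{R}^n$ be a domain and $1\le p\le\infty$; functions are identified when equal almost everywhere with respect to Lebesgue measure. Sobolev space: $W^{1,p}(\Omega)$ is the set of all $u\in L^p(\Omega)$ whose weak (distributional) gradient $\nabla u$ belongs to $L^p(\Omega;\mathbb{R}^n)$, with norm $\|u\|_{W^{1,p}(\Omega)}=\|u\|_{L^p(\Omega)}+\||\nabla u|\|_{L^p(\Omega)}$. Hajłasz–Sobolev space: for $u\in L^p(\Omega)$ let $\mathcal{D}_p(u)$ be the class of functions $0\le g\in L^p(\Omega)$ for which there exists $E\subset\Omega$ with $n$-dimensional Lebesgue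 measure $|E|=0$ such that $$|u(z_1)-u(z_2)|\le|z_1-z_2|\,(g(z_1)+g(z_2))\quad\text{for all } z_1,z_2\in\Omega\setminus E .$$ Then $M^{1,p}(\Omega)=\{u\in L^p(\Omega):\mathcal{D}_p(u)\neq\emptyset\}$, with norm $\|u\|_{M^{1,p}(\Omega)}=\|u\|_{L^p(\Omega)}+\inf_{g\in\mathcal{D}_p(u)}\|g\|_{L^p(\Omega)}$. *)

theory Defs
  imports "HOL-Analysis.Analysis" "HOL-Probability.Essential_Supremum"
begin

text \<open>
  The exponent is an extended real \<open>1 \<le> p \<le> \<infinity>\<close>, represented in \<open>ennreal\<close>. Function spaces on a
  set \<open>\<Omega>\<close> are sets of total functions of which only the restriction to \<open>\<Omega>\<close> matters. Instead of
  forming the quotient by equality almost everywhere, they are sets of representatives: each of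
  them is closed under changing a function on a null subset of \<open>\<Omega>\<close>, and the norms are invariant
  under such a change.
\<close>

definition Lp :: "ennreal \<Rightarrow> 'a::euclidean_space set \<Rightarrow> ('a \<Rightarrow> 'b::euclidean_space) set"
  where "Lp p \<Omega> =
    {f \<in> borel_measurable (lebesgue_on \<Omega>).
       if p = \<infinity> then esssup (lebesgue_on \<Omega>) (\<lambda>z. ereal (norm (f z))) < \<infinity>
       else integrable (lebesgue_on \<Omega>) (\<lambda>z. norm (f z) powr enn2real p)}"

text \<open>Only meaningful on \<open>Lp p \<Omega>\<close>; the pointwise norm is the Euclidean one.\<close>

definition Lp_norm :: "ennreal \<Rightarrow> 'a::euclidean_space set \<Rightarrow> ('a \<Rightarrow> 'b::euclidean_space) \<Rightarrow> real"
  where "Lp_norm p \<Omega> f =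
    (if p = \<infinity> then real_of_ereal (esssup (lebesgue_on \<Omega>) (\<lambda>z. ereal (norm (f z))))
     else (LINT z|lebesgue_on \<Omega>. norm (f z) powr enn2real p) powr (1 / enn2real p))"

fun Ck :: "nat \<Rightarrow> ('a::euclidean_space \<Rightarrow> real) \<Rightarrow> bool" where
  "Ck 0 f \<longleftrightarrow> continuous_on UNIV f"
| "Ck (Suc k) f \<longleftrightarrow> (\<forall>x. f differentiable (at x)) \<and>
     (\<forall>v. Ck k (\<lambda>x. frechet_derivative f (at x) v))"

definition test_functions :: "'a::euclidean_space set \<Rightarrow> ('a \<Rightarrow> real) set"
  where "test_functions \<Omega> =
    {\<phi>. (\<forall>k. Ck k \<phi>) \<and> compact (closure {x. \<phi> x \<noteq> 0}) \<and> closure {x. \<phi> x \<noteq> 0} \<subseteq> \<Omega>}"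

definition locally_integrable_on ::
    "('a::euclidean_space \<Rightarrow> 'b::euclidean_space) \<Rightarrow> 'a set \<Rightarrow> bool" (infix "locally'_integrable'_on" 50)
  where "f locally_integrable_on \<Omega> \<longleftrightarrow>
    (\<forall>K. compact K \<and> K \<subseteq> \<Omega> \<longrightarrow> integrable (lebesgue_on K) f)"

definition has_weak_gradient ::
    "'a::euclidean_space set \<Rightarrow> ('a \<Rightarrow> real) \<Rightarrow> ('a \<Rightarrow> 'a) \<Rightarrow> bool"
  where "has_weak_gradient \<Omega> u G \<longleftrightarrow>
    u locally_integrable_on \<Omega> \<and> G locally_integrable_on \<Omega> \<and>
    (\<forall>\<phi>\<in>test_functions \<Omega>. \<forall>e\<in>Basis.
       (LINT z|lebesgue_on \<Omega>. u z * frechet_derivative \<phi> (at z) e) =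
       - (LINT z|lebesgue_on \<Omega>. (G z \<bullet> e) * \<phi> z))"

text \<open>On an open set a weak gradient is unique almost everywhere, so the choice is immaterial for
  membership in \<open>L\<^sup>p\<close> and for the norm.\<close>

definition weak_gradient :: "'a::euclidean_space set \<Rightarrow> ('a \<Rightarrow> real) \<Rightarrow> 'a \<Rightarrow> 'a"
  where "weak_gradient \<Omega> u = (SOME G. has_weak_gradient \<Omega> u G)"

definition sobolev :: "ennreal \<Rightarrow> 'a::euclidean_space set \<Rightarrow> ('a \<Rightarrow> real) set"
  where "sobolev p \<Omega> = {u \<in> Lp p \<Omega>. \<exists>G. has_weak_gradient \<Omega> u G \<and> G \<in> Lp p \<Omega>}"

definition sobolev_norm :: "ennreal \<Rightarrow> 'a::euclidean_space set \<Rightarrow> ('a \<Rightarrow> real) \<Rightarrow> real"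
  where "sobolev_norm p \<Omega> u = Lp_norm p \<Omega> u + Lp_norm p \<Omega> (weak_gradient \<Omega> u)"

definition hajlasz_gradients ::
    "ennreal \<Rightarrow> 'a::euclidean_space set \<Rightarrow> ('a \<Rightarrow> real) \<Rightarrow> ('a \<Rightarrow> real) set"
  where "hajlasz_gradients p \<Omega> u =
    {g \<in> Lp p \<Omega>. (\<forall>z\<in>\<Omega>. 0 \<le> g z) \<and>
       (\<exists>E. E \<subseteq> \<Omega> \<and> E \<in> null_sets lebesgue \<and>
         (\<forall>z1\<in>\<Omega> - E. \<forall>z2\<in>\<Omega> - E. \<bar>u z1 - u z2\<bar> \<le> norm (z1 - z2) * (g z1 + g z2)))}"

definition hajlasz_sobolev :: "ennreal \<Rightarrow> 'a::euclidean_space set \<Rightarrow> ('a \<Rightarrow> real) set"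
  where "hajlasz_sobolev p \<Omega> = {u \<in> Lp p \<Omega>. hajlasz_gradients p \<Omega> u \<noteq> {}}"

definition hajlasz_sobolev_norm :: "ennreal \<Rightarrow> 'a::euclidean_space set \<Rightarrow> ('a \<Rightarrow> real) \<Rightarrow> real"
  where "hajlasz_sobolev_norm p \<Omega> u =
    Lp_norm p \<Omega> u + (INF g\<in>hajlasz_gradients p \<Omega> u. Lp_norm p \<Omega> g)"

text \<open>The ambient space \<open>\<real>\<^sup>n\<close> with \<open>n \<ge> 2\<close> is \<open>real \<times> (real ^ 'm)\<close> with \<open>n = 1 + CARD('m)\<close>; its product
  norm is the Euclidean norm.\<close>

definition cusp_domain :: "(real \<Rightarrow> real) \<Rightarrow> (real \<times> (real ^ 'm::finite)) set"
  where "cusp_domain \<psi> =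
    {(t, x). 0 < t \<and> t < 1 \<and> norm x < \<psi> t} \<union> {(t, x). 1 \<le> t \<and> t < 2 \<and> norm x < \<psi> 1}"

end

theory Submission
  imports Defs
begin

text \<open>
  Both inclusions compare a Hajlasz gradient \<open>g\<close> of \<open>u\<close> with the weak gradient of
  \<open>u\<close>, and each of them comes with a norm estimate.

  If \<open>g\<close> is a Hajlasz gradient, the difference quotients of \<open>u\<close> in a coordinate
  direction \<open>e\<close> satisfy \<open>|u(z + t e) - u(z)| / t \<le> g(z) + g(z + t e)\<close>. Along a
  suitable sequence \<open>t\<^sub>j \<rightarrow> 0\<close> they are dominated by one integrable function, so
  convex combinations of them converge almost everywhere (\<open>dominated_midpoint_limit\<close>). The limit is
  a weak derivative that is bounded by \<open>2g\<close>
  (\<open>hajlasz_imp_weak_directional_derivative\<close>). This part holds on every open set of finite positive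
  measure.

  The converse uses the geometry of the cusp domain. Let \<open>f = |\<nabla>u|\<close>, extended by
  \<open>0\<close>. Since \<open>\<psi>\<close> is increasing, from each point one may move upwards, and two
  points are joined by a vertical segment from the first point to a height \<open>s\<close> above both, a detour
  across the horizontal ball at that height, and a vertical segment down to the second point. (Two points near
  the lid \<open>t = 2\<close> are handled within the cylinder.) The vertical pieces cost the maximal function
  \<open>M\<^sub>1 f\<close> in the variable \<open>t\<close> at the given points. The horizontal piece costs
  the full maximal function \<open>Mf\<close>, but at points of height \<open>s\<close> instead of at the given
  ones; averaging over \<open>s\<close> replaces it by \<open>M\<^sub>1 (Mf)\<close> at the given points
  (\<open>hajlasz_estimate_along_paths\<close>, \<open>cusp_domain_hajlasz_estimate\<close>). However thin the
  cusp is, the constants depend only on the dimension and on \<open>\<psi>(1)\<close>. Hence a constant multiple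
  of \<open>M\<^sub>1 f + M\<^sub>1 (Mf)\<close> is a Hajlasz gradient of \<open>u\<close>. The maximal theorem,
  on the whole space and on slices, bounds its \<open>L\<^sup>p\<close> norm by that of \<open>f\<close>, and
  this is where \<open>p > 1\<close> matters.

  A Sobolev function has no values on segments, so the path argument is carried out for the mollifications of
  \<open>u\<close>. They have the mollifications of \<open>f\<close> as upper gradients
  (\<open>mollify_upper_gradient\<close>), and since averages over balls commute with mollification,
  \<open>M(f\<^sub>e) \<le> (Mf)\<^sub>e\<close>; both sides of the estimate then pass to the limit almost
  everywhere (\<open>weak_gradient_imp_hajlasz\<close>).
\<close>

section \<open>Smooth kernels\<close>

lemma Ck_SucI:
  assumes "\<And>x. (f has_derivative f' x) (at x)" and "\<And>v. Ck k (\<lambda>x. f' x v)"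
  shows "Ck (Suc k) f"
proof -
  have eq: "frechet_derivative f (at x) = f' x" for x
    using frechet_derivative_at[OF assms(1)] by simp
  show ?thesis
    using assms by (auto simp: eq differentiable_def)
qed

lemma Ck_Suc_has_derivative:
  assumes "Ck (Suc k) f"
  shows "(f has_derivative frechet_derivative f (at x)) (at x)"
  using assms by (simp add: frechet_derivative_works)

lemma Ck_Suc_imp_Ck: "Ck (Suc k) f \<Longrightarrow> Ck k f"
proof (induction k arbitrary: f)
  case 0
  then show ?case
    by (auto simp: continuous_on_eq_continuous_at intro: differentiable_imp_continuous_within)
next
  case (Suc k)
  then show ?case by (metis Ck.simps(2))
qed

lemma Ck_const: "Ck k (\<lambda>x. c)"
  by (induction k arbitrary: c) (auto intro!: Ck_SucI[where f'="\<lambda>_ _. 0"])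

lemma Ck_add: "Ck k f \<Longrightarrow> Ck k g \<Longrightarrow> Ck k (\<lambda>x. f x + g x)"
proof (induction k arbitrary: f g)
  case 0
  then show ?case by (auto intro: continuous_on_add)
next
  case (Suc k)
  show ?case
    using Suc.prems
    by (intro Ck_SucI[OF has_derivative_add[OF Ck_Suc_has_derivative Ck_Suc_has_derivative]] Suc.IH) auto
qed

lemma Ck_mult: "Ck k f \<Longrightarrow> Ck k g \<Longrightarrow> Ck k (\<lambda>x. f x * g x)"
proof (induction k arbitrary: f g)
  case 0
  then show ?case by (auto intro: continuous_on_mult)
next
  case (Suc k)
  show ?case
    using Suc.prems Ck_Suc_imp_Ck[OF Suc.prems(1)] Ck_Suc_imp_Ck[OF Suc.prems(2)]
    by (intro Ck_SucI[OF has_derivative_mult[OF Ck_Suc_has_derivative Ck_Suc_has_derivative]] Suc.IH Ck_add) auto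
qed

lemma Ck_linear:
  assumes "linear f" shows "Ck k f"
proof (cases k)
  case 0
  then show ?thesis using assms by (simp add: linear_continuous_on linear_conv_bounded_linear)
next
  case (Suc j)
  show ?thesis unfolding Suc
    by (rule Ck_SucI[where f'="\<lambda>_. f"])
       (use assms in \<open>auto simp: linear_conv_bounded_linear Ck_const intro: bounded_linear_imp_has_derivative\<close>)
qed

lemma Ck_affine_comp:
  assumes "Ck k f" shows "Ck k (\<lambda>x. f (a + c *\<^sub>R x))"
  using assms
proof (induction k arbitrary: f)
  case 0
  then show ?case
    by (auto intro!: continuous_on_compose2[of UNIV f] continuous_intros)
next
  case (Suc k)
  have d: "((\<lambda>x. f (a + c *\<^sub>R x)) has_derivative (\<lambda>v. frechet_derivative f (at (a + c *\<^sub>R x)) (c *\<^sub>R v))) (at x)" for x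
    by (rule has_derivative_compose[OF _ Ck_Suc_has_derivative[OF Suc.prems]])
       (auto intro!: derivative_eq_intros)
  show ?case
    using Suc.prems by (intro Ck_SucI[OF d] Suc.IH) auto
qed

text \<open>
  The functions \<open>F\<^sub>n(x) = x\<^sup>-\<^sup>n exp(-1/x)\<close>, extended by \<open>0\<close> to the
  left of the origin. The family is closed under differentiation,
  \<open>F\<^sub>n' = F\<^bsub>n+2\<^esub> - n F\<^bsub>n+1\<^esub>\<close>, so that smoothness of all its
  members follows from a single induction on the order of differentiability.
\<close>

definition flat_exp :: "nat \<Rightarrow> real \<Rightarrow> real"
  where "flat_exp n x = (if 0 < x then exp (- inverse x) / x ^ n else 0)"

lemma flat_exp_tendsto_0: "((\<lambda>x. exp (- inverse x) / x ^ n) \<longlongrightarrow> 0) (at_right (0::real))"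
proof -
  have "((\<lambda>y::real. y ^ n / exp y) \<longlongrightarrow> 0) at_top"
    by (rule tendsto_power_div_exp_0)
  then have "((\<lambda>x::real. inverse x ^ n / exp (inverse x)) \<longlongrightarrow> 0) (at_right 0)"
    by (rule filterlim_compose[OF _ filterlim_inverse_at_top_right])
  then show ?thesis
    by (simp add: exp_minus field_simps power_inverse)
qed

lemma DERIV_flat_exp:
  "(flat_exp n has_real_derivative (flat_exp (n + 2) x - real n * flat_exp (n + 1) x)) (at x)"
proof -
  consider "x > 0" | "x < 0" | "x = 0" by linarith
  then show ?thesis
  proof cases
    case 1
    have "((\<lambda>x. exp (- inverse x) / x ^ n) has_real_derivative
        (flat_exp (n + 2) x - real n * flat_exp (n + 1) x)) (at x)"
    proof (cases n)
      case 0
      then show ?thesis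
        using 1 by (auto intro!: derivative_eq_intros simp: flat_exp_def divide_simps power2_eq_square)
    next
      case (Suc m)
      have "real m * x ^ (m - Suc 0) * x = real m * x ^ m"
        by (cases m) auto
      then have "(x ^ m + real m * x ^ (m - Suc 0) * x) = (1 + real m) * x ^ m"
        by (simp add: algebra_simps)
      then show ?thesis
        using 1 Suc by (auto intro!: derivative_eq_intros simp: flat_exp_def divide_simps power2_eq_square)
          (simp add: algebra_simps)
    qed
    moreover have "\<forall>\<^sub>F y in nhds x. exp (- inverse y) / y ^ n = flat_exp n y"
      using eventually_nhds_in_open[of "{0<..}" x] 1 
      by (auto simp: flat_exp_def elim!: eventually_mono)
    ultimately show ?thesis
      by (rule DERIV_cong_ev[OF refl _ refl, THEN iffD1, rotated])
  next
    case 2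
    have "\<forall>\<^sub>F y in nhds x. 0 = flat_exp n y"
      using eventually_nhds_in_open[of "{..<0}" x] 2
      by (auto simp: flat_exp_def elim!: eventually_mono)
    moreover have "((\<lambda>x. 0) has_real_derivative (flat_exp (n + 2) x - real n * flat_exp (n + 1) x)) (at x)"
      using 2 by (simp add: flat_exp_def)
    ultimately show ?thesis
      by (rule DERIV_cong_ev[OF refl _ refl, THEN iffD1])
  next
    case 3
    have "((\<lambda>h. flat_exp n h / h) \<longlongrightarrow> 0) (at 0)"
      unfolding filterlim_at_split
    proof
      show "((\<lambda>h. flat_exp n h / h) \<longlongrightarrow> 0) (at_left 0)"
        by (rule tendsto_eventually) (auto simp: eventually_at_filter flat_exp_def)
      have "\<forall>\<^sub>F h in at_right 0. exp (- inverse h) / h ^ Suc n = flat_exp n h / h"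
        by (auto simp: eventually_at_filter flat_exp_def)
      then show "((\<lambda>h. flat_exp n h / h) \<longlongrightarrow> 0) (at_right 0)"
        using flat_exp_tendsto_0[of "Suc n"] by (rule Lim_transform_eventually[rotated])
    qed
    then show ?thesis
      using 3 by (simp add: DERIV_def flat_exp_def)
  qed
qed

lemma Ck_flat_exp_sphere: "Ck k (\<lambda>z::'a::euclidean_space. flat_exp n (1 - z \<bullet> z))"
proof (induction k arbitrary: n)
  case 0
  have "continuous_on UNIV (flat_exp n)"
    using DERIV_isCont[OF DERIV_flat_exp] by (simp add: continuous_on_eq_continuous_at)
  then show ?case
    by (auto intro!: continuous_on_compose2[of UNIV "flat_exp n"] continuous_intros)
next
  case (Suc k)
  have d: "((\<lambda>z. flat_exp n (1 - z \<bullet> z)) has_derivative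
      (\<lambda>v. (flat_exp (n + 2) (1 - z \<bullet> z) + - real n * flat_exp (n + 1) (1 - z \<bullet> z)) * (- 2 * (z \<bullet> v)))) (at z)" for z :: 'a
    by (rule has_derivative_eq_rhs[OF has_derivative_compose[OF _ DERIV_flat_exp[unfolded has_field_derivative_def], of "\<lambda>z. 1 - z \<bullet> z"]])
       (auto intro!: derivative_eq_intros simp: inner_commute fun_eq_iff algebra_simps)
  show ?case
    by (intro Ck_SucI[OF d] Ck_mult Ck_add Suc.IH Ck_const Ck_linear)
       (auto intro!: linearI simp: inner_simps)
qed

text \<open>
  A positive multiple of \<open>F\<^sub>0(1 - |z|\<^sup>2)\<close>. Weak gradients are tested against smooth
  functions only, so an explicit smooth kernel is what makes them accessible at all.
\<close>

lemma exists_mollifier: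
  obtains \<phi> :: "'a::euclidean_space \<Rightarrow> real" where "\<And>k. Ck k \<phi>" "\<And>z. 0 \<le> \<phi> z"
    "\<And>z. 1 \<le> norm z \<Longrightarrow> \<phi> z = 0" "integrable lborel \<phi>" "(\<integral>z. \<phi> z \<partial>lborel) = 1"
proof -
  define f where "f = (\<lambda>z::'a. flat_exp 0 (1 - z \<bullet> z))"
  have Ckf: "Ck k f" for k unfolding f_def by (rule Ck_flat_exp_sphere)
  have nn: "0 \<le> f z" for z by (simp add: f_def flat_exp_def)
  have supp: "f z = 0" if "1 \<le> norm z" for z
    using that by (simp add: f_def flat_exp_def dot_square_norm power_less_one_iff not_less)
  have cont: "continuous_on A f" for A using Ckf[of 0] by (auto intro: continuous_on_subset)
  have "f = (\<lambda>z. indicator (cball 0 1) z *\<^sub>R f z)"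
    using supp by (auto simp: fun_eq_iff indicator_def)
  moreover have "integrable lborel (\<lambda>z. indicator (cball 0 1) z *\<^sub>R f z)"
    using borel_integrable_compact[OF compact_cball cont, of 0 1] by simp
  ultimately have int: "integrable lborel f" by simp
  have "(\<integral>z. f z \<partial>lborel) \<noteq> 0"
  proof
    assume "(\<integral>z. f z \<partial>lborel) = 0"
    then have "AE z in lborel. f z = 0"
      using integral_nonneg_eq_0_iff_AE[OF int] nn by simp
    moreover have "f z \<noteq> 0" if "z \<in> ball 0 1" for z
      using that by (simp add: f_def flat_exp_def dot_square_norm power_less_one_iff)
    ultimately have "AE z in lborel. z \<notin> ball (0::'a) 1"
      by (auto elim!: eventually_mono)
    then have "emeasure lborel (ball (0::'a) 1) = 0"
      by (subst (asm) AE_iff_null_sets[symmetric]) auto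
    then have "measure lborel (ball (0::'a) 1) = 0"
      by (simp add: measure_def)
    then show False
      using content_ball_gt_0_iff[of "0::'a" 1] by simp
  qed
  moreover have "0 \<le> (\<integral>z. f z \<partial>lborel)" using nn by simp
  ultimately have c: "0 < (\<integral>z. f z \<partial>lborel)" by linarith
  show ?thesis
  proof
    show "Ck k (\<lambda>z. inverse (\<integral>z. f z \<partial>lborel) * f z)" for k
      by (intro Ck_mult Ck_const Ckf)
  qed (use nn supp int c in auto)
qed

section \<open>The Hardy-Littlewood maximal theorem\<close>

lemma ennreal_divide_le_iff:
  fixes a b c :: ennreal
  assumes "b \<noteq> 0" "b < top"
  shows "a / b \<le> c \<longleftrightarrow> a \<le> c * b"
proof
  assume "a / b \<le> c"
  then have "a / b * b \<le> c * b" by (rule mult_right_mono) simp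
  then show "a \<le> c * b" using assms by (simp add: ennreal_divide_times)
next
  assume "a \<le> c * b"
  then show "a / b \<le> c"
    using assms by (intro divide_le_posI_ennreal) (auto simp: mult.commute zero_less_iff_neq_zero)
qed

text \<open>
  The centred Hardy-Littlewood maximal function. Values in \<open>ennreal\<close> avoid any integrability side
  condition, in particular when maximal functions are iterated.
\<close>

definition maximal_function :: "('a::euclidean_space \<Rightarrow> ennreal) \<Rightarrow> 'a \<Rightarrow> ennreal"
  where "maximal_function f a =
    (SUP r\<in>{0<..}. (\<integral>\<^sup>+y\<in>ball a r. f y \<partial>lborel) / emeasure lborel (ball a r))"

lemma emeasure_ball_pos: "0 < r \<Longrightarrow> emeasure lborel (ball (a::'a::euclidean_space) r) \<noteq> 0"
  by (simp add: emeasure_ball ennreal_eq_0_iff not_le)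

lemma emeasure_ball_less_top: "emeasure lborel (ball (a::'a::euclidean_space) r) < top"
  using emeasure_lborel_ball_finite[of a r] by simp

lemma maximal_function_le_iff:
  "maximal_function f a \<le> c \<longleftrightarrow>
    (\<forall>r>0. (\<integral>\<^sup>+y\<in>ball a r. f y \<partial>lborel) \<le> c * emeasure lborel (ball a r))"
  unfolding maximal_function_def
  by (auto simp: SUP_le_iff ennreal_divide_le_iff emeasure_ball_pos emeasure_ball_less_top)

lemma ball_nn_integral_le_maximal_function:
  assumes "0 < r"
  shows "(\<integral>\<^sup>+y\<in>ball a r. f y \<partial>lborel) \<le> maximal_function f a * emeasure lborel (ball a r)"
  using maximal_function_le_iff[of f a "maximal_function f a"] assms by auto

lemma maximal_function_mono: "(\<And>x. f x \<le> g x) \<Longrightarrow> maximal_function f a \<le> maximal_function g a"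
  unfolding maximal_function_def
  by (intro SUP_mono, rule bexI)
    (auto intro!: divide_right_mono_ennreal nn_integral_mono mult_right_mono)

lemma maximal_function_le_const: "(\<And>x. f x \<le> c) \<Longrightarrow> maximal_function f a \<le> c"
  unfolding maximal_function_le_iff
  by (auto simp flip: nn_integral_cmult_indicator intro!: nn_integral_mono mult_right_mono)

text \<open>
  A ball is the increasing union of concentric balls of rational radius. The supremum thus becomes countable,
  which gives measurability.
\<close>

lemma maximal_function_eq_rational:
  assumes [measurable]: "f \<in> borel_measurable borel"
  shows "maximal_function f a =
    (SUP r\<in>{q\<in>\<rat>. 0 < q}. (\<integral>\<^sup>+y\<in>ball a r. f y \<partial>lborel) / emeasure lborel (ball a r))" (is "_ = ?S")
proof (rule antisym)
  show "maximal_function f a \<le> ?S"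
    unfolding maximal_function_le_iff
  proof (intro allI impI)
    fix r :: real assume "0 < r"
    let ?Q = "{q\<in>\<rat>. 0 < q \<and> q < r}"
    have "?Q \<noteq> {}" using Rats_dense_in_real[OF \<open>0 < r\<close>] by auto
    have q: "(\<integral>\<^sup>+y\<in>ball a q. f y \<partial>lborel) \<le> ?S * emeasure lborel (ball a r)" if "q \<in> ?Q" for q
    proof -
      have "(\<integral>\<^sup>+y\<in>ball a q. f y \<partial>lborel) / emeasure lborel (ball a q) \<le> ?S"
        using that by (intro SUP_upper) auto
      then have "(\<integral>\<^sup>+y\<in>ball a q. f y \<partial>lborel) \<le> ?S * emeasure lborel (ball a q)"
        using that by (subst (asm) ennreal_divide_le_iff) (auto simp: emeasure_ball_pos emeasure_ball_less_top)
      also have "\<dots> \<le> ?S * emeasure lborel (ball a r)"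
        using that by (intro mult_left_mono emeasure_mono subset_ball) auto
      finally show ?thesis .
    qed
    have "(\<integral>\<^sup>+y\<in>ball a r. f y \<partial>lborel) = emeasure (density lborel f) (ball a r)"
      by (simp add: emeasure_density)
    also have "\<dots> = (SUP q\<in>?Q. emeasure (density lborel f) (ball a q))"
    proof -
      \<comment> \<open>Smaller balls of radius r - r/(n+1) exhaust the ball; a rational radius
        lies above each of these radii.\<close>
      have "incseq (\<lambda>n::nat. ball a (r - r / (real n + 1)))"
        using \<open>0 < r\<close> by (intro incseq_SucI subset_ball) (simp add: frac_le)
      have "emeasure (density lborel f) (ball a r) \<le> (SUP q\<in>?Q. emeasure (density lborel f) (ball a q))"
      proof -
        have "(\<Union>n::nat. ball a (r - r / (real n + 1))) = ball a r"
        proof (intro equalityI subsetI)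
          fix x assume x: "x \<in> ball a r"
          obtain n :: nat where "r / (r - dist a x) < n" using reals_Archimedean2 by blast
          then have "r / (real n + 1) < r - dist a x"
            using x \<open>0 < r\<close> by (simp add: field_simps)
          then show "x \<in> (\<Union>n::nat. ball a (r - r / (real n + 1)))" by (auto intro!: exI[of _ n] simp: add.commute)
        qed (use \<open>0 < r\<close> in \<open>auto elim!: less_le_trans\<close>)
        then have "emeasure (density lborel f) (ball a r) =
            (SUP n::nat. emeasure (density lborel f) (ball a (r - r / (real n + 1))))"
          using SUP_emeasure_incseq[OF _ \<open>incseq _\<close>, of "density lborel f"]
          by (simp add: image_subset_iff)
        also have "\<dots> \<le> (SUP q\<in>?Q. emeasure (density lborel f) (ball a q))"
        proof (intro SUP_least)
          fix n :: nat
          have "r - r / (real n + 1) < r" using \<open>0 < r\<close> by simp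
          moreover have "0 \<le> r - r / (real n + 1)" using \<open>0 < r\<close> by (simp add: field_simps)
          ultimately obtain q where "q \<in> \<rat>" "r - r / (real n + 1) < q" "q < r" using Rats_dense_in_real by blast
          then show "emeasure (density lborel f) (ball a (r - r / (real n + 1))) \<le>
              (SUP q\<in>?Q. emeasure (density lborel f) (ball a q))"
            using \<open>0 \<le> r - r / (real n + 1)\<close>
            by (intro SUP_upper2[of q] emeasure_mono subset_ball) auto
        qed
        finally show ?thesis .
      qed
      moreover have "(SUP q\<in>?Q. emeasure (density lborel f) (ball a q)) \<le> emeasure (density lborel f) (ball a r)"
        by (intro SUP_least emeasure_mono subset_ball) auto
      ultimately show ?thesis by (rule antisym)
    qed
    also have "\<dots> \<le> ?S * emeasure lborel (ball a r)"
      using q by (intro SUP_least) (simp add: emeasure_density)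
    finally show "(\<integral>\<^sup>+y\<in>ball a r. f y \<partial>lborel) \<le> ?S * emeasure lborel (ball a r)" .
  qed
  show "?S \<le> maximal_function f a"
    unfolding maximal_function_def by (intro SUP_subset_mono) auto
qed

text \<open>
  Joint measurability in a point and a parameter is needed for maximal functions that are taken along slices of
  a product space.
\<close>

lemma borel_measurable_maximal_function_param:
  fixes f :: "'x \<Rightarrow> 'a::euclidean_space \<Rightarrow> ennreal"
  assumes [measurable]: "case_prod f \<in> borel_measurable (M \<Otimes>\<^sub>M lborel)"
  shows "(\<lambda>(x, a). maximal_function (f x) a) \<in> borel_measurable (M \<Otimes>\<^sub>M lborel)"
proof -
  have [measurable]: "f x \<in> borel_measurable borel" if "x \<in> space M" for x
    using measurable_Pair2[OF assms that] by simp
  have "(\<lambda>(x, a). (\<integral>\<^sup>+y\<in>ball a r. f x y \<partial>lborel) / emeasure lborel (ball a r)) \<in> borel_measurable (M \<Otimes>\<^sub>M lborel)"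
    if "0 < r" for r
  proof -
    have "(\<lambda>(x, a). \<integral>\<^sup>+y. f x y * (if dist a y < r then 1 else 0) \<partial>lborel) \<in> borel_measurable (M \<Otimes>\<^sub>M lborel)"
      by measurable
    moreover have "(\<lambda>(x, a). \<integral>\<^sup>+y. f x y * (if dist a y < r then 1 else 0) \<partial>lborel) = (\<lambda>(x, a). \<integral>\<^sup>+y\<in>ball a r. f x y \<partial>lborel)"
      by (auto simp: fun_eq_iff indicator_def intro!: nn_integral_cong)
    ultimately show ?thesis
      unfolding split_beta' using that
      by (simp only: emeasure_ball less_imp_le) (rule borel_measurable_divide_ennreal; simp)
  qed
  then have "(\<lambda>z. SUP r\<in>{q\<in>\<rat>. 0 < q}. (case z of (x, a) \<Rightarrow> (\<integral>\<^sup>+y\<in>ball a r. f x y \<partial>lborel) / emeasure lborel (ball a r))) \<in> borel_measurable (M \<Otimes>\<^sub>M lborel)"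
    by (intro borel_measurable_SUP countable_Collect countable_rat) auto
  moreover have "(case z of (x, a) \<Rightarrow> maximal_function (f x) a) =
      (SUP r\<in>{q\<in>\<rat>. 0 < q}. (case z of (x, a) \<Rightarrow> (\<integral>\<^sup>+y\<in>ball a r. f x y \<partial>lborel) / emeasure lborel (ball a r)))"
    if "z \<in> space (M \<Otimes>\<^sub>M lborel)" for z
    using that by (auto simp: space_pair_measure maximal_function_eq_rational split: prod.split)
  ultimately show ?thesis
    by (rule measurable_cong[THEN iffD2, rotated])
qed

lemma borel_measurable_maximal_function [measurable]:
  assumes [measurable]: "f \<in> borel_measurable borel"
  shows "maximal_function f \<in> borel_measurable borel"
proof -
  have "(\<lambda>(x, a). f a) \<in> borel_measurable (count_space {()} \<Otimes>\<^sub>M lborel)"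
    unfolding split_beta' by (rule measurable_compose[OF measurable_snd]) simp
  from borel_measurable_maximal_function_param[OF this]
  have "(\<lambda>(x, a). maximal_function f a) \<in> borel_measurable (count_space {()} \<Otimes>\<^sub>M lborel)" .
  from measurable_Pair2[OF this, of "()"] show ?thesis by simp
qed

text \<open>
  Each point of the superlevel set is the centre of a ball on which the average of \<open>f\<close> exceeds
  \<open>l\<close>. The measure of such a ball is at most \<open>\<integral>f / l\<close>, so the radii are
  bounded and the Vitali covering lemma selects disjoint balls whose fivefold enlargements cover the set;
  summing over them costs \<open>5\<^sup>n\<close>.
\<close>

theorem maximal_function_weak_type:
  fixes f :: "'a::euclidean_space \<Rightarrow> ennreal"
  assumes [measurable]: "f \<in> borel_measurable borel" and l: "0 < l"
  shows "ennreal l * emeasure lborel {a. ennreal l < maximal_function f a} \<le> 5 ^ DIM('a) * (\<integral>\<^sup>+y. f y \<partial>lborel)"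
proof (cases "(\<integral>\<^sup>+y. f y \<partial>lborel) = top")
  case True
  then show ?thesis by (simp add: ennreal_mult_top)
next
  case False
  let ?S = "{a. ennreal l < maximal_function f a}"
  obtain V where V: "(\<integral>\<^sup>+y. f y \<partial>lborel) = ennreal V" "0 \<le> V"
    using False by (cases "(\<integral>\<^sup>+y. f y \<partial>lborel)") auto
  have "\<exists>r. 0 < r \<and> ennreal l * emeasure lborel (ball a r) < (\<integral>\<^sup>+y\<in>ball a r. f y \<partial>lborel)" if "a \<in> ?S" for a
    using that maximal_function_le_iff[of f a "ennreal l"] by (auto simp: not_le)
  then obtain r where r0: "\<And>a. a \<in> ?S \<Longrightarrow> 0 < r a"
    and r: "\<And>a. a \<in> ?S \<Longrightarrow> ennreal l * emeasure lborel (ball a (r a)) < (\<integral>\<^sup>+y\<in>ball a (r a). f y \<partial>lborel)"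
    by metis
  let ?c = "unit_ball_vol (real DIM('a))"
  have "?c > 0" by simp
  define B where "B = max 1 (V / (l * ?c))"
  have rB: "r a \<le> B" if a: "a \<in> ?S" for a
  proof (cases "r a \<le> 1")
    case False
    have "ennreal (l * (?c * r a ^ DIM('a))) \<le> ennreal V"
    proof -
      have "ennreal (l * (?c * r a ^ DIM('a))) = ennreal l * emeasure lborel (ball a (r a))"
        using r0[OF a] l by (simp add: emeasure_ball ennreal_mult')
      also have "\<dots> \<le> (\<integral>\<^sup>+y\<in>ball a (r a). f y \<partial>lborel)"
        by (rule less_imp_le[OF r[OF a]])
      also have "\<dots> \<le> (\<integral>\<^sup>+y. f y \<partial>lborel)"
        by (intro nn_integral_mono) (simp add: indicator_def)
      finally show ?thesis unfolding V(1) .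
    qed
    then have "l * (?c * r a ^ DIM('a)) \<le> V" using V(2) by simp
    moreover have "r a \<le> r a ^ DIM('a)" using False by (intro self_le_power) auto
    then have "l * (?c * r a) \<le> l * (?c * r a ^ DIM('a))"
      using l \<open>?c > 0\<close> by (intro mult_left_mono) auto
    ultimately have "l * (?c * r a) \<le> V" by linarith
    then have "r a \<le> V / (l * ?c)" using l \<open>?c > 0\<close> by (simp add: pos_le_divide_eq ac_simps)
    then show ?thesis unfolding B_def by simp
  qed (simp add: B_def)
  have "?S \<subseteq> (\<Union>a\<in>?S. ball a (r a))" using r0 by auto
  then obtain C where C: "countable C" "C \<subseteq> ?S"
    "pairwise (\<lambda>i j. disjnt (ball i (r i)) (ball j (r j))) C" "?S \<subseteq> (\<Union>i\<in>C. ball i (5 * r i))"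
    by (rule Vitali_covering_lemma_balls[where S="?S" and K="?S" and a="\<lambda>a. a" and r=r and B=B])
      (use r0 rB in auto)
  \<comment> \<open>Countable subadditivity, in the form of a sum of indicators over the countable set C.\<close>
  have "emeasure lborel ?S \<le> (\<integral>\<^sup>+a. (\<integral>\<^sup>+i. indicator (ball i (5 * r i)) a \<partial>count_space C) \<partial>lborel)"
  proof -
    have "emeasure lborel ?S = (\<integral>\<^sup>+a. indicator ?S a \<partial>lborel)" by simp
    also have "\<dots> \<le> (\<integral>\<^sup>+a. (\<integral>\<^sup>+i. indicator (ball i (5 * r i)) a \<partial>count_space C) \<partial>lborel)"
    proof (rule nn_integral_mono)
      fix a
      show "indicator ?S a \<le> (\<integral>\<^sup>+i. indicator (ball i (5 * r i)) a \<partial>count_space C)"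
      proof (cases "a \<in> ?S")
        case True
        then obtain i where i: "i \<in> C" "a \<in> ball i (5 * r i)" using C(4) by blast
        then have "1 \<le> (\<integral>\<^sup>+j. indicator {i} j \<partial>count_space C)" by simp
        also have "\<dots> \<le> (\<integral>\<^sup>+i. indicator (ball i (5 * r i)) a \<partial>count_space C)"
          using i by (intro nn_integral_mono) (auto simp: indicator_def)
        finally show ?thesis using True by simp
      qed simp
    qed
    finally show ?thesis .
  qed
  also have "\<dots> = (\<integral>\<^sup>+i. (\<integral>\<^sup>+a. indicator (ball i (5 * r i)) a \<partial>lborel) \<partial>count_space C)"
    by (rule nn_integral_count_space_nn_integral[OF C(1)]) (simp add: borel_measurable_indicator)
  also have "\<dots> = (\<integral>\<^sup>+i. 5 ^ DIM('a) * emeasure lborel (ball i (r i)) \<partial>count_space C)"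
  proof (rule nn_integral_cong)
    fix i assume "i \<in> space (count_space C)"
    then have "0 < r i" using C(2) r0 by auto
    then have "emeasure lborel (ball i (5 * r i)) = ennreal (5 ^ DIM('a) * (?c * r i ^ DIM('a)))"
      by (simp add: emeasure_ball power_mult_distrib ac_simps)
    also have "\<dots> = ennreal (5 ^ DIM('a)) * emeasure lborel (ball i (r i))"
      using \<open>0 < r i\<close> by (subst ennreal_mult') (auto simp: emeasure_ball)
    also have "ennreal (5 ^ DIM('a)) = 5 ^ DIM('a)" by (simp flip: ennreal_power)
    finally show "(\<integral>\<^sup>+a. indicator (ball i (5 * r i)) a \<partial>lborel) = 5 ^ DIM('a) * emeasure lborel (ball i (r i))"
      by simp
  qed
  finally have "ennreal l * emeasure lborel ?S \<le> ennreal l * (\<integral>\<^sup>+i. 5 ^ DIM('a) * emeasure lborel (ball i (r i)) \<partial>count_space C)"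
    by (rule mult_left_mono) simp
  also have "\<dots> = 5 ^ DIM('a) * (\<integral>\<^sup>+i. ennreal l * emeasure lborel (ball i (r i)) \<partial>count_space C)"
    by (subst (1 2) nn_integral_cmult) (auto simp: mult.left_commute)
  also have "\<dots> \<le> 5 ^ DIM('a) * (\<integral>\<^sup>+i. emeasure (density lborel f) (ball i (r i)) \<partial>count_space C)"
    using r C(2) by (intro mult_left_mono nn_integral_mono) (auto simp: emeasure_density less_imp_le)
  also have "(\<integral>\<^sup>+i. emeasure (density lborel f) (ball i (r i)) \<partial>count_space C) = emeasure (density lborel f) (\<Union>i\<in>C. ball i (r i))"
    using C(3) by (intro emeasure_UN_countable[symmetric] C(1))
      (auto simp: disjoint_family_on_def pairwise_def disjnt_def)
  also have "\<dots> \<le> emeasure (density lborel f) UNIV"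
    by (intro emeasure_mono) auto
  also have "\<dots> = (\<integral>\<^sup>+y. f y \<partial>lborel)" by (simp add: emeasure_density)
  finally show ?thesis by (auto simp: mult_left_mono)
qed

text \<open>
  The power \<open>x\<^sup>p\<close> with \<open>\<infinity>\<^sup>p = \<infinity>\<close>, so that a finite
  integral of \<open>(Mf)\<^sup>p\<close> also says that the maximal function is finite almost everywhere.
\<close>

definition ennpow :: "ennreal \<Rightarrow> real \<Rightarrow> ennreal"
  where "ennpow x p = (if x = top then top else ennreal (enn2real x powr p))"

lemma ennpow_ennreal [simp]: "0 \<le> x \<Longrightarrow> ennpow (ennreal x) p = ennreal (x powr p)"
  by (simp add: ennpow_def)

lemma ennpow_top [simp]: "ennpow top p = top"
  by (simp add: ennpow_def)

lemma borel_measurable_ennpow [measurable]: "(\<lambda>x. ennpow x p) \<in> borel_measurable borel"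
  unfolding ennpow_def by measurable

lemma ennpow_mono: "0 \<le> p \<Longrightarrow> x \<le> y \<Longrightarrow> ennpow x p \<le> ennpow y p"
  by (cases x; cases y) (auto intro: powr_mono2 simp: top_unique)

lemma ennpow_mult_ennreal:
  assumes "0 < c" shows "ennpow (ennreal c * x) p = ennreal (c powr p) * ennpow x p"
  using assms by (cases x) (auto simp: powr_mult ennreal_mult_top simp flip: ennreal_mult)

lemma ennpow_add_le:
  assumes "0 \<le> p" shows "ennpow (x + y) p \<le> ennreal (2 powr p) * (ennpow x p + ennpow y p)"
proof -
  have "ennpow (x + y) p \<le> ennpow (ennreal 2 * max x y) p"
    using assms by (intro ennpow_mono) (auto simp: mult_2 max_def intro: add_mono)
  also have "\<dots> = ennreal (2 powr p) * ennpow (max x y) p"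
    by (rule ennpow_mult_ennreal) simp
  also have "\<dots> \<le> ennreal (2 powr p) * (ennpow x p + ennpow y p)"
    by (intro mult_left_mono) (auto simp: max_def)
  finally show ?thesis .
qed

text \<open>
  The primitive \<open>\<integral>\<^sub>0\<^sup>x l\<^sup>a dl = x\<^bsup>a+1\<^esup> / (a + 1)\<close> in a
  form that still holds for \<open>x = \<infinity>\<close>.
\<close>

lemma ennpow_layer_cake:
  assumes a: "-1 < a"
  shows "(\<integral>\<^sup>+l\<in>{0<..}. ennreal (l powr a) * (if ennreal l < x then 1 else 0) \<partial>lborel) =
    ennreal (1 / (a + 1)) * ennpow x (a + 1)"
proof -
  have real_case: "(\<integral>\<^sup>+l\<in>{0<..}. ennreal (l powr a) * (if ennreal l < ennreal c then 1 else 0) \<partial>lborel) =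
    ennreal (1 / (a + 1)) * ennpow (ennreal c) (a + 1)" if c: "0 \<le> c" for c
  proof -
    have "((\<lambda>l. if l \<in> {0..c} then l powr a else 0) has_integral (c powr (a+1) / (a+1))) UNIV"
      using has_integral_powr_from_0[OF a c] by (simp only: has_integral_restrict_UNIV)
    then have "(\<integral>\<^sup>+l. ennreal (if l \<in> {0..c} then l powr a else 0) \<partial>lborel) = ennreal (c powr (a+1) / (a+1))"
      by (intro nn_integral_has_integral_lborel) auto
    moreover have "(\<integral>\<^sup>+l\<in>{0<..}. ennreal (l powr a) * (if ennreal l < ennreal c then 1 else 0) \<partial>lborel) =
        (\<integral>\<^sup>+l. ennreal (if l \<in> {0..c} then l powr a else 0) \<partial>lborel)"
    proof (rule nn_integral_cong_AE)
      have "AE l in lborel. l \<noteq> c" by (rule AE_lborel_singleton)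
      moreover have "AE l in lborel. l \<noteq> (0::real)" by (rule AE_lborel_singleton)
      ultimately show "AE l in lborel. ennreal (l powr a) * (if ennreal l < ennreal c then 1 else 0) * indicator {0<..} l =
          ennreal (if l \<in> {0..c} then l powr a else 0)"
        by eventually_elim (use c in \<open>auto simp: indicator_def ennreal_less_iff\<close>)
    qed
    ultimately show ?thesis
      using a c by (simp add: ennreal_mult'[symmetric])
  qed
  show ?thesis
  proof (cases x)
    case (real r)
    then show ?thesis using real_case by simp
  next
    case top
    have "top \<le> (\<integral>\<^sup>+l\<in>{0<..}. ennreal (l powr a) * (if ennreal l < top then 1 else 0) \<partial>lborel)"
    proof -
      let ?I = "\<integral>\<^sup>+l\<in>{0<..}. ennreal (l powr a) * (if ennreal l < top then 1 else 0) \<partial>lborel"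
      have "ennreal B \<le> ?I" if "0 \<le> B" for B
      proof -
        \<comment> \<open>c is chosen such that the integral up to c has the value B.\<close>
        define c where "c = ((a + 1) * B) powr (1 / (a + 1))"
        have "ennreal B = ennreal (1 / (a + 1)) * ennpow (ennreal c) (a + 1)"
          using a that by (simp add: c_def powr_powr flip: ennreal_mult')
        also have "\<dots> =
            (\<integral>\<^sup>+l\<in>{0<..}. ennreal (l powr a) * (if ennreal l < ennreal c then 1 else 0) \<partial>lborel)"
          by (subst real_case) (auto simp: c_def)
        also have "\<dots> \<le> ?I"
          by (intro nn_integral_mono mult_right_mono mult_left_mono) auto
        finally show ?thesis .
      qed
      then show ?thesis
        proof (cases ?I)
          case (real r)
          then have "r + 1 \<le> r" using \<open>\<And>B. 0 \<le> B \<Longrightarrow> ennreal B \<le> ?I\<close>[of "r + 1"] by simp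
          then show ?thesis by simp
        qed simp
    qed
    then show ?thesis using a top by (simp add: top_unique ennreal_mult_top)
  qed
qed

text \<open>
  Marcinkiewicz interpolation: the part of \<open>f\<close> below \<open>l/2\<close> contributes at most
  \<open>l/2\<close> to \<open>Mf\<close>, so the weak type inequality applied to the remaining part
  \<open>f1\<close> bounds the measure of \<open>{Mf > l}\<close> by
  \<open>(2 \<cdot> 5\<^sup>n / l) \<integral>\<^bsub>{f > l/2}\<^esub> f\<close>. Multiplying by
  \<open>p l\<^bsup>p-1\<^esup>\<close>, integrating over \<open>l\<close> and exchanging the integrals gives
  the result; here \<open>p > 1\<close> makes \<open>l\<^bsup>p-2\<^esup>\<close> integrable at
  \<open>0\<close>.
\<close>

theorem maximal_function_strong_type:
  fixes f :: "'a::euclidean_space \<Rightarrow> ennreal"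
  assumes [measurable]: "f \<in> borel_measurable borel" and p: "1 < p"
  shows "(\<integral>\<^sup>+z. ennpow (maximal_function f z) p \<partial>lborel)
    \<le> ennreal (5 ^ DIM('a) * 2 powr p * p / (p - 1)) * (\<integral>\<^sup>+z. ennpow (f z) p \<partial>lborel)"
proof -
  let ?C = "5 ^ DIM('a) :: real"
  define u where "u l = emeasure lborel {z. ennreal l < maximal_function f z}" for l
  define w where "w l = (\<integral>\<^sup>+z. f z * (if ennreal l < 2 * f z then 1 else 0) \<partial>lborel)" for l :: real
  have truncated: "ennreal l * u l \<le> ennreal (2 * ?C) * w l" if l: "0 < l" for l
  proof -
    define f1 where "f1 z = f z * (if ennreal l < 2 * f z then 1 else 0)" for z
    have [measurable]: "f1 \<in> borel_measurable borel" unfolding f1_def by measurable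
    have half: "ennreal (l / 2) + ennreal (l / 2) = ennreal l" using l by (simp flip: ennreal_plus)
    have f_le: "f z \<le> f1 z + ennreal (l / 2)" for z
    proof (cases "ennreal l < 2 * f z")
      case False
      then have "2 * f z \<le> 2 * ennreal (l / 2)" using half by (simp add: mult_2)
      then have "f z \<le> ennreal (l / 2)" by (subst (asm) ennreal_mult_le_mult_iff) auto
      then show ?thesis by (simp add: add_increasing)
    qed (simp add: f1_def add_increasing2)
    have "maximal_function f z \<le> maximal_function f1 z + ennreal (l / 2)" for z
      unfolding maximal_function_le_iff
    proof (intro allI impI)
      fix r :: real assume r: "0 < r"
      have [measurable]: "ball z r \<in> sets borel" by simp
      have "(\<integral>\<^sup>+y\<in>ball z r. f y \<partial>lborel) \<le> (\<integral>\<^sup>+y. f1 y * indicator (ball z r) y + ennreal (l / 2) * indicator (ball z r) y \<partial>lborel)"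
        using f_le by (intro nn_integral_mono) (auto simp: indicator_def)
      also have "\<dots> = (\<integral>\<^sup>+y\<in>ball z r. f1 y \<partial>lborel) + ennreal (l / 2) * emeasure lborel (ball z r)"
        by (subst nn_integral_add; (simp add: nn_integral_cmult_indicator; fail | measurable))
      also have "\<dots> \<le> (maximal_function f1 z + ennreal (l / 2)) * emeasure lborel (ball z r)"
        unfolding distrib_right by (intro add_right_mono ball_nn_integral_le_maximal_function r)
      finally show "(\<integral>\<^sup>+y\<in>ball z r. f y \<partial>lborel) \<le> (maximal_function f1 z + ennreal (l / 2)) * emeasure lborel (ball z r)" .
    qed
    then have shift: "maximal_function f z \<le> maximal_function f1 z + ennreal (l / 2)" for z .
    have "{z. ennreal l < maximal_function f z} \<subseteq> {z. ennreal (l / 2) < maximal_function f1 z}"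
    proof (rule subsetI, rule ccontr)
      fix z assume z: "z \<in> {z. ennreal l < maximal_function f z}" "z \<notin> {z. ennreal (l / 2) < maximal_function f1 z}"
      then have "maximal_function f1 z + ennreal (l / 2) \<le> ennreal (l / 2) + ennreal (l / 2)"
        by (intro add_right_mono) (simp add: not_less)
      with shift[of z] have "maximal_function f z \<le> ennreal l" unfolding half by (rule order_trans)
      with z show False by simp
    qed
    then have "ennreal l * u l \<le> 2 * (ennreal (l / 2) * emeasure lborel {z. ennreal (l / 2) < maximal_function f1 z})"
      unfolding u_def half[symmetric] mult_2 distrib_right by (intro add_mono mult_left_mono emeasure_mono) auto
    also have "\<dots> \<le> 2 * (5 ^ DIM('a) * (\<integral>\<^sup>+y. f1 y \<partial>lborel))"
      using l by (intro mult_left_mono maximal_function_weak_type) auto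
    also have "\<dots> = ennreal (2 * ?C) * w l"
      by (simp add: w_def f1_def ennreal_mult' mult.assoc flip: ennreal_power)
    finally show ?thesis .
  qed
  have "(\<integral>\<^sup>+z. ennpow (maximal_function f z) p \<partial>lborel) =
      ennreal p * (\<integral>\<^sup>+z. (\<integral>\<^sup>+l\<in>{0<..}. ennreal (l powr (p - 1)) * (if ennreal l < maximal_function f z then 1 else 0) \<partial>lborel) \<partial>lborel)"
    using p by (subst ennpow_layer_cake)
      (auto simp: nn_integral_cmult mult.assoc[symmetric] simp flip: ennreal_mult')
  also have "(\<integral>\<^sup>+z. (\<integral>\<^sup>+l\<in>{0<..}. ennreal (l powr (p - 1)) * (if ennreal l < maximal_function f z then 1 else 0) \<partial>lborel) \<partial>lborel)
      = (\<integral>\<^sup>+l. (\<integral>\<^sup>+z. ennreal (l powr (p - 1)) * (if ennreal l < maximal_function f z then 1 else 0) * indicator {0<..} l \<partial>lborel) \<partial>lborel)"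
    by (rule lborel_pair.Fubini') measurable
  also have "\<dots> = (\<integral>\<^sup>+l\<in>{0<..}. ennreal (l powr (p - 1)) * u l \<partial>lborel)"
  proof (rule nn_integral_cong)
    fix l :: real
    have "(\<integral>\<^sup>+z. ennreal (l powr (p - 1)) * (if ennreal l < maximal_function f z then 1 else 0) * indicator {0<..} l \<partial>lborel)
        = (\<integral>\<^sup>+z. (ennreal (l powr (p - 1)) * indicator {0<..} l) * indicator {z. ennreal l < maximal_function f z} z \<partial>lborel)"
      by (intro nn_integral_cong) (auto simp: indicator_def)
    then show "(\<integral>\<^sup>+z. ennreal (l powr (p - 1)) * (if ennreal l < maximal_function f z then 1 else 0) * indicator {0<..} l \<partial>lborel)
        = ennreal (l powr (p - 1)) * u l * indicator {0<..} l"
      by (simp add: nn_integral_cmult u_def ac_simps)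
  qed
  also have "\<dots> \<le> (\<integral>\<^sup>+l. ennreal (2 * ?C) * (ennreal (l powr (p - 2)) * w l * indicator {0<..} l) \<partial>lborel)"
  proof (rule nn_integral_mono)
    fix l :: real
    show "ennreal (l powr (p - 1)) * u l * indicator {0<..} l \<le> ennreal (2 * ?C) * (ennreal (l powr (p - 2)) * w l * indicator {0<..} l)"
    proof (cases "0 < l")
      case True
      have "l powr (p - 1) = l powr (p - 2) * l"
        using True powr_add[of l "p - 2" 1] by simp
      then have "ennreal (l powr (p - 1)) * u l = ennreal (l powr (p - 2)) * (ennreal l * u l)"
        using True by (simp add: ennreal_mult' mult.assoc)
      also have "\<dots> \<le> ennreal (l powr (p - 2)) * (ennreal (2 * ?C) * w l)"
        by (intro mult_left_mono truncated True) simp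
      finally show ?thesis using True by (simp add: ac_simps)
    qed simp
  qed
  also have "\<dots> = ennreal (2 * ?C) * (\<integral>\<^sup>+l. (\<integral>\<^sup>+z. f z * (ennreal (l powr (p - 2)) * (if ennreal l < 2 * f z then 1 else 0) * indicator {0<..} l) \<partial>lborel) \<partial>lborel)"
  proof -
    have "ennreal (l powr (p - 2)) * w l * indicator {0<..} l = (\<integral>\<^sup>+z. f z * (ennreal (l powr (p - 2)) * (if ennreal l < 2 * f z then 1 else 0) * indicator {0<..} l) \<partial>lborel)" for l
      unfolding w_def by (subst nn_integral_cmult[symmetric], measurable, subst nn_integral_multc[symmetric], measurable)
        (auto intro!: nn_integral_cong simp: ac_simps)
    then show ?thesis by (subst nn_integral_cmult[symmetric]) (auto intro!: nn_integral_cong)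
  qed
  also have "(\<integral>\<^sup>+l. (\<integral>\<^sup>+z. f z * (ennreal (l powr (p - 2)) * (if ennreal l < 2 * f z then 1 else 0) * indicator {0<..} l) \<partial>lborel) \<partial>lborel)
     = (\<integral>\<^sup>+z. (\<integral>\<^sup>+l. f z * (ennreal (l powr (p - 2)) * (if ennreal l < 2 * f z then 1 else 0) * indicator {0<..} l) \<partial>lborel) \<partial>lborel)"
    by (rule lborel_pair.Fubini') measurable
  also have "\<dots> = (\<integral>\<^sup>+z. ennreal (2 powr (p - 1) / (p - 1)) * ennpow (f z) p \<partial>lborel)"
  proof (rule nn_integral_cong)
    fix z
    have "(\<integral>\<^sup>+l. f z * (ennreal (l powr (p - 2)) * (if ennreal l < 2 * f z then 1 else 0) * indicator {0<..} l) \<partial>lborel)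
        = f z * (ennreal (1 / (p - 1)) * ennpow (ennreal 2 * f z) (p - 1))"
      using ennpow_layer_cake[of "p - 2" "2 * f z"] p by (subst nn_integral_cmult) auto
    also have "\<dots> = ennreal (2 powr (p - 1) / (p - 1)) * (f z * ennpow (f z) (p - 1))"
      using p by (subst ennpow_mult_ennreal) (auto simp: divide_inverse ennreal_mult' ac_simps)
    also have "f z * ennpow (f z) (p - 1) = ennpow (f z) p"
    proof (cases "f z")
      case (real r)
      have "r * r powr (p - 1) = r powr p"
        using real p powr_add[of r 1 "p - 1"] by (cases "r = 0") auto
      then show ?thesis using real by (simp flip: ennreal_mult')
    qed (simp add: ennreal_mult_top)
    finally show "(\<integral>\<^sup>+l. f z * (ennreal (l powr (p - 2)) * (if ennreal l < 2 * f z then 1 else 0) * indicator {0<..} l) \<partial>lborel)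
        = ennreal (2 powr (p - 1) / (p - 1)) * ennpow (f z) p" .
  qed
  also have "\<dots> = ennreal (2 powr (p - 1) / (p - 1)) * (\<integral>\<^sup>+z. ennpow (f z) p \<partial>lborel)"
    by (rule nn_integral_cmult) measurable
  finally have "(\<integral>\<^sup>+z. ennpow (maximal_function f z) p \<partial>lborel) \<le>
      ennreal p * (ennreal (2 * ?C) * (ennreal (2 powr (p - 1) / (p - 1)) * (\<integral>\<^sup>+z. ennpow (f z) p \<partial>lborel)))"
    by (auto simp: mult_left_mono)
  also have "\<dots> = ennreal (p * (2 * ?C) * (2 powr (p - 1) / (p - 1))) * (\<integral>\<^sup>+z. ennpow (f z) p \<partial>lborel)"
  proof -
    define q where "q = 2 powr (p - 1) / (p - 1)"
    define K where "K = 2 * ?C"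
    have "0 \<le> q" "0 \<le> K" using p by (auto simp: q_def K_def)
    then show ?thesis
      using p unfolding q_def[symmetric] K_def[symmetric] by (simp add: ennreal_mult mult.assoc)
  qed
  also have "p * (2 * ?C) * (2 powr (p - 1) / (p - 1)) = ?C * 2 powr p * p / (p - 1)"
    using p by (simp add: powr_diff field_simps)
  finally show ?thesis .
qed

section \<open>Maximal functions along slices\<close>

definition slice_maximal_function ::
    "('a::euclidean_space \<times> 'b::euclidean_space \<Rightarrow> ennreal) \<Rightarrow> 'a \<times> 'b \<Rightarrow> ennreal"
  where "slice_maximal_function f z = maximal_function (\<lambda>s. f (s, snd z)) (fst z)"

lemma borel_measurable_slice_maximal_function [measurable]:
  fixes f :: "'a::euclidean_space \<times> 'b::euclidean_space \<Rightarrow> ennreal"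
  assumes [measurable]: "f \<in> borel_measurable borel"
  shows "slice_maximal_function f \<in> borel_measurable borel"
proof -
  have "(\<lambda>(x, s). f (s, x)) \<in> borel_measurable (lborel \<Otimes>\<^sub>M lborel)" by measurable
  then have "(\<lambda>(x, t). maximal_function (\<lambda>s. f (s, x)) t) \<in> borel_measurable (lborel \<Otimes>\<^sub>M lborel)"
    by (intro borel_measurable_maximal_function_param) simp
  then have "(\<lambda>(x, t). maximal_function (\<lambda>s. f (s, x)) t) \<circ> prod.swap \<in> borel_measurable (lborel \<Otimes>\<^sub>M lborel)"
    by (rule measurable_comp[rotated]) (simp add: measurable_pair_swap' prod.swap_def[abs_def] split_beta')
  then show ?thesis
    by (simp add: comp_def slice_maximal_function_def[abs_def] split_beta' lborel_prod)
qed

text \<open>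
  Tonelli reduces the inequality to the strong type inequality on each slice.
\<close>

lemma slice_maximal_function_strong_type:
  fixes f :: "'a::euclidean_space \<times> 'b::euclidean_space \<Rightarrow> ennreal"
  assumes [measurable]: "f \<in> borel_measurable borel" and p: "1 < p"
  shows "(\<integral>\<^sup>+z. ennpow (slice_maximal_function f z) p \<partial>lborel)
    \<le> ennreal (5 ^ DIM('a) * 2 powr p * p / (p - 1)) * (\<integral>\<^sup>+z. ennpow (f z) p \<partial>lborel)"
proof -
  have tonelli: "(\<integral>\<^sup>+z. F z \<partial>lborel) = (\<integral>\<^sup>+x. (\<integral>\<^sup>+t. F (t, x) \<partial>lborel) \<partial>lborel)"
    if [measurable]: "F \<in> borel_measurable borel" for F :: "'a \<times> 'b \<Rightarrow> ennreal"
    by (subst lborel_prod[symmetric]) (rule lborel_pair.nn_integral_snd[symmetric], simp add: lborel_prod)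
  have "(\<integral>\<^sup>+z. ennpow (slice_maximal_function f z) p \<partial>lborel) =
     (\<integral>\<^sup>+x. (\<integral>\<^sup>+t. ennpow (maximal_function (\<lambda>s. f (s, x)) t) p \<partial>lborel) \<partial>lborel)"
    by (subst tonelli, measurable) (simp add: slice_maximal_function_def)
  also have "\<dots> \<le> (\<integral>\<^sup>+x. ennreal (5 ^ DIM('a) * 2 powr p * p / (p - 1)) * (\<integral>\<^sup>+t. ennpow (f (t, x)) p \<partial>lborel) \<partial>lborel)"
    by (intro nn_integral_mono maximal_function_strong_type p) measurable
  also have "\<dots> = ennreal (5 ^ DIM('a) * 2 powr p * p / (p - 1)) * (\<integral>\<^sup>+z. ennpow (f z) p \<partial>lborel)"
    by (subst nn_integral_cmult, measurable) (subst tonelli[of "\<lambda>z. ennpow (f z) p"], auto)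
  finally show ?thesis .
qed

section \<open>Continuity of translation\<close>

lemma nn_integral_lborel_affine:
  fixes t :: "'a::euclidean_space"
  assumes [measurable]: "f \<in> borel_measurable borel" and c: "c \<noteq> 0"
  shows "(\<integral>\<^sup>+x. f x \<partial>lborel) = ennreal (\<bar>c\<bar> ^ DIM('a)) * (\<integral>\<^sup>+x. f (t + c *\<^sub>R x) \<partial>lborel)"
  by (subst lborel_affine[OF c, of t])
     (simp add: nn_integral_density nn_integral_distr nn_integral_cmult)

lemma nn_integral_lborel_shift:
  fixes t :: "'a::euclidean_space"
  assumes "f \<in> borel_measurable borel"
  shows "(\<integral>\<^sup>+x. f (x + t) \<partial>lborel) = (\<integral>\<^sup>+x. f x \<partial>lborel)"
  using nn_integral_lborel_affine[OF assms, of 1 t] by (simp add: add.commute)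

lemma integrable_lborel_affine:
  fixes f :: "'a::euclidean_space \<Rightarrow> 'b::{banach, second_countable_topology}"
  assumes f: "integrable lborel f" and c: "c \<noteq> 0"
  shows "integrable lborel (\<lambda>x. f (t + c *\<^sub>R x))"
proof -
  have [measurable]: "f \<in> borel_measurable borel" using f by simp
  have "(\<integral>\<^sup>+x. ennreal (norm (f x)) \<partial>lborel) < \<infinity>"
    using f by (simp add: integrable_iff_bounded)
  then have "(\<integral>\<^sup>+x. ennreal (norm (f (t + c *\<^sub>R x))) \<partial>lborel) < \<infinity>"
    using c by (subst (asm) nn_integral_lborel_affine[OF _ c, of _ t]) (auto simp: ennreal_mult_less_top)
  then show ?thesis by (simp add: integrable_iff_bounded)
qed

lemma integrable_lborel_shift:
  fixes f :: "'a::euclidean_space \<Rightarrow> 'b::{banach, second_countable_topology}"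
  assumes f: "integrable lborel f"
  shows "integrable lborel (\<lambda>x. f (x + t))"
  using integrable_lborel_affine[OF f, of 1 t] by (simp add: add.commute)

lemma integral_lborel_shift:
  fixes f :: "'a::euclidean_space \<Rightarrow> 'b::{banach, second_countable_topology}"
  assumes f: "f \<in> borel_measurable borel"
  shows "(\<integral>x. f (x + t) \<partial>lborel) = (\<integral>x. f x \<partial>lborel)"
  using f by (subst lborel_distr_plus[of t, symmetric], subst integral_distr) (auto simp: add.commute)

lemma one_div_Suc_tendsto_0: "(\<lambda>n. 1 / (real n + 1)) \<longlonglongrightarrow> 0"
  using LIMSEQ_inverse_real_of_nat by (simp add: inverse_eq_divide add.commute)

definition L1_translation_continuous :: "('a::euclidean_space \<Rightarrow> real) \<Rightarrow> bool"
  where "L1_translation_continuous f \<longleftrightarrow> (\<forall>y. y \<longlonglongrightarrow> 0 \<longrightarrow> (\<lambda>n. \<integral>z. \<bar>f (z + y n) - f z\<bar> \<partial>lborel) \<longlonglongrightarrow> 0)"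

text \<open>
  The translation operators are isometries of \<open>L\<^sup>1\<close>, so the functions that they move
  continuously form a closed set.
\<close>

lemma L1_translation_continuous_approx:
  fixes f :: "'a::euclidean_space \<Rightarrow> real"
  assumes f: "integrable lborel f"
    and approx: "\<And>e. 0 < e \<Longrightarrow> \<exists>g. integrable lborel g \<and> L1_translation_continuous g \<and> (\<integral>z. \<bar>f z - g z\<bar> \<partial>lborel) < e"
  shows "L1_translation_continuous f"
  unfolding L1_translation_continuous_def
proof (intro allI impI LIMSEQ_I)
  fix y :: "nat \<Rightarrow> 'a" and e :: real
  assume y: "y \<longlonglongrightarrow> 0" and e: "0 < e"
  obtain g where g: "integrable lborel g" "L1_translation_continuous g" and fg: "(\<integral>z. \<bar>f z - g z\<bar> \<partial>lborel) < e / 3"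
    using approx[of "e / 3"] e by auto
  have "(\<lambda>n. \<integral>z. \<bar>g (z + y n) - g z\<bar> \<partial>lborel) \<longlonglongrightarrow> 0"
    using g(2) y unfolding L1_translation_continuous_def by auto
  then obtain N where N: "\<And>n. n \<ge> N \<Longrightarrow> norm ((\<integral>z. \<bar>g (z + y n) - g z\<bar> \<partial>lborel) - 0) < e / 3"
    using LIMSEQ_D[of _ 0 "e / 3"] e by force
  have "norm ((\<integral>z. \<bar>f (z + y n) - f z\<bar> \<partial>lborel) - 0) < e" if n: "n \<ge> N" for n
  proof -
    note [simp] = f g(1) integrable_lborel_shift[OF f] integrable_lborel_shift[OF g(1)]
    have [measurable]: "f \<in> borel_measurable borel" "g \<in> borel_measurable borel"
      using borel_measurable_integrable[OF f] borel_measurable_integrable[OF g(1)] by simp_all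
    have "(\<integral>z. \<bar>f (z + y n) - f z\<bar> \<partial>lborel) \<le>
       (\<integral>z. \<bar>f (z + y n) - g (z + y n)\<bar> + \<bar>g (z + y n) - g z\<bar> + \<bar>f z - g z\<bar> \<partial>lborel)"
      by (intro integral_mono integrable_add integrable_abs Bochner_Integration.integrable_diff) auto
    also have "\<dots> = (\<integral>z. \<bar>f (z + y n) - g (z + y n)\<bar> \<partial>lborel) + (\<integral>z. \<bar>g (z + y n) - g z\<bar> \<partial>lborel) + (\<integral>z. \<bar>f z - g z\<bar> \<partial>lborel)"
      by (subst Bochner_Integration.integral_add, simp, simp)+ simp
    also have "(\<integral>z. \<bar>f (z + y n) - g (z + y n)\<bar> \<partial>lborel) = (\<integral>z. \<bar>f z - g z\<bar> \<partial>lborel)"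
      by (rule integral_lborel_shift[of "\<lambda>z. \<bar>f z - g z\<bar>"]) measurable
    finally show ?thesis using N[OF n] fg by simp
  qed
  then show "\<exists>N. \<forall>n\<ge>N. norm ((\<integral>z. \<bar>f (z + y n) - f z\<bar> \<partial>lborel) - 0) < e" by blast
qed

text \<open>
  If \<open>z \<in> U\<close> then \<open>z + y\<^sub>n \<in> U\<close> eventually, so
  \<open>|U \<inter> (U - y\<^sub>n)| \<rightarrow> |U|\<close>. Since \<open>U\<close> and its translates have
  the same measure, this controls the whole symmetric difference.
\<close>

lemma L1_translation_continuous_indicator_open:
  fixes U :: "'a::euclidean_space set"
  assumes U: "open U" "emeasure lborel U < \<infinity>"
  shows "L1_translation_continuous (indicator U)"
  unfolding L1_translation_continuous_def
proof (intro allI impI)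
  fix y :: "nat \<Rightarrow> 'a" assume y: "y \<longlonglongrightarrow> 0"
  have [measurable]: "U \<in> sets borel" using U by simp
  have int: "integrable lborel (indicator U :: 'a \<Rightarrow> real)" using U by simp
  have int2: "integrable lborel (\<lambda>z. indicator U z * indicator U (z + y n) :: real)" for n
    by (rule Bochner_Integration.integrable_bound[OF int]) (auto simp: indicator_def)
  have "(\<lambda>n. \<integral>z. indicator U z * indicator U (z + y n) \<partial>lborel) \<longlonglongrightarrow> (\<integral>z. indicator U z \<partial>(lborel::'a measure) :: real)"
  proof (rule integral_dominated_convergence[where w="indicator U"])
    show "AE z in lborel. (\<lambda>n. indicator U z * indicator U (z + y n) :: real) \<longlonglongrightarrow> indicator U z"
    proof (rule AE_I2)
      fix z
      show "(\<lambda>n. indicator U z * indicator U (z + y n) :: real) \<longlonglongrightarrow> indicator U z"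
      proof (cases "z \<in> U")
        case True
        have "(\<lambda>n. z + y n) \<longlonglongrightarrow> z" using tendsto_add[OF tendsto_const y, of z] by simp
        then have "\<forall>\<^sub>F n in sequentially. z + y n \<in> U"
          using U(1) True by (rule topological_tendstoD)
        then have "\<forall>\<^sub>F n in sequentially. indicator U z * indicator U (z + y n) = (indicator U z :: real)"
          by eventually_elim (simp add: True)
        then show ?thesis by (rule tendsto_eventually)
      qed simp
    qed
  qed (use int in \<open>auto simp: indicator_def\<close>)
  then have "(\<lambda>n. 2 * (\<integral>z. indicator U z \<partial>(lborel::'a measure)) - 2 * (\<integral>z. indicator U z * indicator U (z + y n) \<partial>lborel)) \<longlonglongrightarrow>
     2 * (\<integral>z. indicator U z \<partial>(lborel::'a measure)) - 2 * (\<integral>z. indicator U z \<partial>(lborel::'a measure) :: real)"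
    by (intro tendsto_intros)
  moreover have "(\<integral>z. \<bar>indicator U (z + y n) - indicator U z\<bar> \<partial>lborel) =
      2 * (\<integral>z. indicator U z \<partial>(lborel::'a measure)) - 2 * (\<integral>z. indicator U z * indicator U (z + y n) \<partial>lborel :: real)" for n
  proof -
    have "(\<integral>z. \<bar>indicator U (z + y n) - indicator U z\<bar> \<partial>lborel) =
       (\<integral>z. indicator U (z + y n) + indicator U z - 2 * (indicator U z * indicator U (z + y n)) \<partial>lborel :: real)"
      by (intro Bochner_Integration.integral_cong) (auto simp: indicator_def)
    also have "\<dots> = (\<integral>z. indicator U (z + y n) \<partial>lborel) + (\<integral>z. indicator U z \<partial>lborel) - 2 * (\<integral>z. indicator U z * indicator U (z + y n) \<partial>lborel)"
      using int int2 integrable_lborel_shift[OF int]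
      by (subst Bochner_Integration.integral_diff) (auto simp: Bochner_Integration.integral_add)
    also have "(\<integral>z. indicator U (z + y n) \<partial>lborel) = (\<integral>z. indicator U z \<partial>(lborel::'a measure) :: real)"
      by (rule integral_lborel_shift) simp
    finally show ?thesis by simp
  qed
  ultimately show "(\<lambda>n. \<integral>z. \<bar>indicator U (z + y n) - indicator U z\<bar> \<partial>lborel) \<longlonglongrightarrow> (0::real)" by simp
qed

text \<open>
  Indicators of measurable sets are approximated by those of open sets through outer regularity, and integrable
  functions by simple functions.
\<close>

lemma integrable_imp_L1_translation_continuous:
  fixes f :: "'a::euclidean_space \<Rightarrow> real"
  assumes "integrable lborel f"
  shows "L1_translation_continuous f"
  using assms
proof (induction rule: integrable_induct)
  case (base A c)
  then have A[measurable]: "A \<in> sets borel" "emeasure lborel A < \<infinity>" by auto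
  have intA: "integrable lborel (indicator A :: 'a \<Rightarrow> real)" using A by simp
  have "L1_translation_continuous (indicator A :: 'a \<Rightarrow> real)"
  proof (rule L1_translation_continuous_approx[OF intA])
    fix e :: real assume e: "0 < e"
    obtain U where U: "open U" "A \<subseteq> U" "emeasure lborel (U - A) < ennreal e"
      using outer_regular_lborel[OF A(1) e] by blast
    have [measurable]: "U \<in> sets borel" using U by simp
    have "emeasure lborel U = emeasure lborel A + emeasure lborel (U - A)"
      using U A by (subst plus_emeasure) (auto simp: Un_absorb1)
    also have "\<dots> < \<infinity>" using A(2) U(3) by (auto simp: less_top[symmetric])
    finally have finU: "emeasure lborel U < \<infinity>" .
    have "(\<integral>z. \<bar>indicator A z - indicator U z\<bar> \<partial>lborel) = (\<integral>z. indicator (U - A) z \<partial>lborel :: real)"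
      using U(2) by (intro Bochner_Integration.integral_cong) (auto simp: indicator_def)
    also have "\<dots> < e" using U(3) e
      by (cases "emeasure lborel (U - A)") (auto simp: measure_def ennreal_less_iff)
    finally show "\<exists>g. integrable lborel g \<and> L1_translation_continuous g \<and> (\<integral>z. \<bar>indicator A z - g z\<bar> \<partial>lborel) < e"
      using L1_translation_continuous_indicator_open[OF U(1) finU] finU
      by (intro exI[of _ "indicator U"]) auto
  qed
  then have "(\<lambda>n. \<bar>c\<bar> * (\<integral>z. \<bar>indicator A (z + y n) - indicator A z\<bar> \<partial>lborel)) \<longlonglongrightarrow> \<bar>c\<bar> * 0" if "y \<longlonglongrightarrow> 0" for y
    using that unfolding L1_translation_continuous_def by (intro tendsto_intros) auto
  then show ?case
    unfolding L1_translation_continuous_def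
    by (simp add: right_diff_distrib[symmetric] abs_mult mult.commute[of _ c])
next
  case (add f g)
  note [simp] = add.hyps integrable_lborel_shift[OF add.hyps(1)] integrable_lborel_shift[OF add.hyps(2)]
  show ?case
    unfolding L1_translation_continuous_def
  proof (intro allI impI)
    fix y :: "nat \<Rightarrow> 'a" assume y: "y \<longlonglongrightarrow> 0"
    have lim: "(\<lambda>n. (\<integral>z. \<bar>f (z + y n) - f z\<bar> \<partial>lborel) + (\<integral>z. \<bar>g (z + y n) - g z\<bar> \<partial>lborel)) \<longlonglongrightarrow> 0 + 0"
      using add.IH y unfolding L1_translation_continuous_def by (intro tendsto_add) auto
    show "(\<lambda>n. \<integral>z. \<bar>f (z + y n) + g (z + y n) - (f z + g z)\<bar> \<partial>lborel) \<longlonglongrightarrow> 0"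
    proof (rule tendsto_sandwich[OF _ _ tendsto_const lim[simplified]])
      show "\<forall>\<^sub>F n in sequentially. (0::real) \<le> (\<integral>z. \<bar>f (z + y n) + g (z + y n) - (f z + g z)\<bar> \<partial>lborel)"
        by (intro always_eventually allI integral_nonneg_AE) auto
      have "(\<integral>z. \<bar>f (z + y n) + g (z + y n) - (f z + g z)\<bar> \<partial>lborel) \<le>
          (\<integral>z. \<bar>f (z + y n) - f z\<bar> + \<bar>g (z + y n) - g z\<bar> \<partial>lborel)" for n
        by (intro integral_mono integrable_add integrable_abs Bochner_Integration.integrable_diff) auto
      then show "\<forall>\<^sub>F n in sequentially. (\<integral>z. \<bar>f (z + y n) + g (z + y n) - (f z + g z)\<bar> \<partial>lborel) \<le>
          (\<integral>z. \<bar>f (z + y n) - f z\<bar> \<partial>lborel) + (\<integral>z. \<bar>g (z + y n) - g z\<bar> \<partial>lborel)"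
        by (intro always_eventually allI) (simp add: Bochner_Integration.integral_add)
    qed
  qed
next
  case (lim f s)
  show ?case
  proof (rule L1_translation_continuous_approx[OF lim.hyps(4)])
    fix e :: real assume e: "0 < e"
    note [measurable] = borel_measurable_integrable[OF lim.hyps(4)] borel_measurable_integrable[OF lim.hyps(1)]
    have "(\<lambda>i. \<integral>z. \<bar>f z - s i z\<bar> \<partial>lborel) \<longlonglongrightarrow> (\<integral>z. 0 \<partial>(lborel::'a measure))"
    proof (rule integral_dominated_convergence[where w="\<lambda>z. 3 * \<bar>f z\<bar>"])
      show "AE z in lborel. (\<lambda>i. \<bar>f z - s i z\<bar>) \<longlonglongrightarrow> 0"
      proof (rule AE_I2)
        fix z :: 'a assume "z \<in> space lborel"
        then have "(\<lambda>i. \<bar>f z - s i z\<bar>) \<longlonglongrightarrow> \<bar>f z - f z\<bar>"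
          using lim.hyps(2) by (intro tendsto_intros) auto
        then show "(\<lambda>i. \<bar>f z - s i z\<bar>) \<longlonglongrightarrow> 0" by simp
      qed
      show "AE z in lborel. norm \<bar>f z - s i z\<bar> \<le> 3 * \<bar>f z\<bar>" for i
        using lim.hyps(3)[of _ i] by (intro AE_I2) (smt (verit) real_norm_def)
    qed (use lim.hyps(4) in auto)
    then have "\<forall>\<^sub>F i in sequentially. (\<integral>z. \<bar>f z - s i z\<bar> \<partial>lborel) < e"
      using e by (auto dest: order_tendstoD(2))
    then obtain i where "(\<integral>z. \<bar>f z - s i z\<bar> \<partial>lborel) < e" by (auto dest: eventually_happens)
    then show "\<exists>g. integrable lborel g \<and> L1_translation_continuous g \<and> (\<integral>z. \<bar>f z - g z\<bar> \<partial>lborel) < e"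
      using lim.hyps(1) lim.IH by blast
  qed
qed

section \<open>Mollification\<close>

locale mollifier =
  fixes \<phi> :: "'a::euclidean_space \<Rightarrow> real"
  assumes Ck_kernel: "Ck k \<phi>" and kernel_nonneg: "0 \<le> \<phi> z"
    and kernel_support: "1 \<le> norm z \<Longrightarrow> \<phi> z = 0"
    and integrable_kernel: "integrable lborel \<phi>" and integral_kernel: "(\<integral>z. \<phi> z \<partial>lborel) = 1"
begin

text \<open>
  Two versions of convolution with the kernel \<open>e\<^sup>-\<^sup>n \<phi>(\<cdot> / e)\<close>: a real one
  for the Sobolev function itself, and an \<open>ennreal\<close> one for nonnegative functions such as
  \<open>|\<nabla>u|\<close> and its maximal functions. Writing them as averages of translates makes them
  commute with everything that commutes with translations.
\<close>

definition mollify :: "real \<Rightarrow> ('a \<Rightarrow> real) \<Rightarrow> 'a \<Rightarrow> real"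
  where "mollify e F z = (\<integral>y. \<phi> y * F (z - e *\<^sub>R y) \<partial>lborel)"

definition nn_mollify :: "real \<Rightarrow> ('a \<Rightarrow> ennreal) \<Rightarrow> 'a \<Rightarrow> ennreal"
  where "nn_mollify e f z = (\<integral>\<^sup>+y. ennreal (\<phi> y) * f (z - e *\<^sub>R y) \<partial>lborel)"

lemma borel_measurable_kernel [measurable]: "\<phi> \<in> borel_measurable borel"
  using borel_measurable_integrable[OF integrable_kernel] by simp

lemma continuous_on_kernel: "continuous_on A \<phi>"
  using Ck_kernel[of 0] by (auto intro: continuous_on_subset)

lemma kernel_bounded: obtains B where "0 \<le> B" "\<And>z. \<phi> z \<le> B"
proof -
  have "bounded (\<phi> ` cball 0 1)"
    by (intro compact_imp_bounded compact_continuous_image continuous_on_kernel compact_cball)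
  then obtain B where B: "\<forall>z\<in>cball 0 1. norm (\<phi> z) \<le> B" unfolding bounded_iff by auto
  have "\<phi> z \<le> max 0 B" for z
    using B kernel_support[of z] by (cases "norm z \<le> 1") (auto simp: max_def abs_le_iff)
  then show ?thesis by (intro that[of "max 0 B"]) auto
qed

lemma integrable_mollify_integrand:
  assumes F: "integrable lborel F" and e: "0 < e"
  shows "integrable lborel (\<lambda>y. \<phi> y * F (z - e *\<^sub>R y))"
proof -
  obtain B where B: "0 \<le> B" "\<And>z. \<phi> z \<le> B" by (rule kernel_bounded) auto
  have int: "integrable lborel (\<lambda>y. F (z - e *\<^sub>R y))"
    using integrable_lborel_affine[OF F, of "- e" z] e by simp
  have [measurable]: "F \<in> borel_measurable borel" using borel_measurable_integrable[OF F] by simp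
  show ?thesis
    by (rule Bochner_Integration.integrable_bound[OF integrable_mult_right[OF integrable_norm[OF int], of B]])
      (use B kernel_nonneg in \<open>auto simp: abs_mult intro!: mult_right_mono AE_I2\<close>)
qed

lemma borel_measurable_mollify [measurable]:
  assumes [measurable]: "F \<in> borel_measurable borel"
  shows "mollify e F \<in> borel_measurable borel"
  unfolding mollify_def[abs_def] by measurable

lemma borel_measurable_nn_mollify [measurable]:
  assumes [measurable]: "f \<in> borel_measurable borel"
  shows "nn_mollify e f \<in> borel_measurable borel"
  unfolding nn_mollify_def[abs_def] by measurable

lemma nn_mollify_add:
  assumes [measurable]: "f \<in> borel_measurable borel" "g \<in> borel_measurable borel"
  shows "nn_mollify e (\<lambda>z. f z + g z) z = nn_mollify e f z + nn_mollify e g z"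
  unfolding nn_mollify_def distrib_left by (rule nn_integral_add) measurable

lemma nn_mollify_ennreal:
  assumes F: "integrable lborel F" "\<And>z. 0 \<le> F z" and e: "0 < e"
  shows "nn_mollify e (\<lambda>z. ennreal (F z)) z = ennreal (mollify e F z)"
  unfolding nn_mollify_def mollify_def
  using nn_integral_eq_integral[OF integrable_mollify_integrand[OF F(1) e]] F(2) kernel_nonneg
  by (simp add: ennreal_mult)

text \<open>
  By Tonelli
  \<open>\<parallel>F\<^sub>e - F\<parallel>\<^sub>1 \<le> \<integral> \<phi>(y) \<parallel>F(\<cdot> - e y) - F\<parallel>\<^sub>1 dy\<close>;
  the inner norm is bounded by \<open>2 \<parallel>F\<parallel>\<^sub>1\<close> and tends to \<open>0\<close> by
  continuity of translation.
\<close>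

lemma mollify_tendsto_L1:
  assumes F: "integrable lborel F" and e: "\<And>n. 0 < e n" "e \<longlonglongrightarrow> 0"
  shows "integrable lborel (\<lambda>z. mollify (e n) F z - F z)"
    and "(\<lambda>n. \<integral>z. \<bar>mollify (e n) F z - F z\<bar> \<partial>lborel) \<longlonglongrightarrow> 0"
proof -
  have [measurable]: "F \<in> borel_measurable borel" using borel_measurable_integrable[OF F] by simp
  define d where "d n y = (\<integral>z. \<bar>F (z - e n *\<^sub>R y) - F z\<bar> \<partial>lborel)" for n y
  have d_meas [measurable]: "d n \<in> borel_measurable borel" for n unfolding d_def by measurable
  have int_diff: "integrable lborel (\<lambda>z. F (z - e n *\<^sub>R y) - F z)" for n y
    using integrable_lborel_shift[OF F, of "- e n *\<^sub>R y"] F by simp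
  have d_nonneg: "0 \<le> d n y" for n y unfolding d_def by simp
  have d_nn: "(\<integral>\<^sup>+z. ennreal \<bar>F (z - e n *\<^sub>R y) - F z\<bar> \<partial>lborel) = ennreal (d n y)" for n y
    unfolding d_def using nn_integral_eq_integral[OF integrable_abs[OF int_diff[of n y]]] by simp
  have d_le: "d n y \<le> 2 * (\<integral>z. \<bar>F z\<bar> \<partial>lborel)" for n y
  proof -
    have "d n y \<le> (\<integral>z. \<bar>F (z - e n *\<^sub>R y)\<bar> + \<bar>F z\<bar> \<partial>lborel)"
      unfolding d_def using integrable_lborel_shift[OF F, of "- e n *\<^sub>R y"] F int_diff[of n y]
      by (intro integral_mono integrable_add integrable_abs) auto
    also have "\<dots> = (\<integral>z. \<bar>F (z - e n *\<^sub>R y)\<bar> \<partial>lborel) + (\<integral>z. \<bar>F z\<bar> \<partial>lborel)"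
      using integrable_lborel_shift[OF F, of "- e n *\<^sub>R y"] F by (intro Bochner_Integration.integral_add) auto
    also have "(\<integral>z. \<bar>F (z - e n *\<^sub>R y)\<bar> \<partial>lborel) = (\<integral>z. \<bar>F z\<bar> \<partial>lborel)"
      using integral_lborel_shift[of "\<lambda>z. \<bar>F z\<bar>" "- e n *\<^sub>R y"] by simp
    finally show ?thesis by simp
  qed
  have int_d: "integrable lborel (\<lambda>y. \<phi> y * d n y)" for n
    by (rule Bochner_Integration.integrable_bound[OF integrable_mult_left[OF integrable_kernel, of "2 * (\<integral>z. \<bar>F z\<bar> \<partial>lborel)"]])
      (use d_le d_nonneg kernel_nonneg in \<open>auto simp: abs_mult intro!: mult_left_mono AE_I2\<close>)
  have le: "(\<integral>\<^sup>+z. ennreal \<bar>mollify (e n) F z - F z\<bar> \<partial>lborel) \<le> ennreal (\<integral>y. \<phi> y * d n y \<partial>lborel)" for n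
  proof -
    have "(\<integral>\<^sup>+z. ennreal \<bar>mollify (e n) F z - F z\<bar> \<partial>lborel) \<le>
        (\<integral>\<^sup>+z. (\<integral>\<^sup>+y. ennreal (\<phi> y) * ennreal \<bar>F (z - e n *\<^sub>R y) - F z\<bar> \<partial>lborel) \<partial>lborel)"
    proof (rule nn_integral_mono)
      fix z
      have int1: "integrable lborel (\<lambda>y. \<phi> y * F (z - e n *\<^sub>R y))"
        by (rule integrable_mollify_integrand[OF F e(1)])
      have int2: "integrable lborel (\<lambda>y. \<phi> y * F z)" using integrable_kernel by simp
      have "mollify (e n) F z - F z = (\<integral>y. \<phi> y * F (z - e n *\<^sub>R y) - \<phi> y * F z \<partial>lborel)"
        unfolding mollify_def using int1 int2 integral_kernel integrable_kernel
        by (simp add: Bochner_Integration.integral_diff)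
      then have "mollify (e n) F z - F z = (\<integral>y. \<phi> y * (F (z - e n *\<^sub>R y) - F z) \<partial>lborel)"
        by (simp add: right_diff_distrib)
      moreover have "integrable lborel (\<lambda>y. \<phi> y * (F (z - e n *\<^sub>R y) - F z))"
        using Bochner_Integration.integrable_diff[OF int1 int2] by (simp add: right_diff_distrib)
      ultimately have "ennreal \<bar>mollify (e n) F z - F z\<bar> \<le> (\<integral>\<^sup>+y. ennreal \<bar>\<phi> y * (F (z - e n *\<^sub>R y) - F z)\<bar> \<partial>lborel)"
        using integral_norm_bound_ennreal[of lborel "\<lambda>y. \<phi> y * (F (z - e n *\<^sub>R y) - F z)"] by simp
      then show "ennreal \<bar>mollify (e n) F z - F z\<bar> \<le> (\<integral>\<^sup>+y. ennreal (\<phi> y) * ennreal \<bar>F (z - e n *\<^sub>R y) - F z\<bar> \<partial>lborel)"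
        using kernel_nonneg by (simp add: abs_mult ennreal_mult)
    qed
    also have "\<dots> = (\<integral>\<^sup>+y. (\<integral>\<^sup>+z. ennreal (\<phi> y) * ennreal \<bar>F (z - e n *\<^sub>R y) - F z\<bar> \<partial>lborel) \<partial>lborel)"
      by (rule lborel_pair.Fubini') measurable
    also have "\<dots> = (\<integral>\<^sup>+y. ennreal (\<phi> y * d n y) \<partial>lborel)"
      by (subst nn_integral_cmult, measurable) (use kernel_nonneg d_nonneg in \<open>simp add: d_nn ennreal_mult\<close>)
    also have "\<dots> = ennreal (\<integral>y. \<phi> y * d n y \<partial>lborel)"
      using kernel_nonneg d_nonneg by (intro nn_integral_eq_integral int_d) auto
    finally show ?thesis .
  qed
  show int: "integrable lborel (\<lambda>z. mollify (e n) F z - F z)" for n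
    unfolding integrable_iff_bounded using le[of n] by (auto intro: le_less_trans)
  have "(\<lambda>n. \<integral>y. \<phi> y * d n y \<partial>lborel) \<longlonglongrightarrow> (\<integral>y. 0 \<partial>(lborel::'a measure))"
  proof (rule integral_dominated_convergence[where w="\<lambda>y. \<phi> y * (2 * (\<integral>z. \<bar>F z\<bar> \<partial>lborel))"])
    show "AE y in lborel. (\<lambda>n. \<phi> y * d n y) \<longlonglongrightarrow> 0"
    proof (rule AE_I2)
      fix y :: 'a
      have "(\<lambda>n. - (e n *\<^sub>R y)) \<longlonglongrightarrow> - (0 *\<^sub>R y)"
        by (intro tendsto_minus tendsto_scaleR tendsto_const e(2))
      then have "(\<lambda>n. d n y) \<longlonglongrightarrow> 0"
        using integrable_imp_L1_translation_continuous[OF F]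
        unfolding L1_translation_continuous_def d_def by (auto dest!: spec[of _ "\<lambda>n. - (e n *\<^sub>R y)"])
      then have "(\<lambda>n. \<phi> y * d n y) \<longlonglongrightarrow> \<phi> y * 0" by (intro tendsto_intros)
      then show "(\<lambda>n. \<phi> y * d n y) \<longlonglongrightarrow> 0" by simp
    qed
    show "AE y in lborel. norm (\<phi> y * d n y) \<le> \<phi> y * (2 * (\<integral>z. \<bar>F z\<bar> \<partial>lborel))" for n
      using d_le d_nonneg kernel_nonneg by (auto simp: abs_mult intro!: mult_left_mono AE_I2)
  qed (use integrable_kernel in auto)
  then have lim: "(\<lambda>n. \<integral>y. \<phi> y * d n y \<partial>lborel) \<longlonglongrightarrow> 0" by simp
  have "(\<integral>z. \<bar>mollify (e n) F z - F z\<bar> \<partial>lborel) \<le> (\<integral>y. \<phi> y * d n y \<partial>lborel)" for n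
  proof -
    have "ennreal (\<integral>z. \<bar>mollify (e n) F z - F z\<bar> \<partial>lborel) \<le> ennreal (\<integral>y. \<phi> y * d n y \<partial>lborel)"
      using le[of n] nn_integral_eq_integral[OF integrable_abs[OF int[of n]]] by simp
    then show ?thesis
      using kernel_nonneg d_nonneg by (subst (asm) ennreal_le_iff) (auto intro!: integral_nonneg_AE)
  qed
  then show "(\<lambda>n. \<integral>z. \<bar>mollify (e n) F z - F z\<bar> \<partial>lborel) \<longlonglongrightarrow> 0"
    by (intro tendsto_sandwich[OF _ _ tendsto_const lim]) (auto intro!: always_eventually)
qed

lemma mollify_tendsto_AE_subseq:
  assumes F: "integrable lborel F" and e: "\<And>n. 0 < e n" "e \<longlonglongrightarrow> 0"
  obtains r :: "nat \<Rightarrow> nat" where "strict_mono r" "AE z in lborel. (\<lambda>n. mollify (e (r n)) F z) \<longlonglongrightarrow> F z"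
proof -
  have "(\<lambda>n. \<integral>z. norm (mollify (e n) F z - F z) \<partial>lborel) \<longlonglongrightarrow> 0"
    using mollify_tendsto_L1(2)[OF assms] by simp
  from tendsto_L1_AE_subseq[OF mollify_tendsto_L1(1)[OF assms] this]
  obtain r where r: "strict_mono r" "AE z in lborel. (\<lambda>n. mollify (e (r n)) F z - F z) \<longlonglongrightarrow> 0"
    by blast
  show ?thesis
    by (rule that[OF r(1)]) (use r(2) in \<open>simp add: LIM_zero_iff\<close>)
qed

text \<open>
  Ball averages commute with translations, hence with mollification, and each of them is at most the maximal
  function. This is how maximal function bounds for smooth approximations are transferred to the limit.
\<close>

lemma maximal_function_nn_mollify_le:
  assumes [measurable]: "f \<in> borel_measurable borel"
  shows "maximal_function (nn_mollify e f) z \<le> nn_mollify e (maximal_function f) z"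
  unfolding maximal_function_le_iff
proof (intro allI impI)
  fix r :: real assume r: "0 < r"
  have [measurable]: "ball z r \<in> sets borel" by simp
  have ball: "(\<integral>\<^sup>+w\<in>ball z r. f (w - v) \<partial>lborel) = (\<integral>\<^sup>+w\<in>ball (z - v) r. f w \<partial>lborel)" for v
  proof -
    have [measurable]: "ball (z - v) r \<in> sets borel" by simp
    have "(\<integral>\<^sup>+w\<in>ball (z - v) r. f w \<partial>lborel) = (\<integral>\<^sup>+w. f (w + - v) * indicator (ball (z - v) r) (w + - v) \<partial>lborel)"
      by (rule nn_integral_lborel_shift[symmetric]) measurable
    also have "\<dots> = (\<integral>\<^sup>+w\<in>ball z r. f (w - v) \<partial>lborel)"
      by (intro nn_integral_cong) (auto simp: indicator_def dist_norm algebra_simps)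
    finally show ?thesis ..
  qed
  have "(\<integral>\<^sup>+w\<in>ball z r. nn_mollify e f w \<partial>lborel) =
      (\<integral>\<^sup>+w. (\<integral>\<^sup>+y. ennreal (\<phi> y) * f (w - e *\<^sub>R y) * indicator (ball z r) w \<partial>lborel) \<partial>lborel)"
    unfolding nn_mollify_def by (subst nn_integral_multc) auto
  also have "\<dots> = (\<integral>\<^sup>+y. (\<integral>\<^sup>+w. ennreal (\<phi> y) * f (w - e *\<^sub>R y) * indicator (ball z r) w \<partial>lborel) \<partial>lborel)"
    by (rule lborel_pair.Fubini') measurable
  also have "\<dots> = (\<integral>\<^sup>+y. ennreal (\<phi> y) * (\<integral>\<^sup>+w\<in>ball z r. f (w - e *\<^sub>R y) \<partial>lborel) \<partial>lborel)"
    unfolding mult.assoc by (subst nn_integral_cmult) auto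
  also have "\<dots> \<le> (\<integral>\<^sup>+y. ennreal (\<phi> y) * (maximal_function f (z - e *\<^sub>R y) * emeasure lborel (ball (z - e *\<^sub>R y) r)) \<partial>lborel)"
    unfolding ball by (intro nn_integral_mono mult_left_mono ball_nn_integral_le_maximal_function r) simp
  also have "\<dots> = nn_mollify e (maximal_function f) z * emeasure lborel (ball z r)"
    unfolding nn_mollify_def using r
    by (subst nn_integral_multc[symmetric]) (auto simp: emeasure_ball mult.assoc)
  finally show "(\<integral>\<^sup>+w\<in>ball z r. nn_mollify e f w \<partial>lborel) \<le> nn_mollify e (maximal_function f) z * emeasure lborel (ball z r)" .
qed

end

lemma slice_maximal_function_nn_mollify_le:
  fixes f :: "'a::euclidean_space \<times> 'b::euclidean_space \<Rightarrow> ennreal"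
  assumes "mollifier \<phi>" and [measurable]: "f \<in> borel_measurable borel"
  shows "slice_maximal_function (mollifier.nn_mollify \<phi> e f) z \<le>
    mollifier.nn_mollify \<phi> e (slice_maximal_function f) z"
proof -
  interpret mollifier \<phi> by fact
  obtain t x where z: "z = (t, x)" by (cases z)
  have "maximal_function (\<lambda>s. nn_mollify e f (s, x)) t \<le> nn_mollify e (slice_maximal_function f) z"
    unfolding maximal_function_le_iff
  proof (intro allI impI)
    fix r :: real assume r: "0 < r"
    have [measurable]: "ball v r \<in> sets borel" for v :: 'a by simp
    have ball: "(\<integral>\<^sup>+s\<in>ball t r. f ((s, x) - v) \<partial>lborel) = (\<integral>\<^sup>+s\<in>ball (t - fst v) r. f (s, x - snd v) \<partial>lborel)" for v
    proof -
      have "(\<integral>\<^sup>+s\<in>ball (t - fst v) r. f (s, x - snd v) \<partial>lborel) =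
          (\<integral>\<^sup>+s. f (s + - fst v, x - snd v) * indicator (ball (t - fst v) r) (s + - fst v) \<partial>lborel)"
        by (rule nn_integral_lborel_shift[symmetric]) measurable
      also have "\<dots> = (\<integral>\<^sup>+s\<in>ball t r. f ((s, x) - v) \<partial>lborel)"
        by (intro nn_integral_cong) (auto simp: indicator_def dist_norm minus_prod_def algebra_simps)
      finally show ?thesis ..
    qed
    have "(\<integral>\<^sup>+s\<in>ball t r. nn_mollify e f (s, x) \<partial>lborel) =
        (\<integral>\<^sup>+s. (\<integral>\<^sup>+y. ennreal (\<phi> y) * f ((s, x) - e *\<^sub>R y) * indicator (ball t r) s \<partial>lborel) \<partial>lborel)"
      unfolding nn_mollify_def by (subst nn_integral_multc) auto
    also have "\<dots> = (\<integral>\<^sup>+y. (\<integral>\<^sup>+s. ennreal (\<phi> y) * f ((s, x) - e *\<^sub>R y) * indicator (ball t r) s \<partial>lborel) \<partial>lborel)"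
      by (rule lborel_pair.Fubini') measurable
    also have "\<dots> = (\<integral>\<^sup>+y. ennreal (\<phi> y) * (\<integral>\<^sup>+s\<in>ball t r. f ((s, x) - e *\<^sub>R y) \<partial>lborel) \<partial>lborel)"
      unfolding mult.assoc by (subst nn_integral_cmult) auto
    also have "\<dots> \<le> (\<integral>\<^sup>+y. ennreal (\<phi> y) * (slice_maximal_function f (z - e *\<^sub>R y) * emeasure lborel (ball (fst (z - e *\<^sub>R y)) r)) \<partial>lborel)"
      unfolding ball slice_maximal_function_def z
      using ball_nn_integral_le_maximal_function[OF r]
      by (intro nn_integral_mono mult_left_mono) auto
    also have "\<dots> = nn_mollify e (slice_maximal_function f) z * emeasure lborel (ball t r)"
      unfolding nn_mollify_def using r
      by (subst nn_integral_multc[symmetric]) (auto simp: emeasure_ball mult.assoc)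
    finally show "(\<integral>\<^sup>+s\<in>ball t r. nn_mollify e f (s, x) \<partial>lborel) \<le> nn_mollify e (slice_maximal_function f) z * emeasure lborel (ball t r)" .
  qed
  then show ?thesis by (simp add: slice_maximal_function_def z)
qed

section \<open>Upper gradients from weak gradients\<close>

text \<open>
  Moves the integrals in the definition of a weak gradient, which are taken over \<open>\<Omega>\<close> for
  Lebesgue measurable functions, to Borel representatives on the whole space, where Fubini and translation
  invariance are available.
\<close>

lemma integral_lebesgue_on_compact_support:
  fixes u :: "'a::euclidean_space \<Rightarrow> real"
  assumes "open \<Omega>" "u locally_integrable_on \<Omega>" "compact K" "K \<subseteq> \<Omega>"
    and U: "U \<in> borel_measurable borel" "AE z in lebesgue. z \<in> \<Omega> \<longrightarrow> U z = u z"
    and w: "w \<in> borel_measurable borel" "\<And>z. z \<notin> K \<Longrightarrow> w z = 0"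
  shows "(LINT z|lebesgue_on \<Omega>. u z * w z) = (\<integral>z. U z * w z \<partial>lborel)"
proof -
  note [measurable] = U(1) w(1)
  have K: "K \<in> sets lebesgue" using \<open>compact K\<close> by (simp add: borel_compact)
  have "\<Omega> \<in> sets lebesgue" using \<open>open \<Omega>\<close> by simp
  have "integrable (lebesgue_on K) u"
    using assms unfolding locally_integrable_on_def by auto
  then have [measurable]: "(\<lambda>z. indicator K z *\<^sub>R u z) \<in> borel_measurable lebesgue"
    using K by (subst (asm) integrable_restrict_space) auto
  have [measurable]: "w \<in> borel_measurable lebesgue" "U \<in> borel_measurable lebesgue"
    using U(1) w(1) by (auto intro: measurable_completion)
  have "(LINT z|lebesgue_on \<Omega>. u z * w z) = (LINT z|lebesgue. indicator \<Omega> z *\<^sub>R (u z * w z))"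
    using \<open>\<Omega> \<in> sets lebesgue\<close> by (subst integral_restrict_space) auto
  also have "\<dots> = (LINT z|lebesgue. (indicator K z *\<^sub>R u z) * w z)"
    using w(2) \<open>K \<subseteq> \<Omega>\<close> by (intro Bochner_Integration.integral_cong) (auto simp: indicator_def)
  also have "\<dots> = (LINT z|lebesgue. U z * w z)"
  proof (rule integral_cong_AE)
    show "AE z in lebesgue. indicator K z *\<^sub>R u z * w z = U z * w z"
      using U(2) by eventually_elim (use w(2) \<open>K \<subseteq> \<Omega>\<close> in \<open>auto simp: indicator_def\<close>)
  qed measurable
  also have "\<dots> = (\<integral>z. U z * w z \<partial>lborel)"
    by (rule integral_completion) measurable
  finally show ?thesis .
qed

lemma frechet_derivative_eq_0_outside_support:
  assumes "z \<notin> closure {x. \<phi> x \<noteq> 0}"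
  shows "frechet_derivative \<phi> (at z) = (\<lambda>_. 0)"
proof -
  have "\<forall>\<^sub>F x in nhds z. \<phi> x = 0"
    using eventually_nhds_in_open[OF open_Compl[OF closed_closure[of "{x. \<phi> x \<noteq> 0}"]], of z] assms
      closure_subset[of "{x. \<phi> x \<noteq> 0}"]
    by (auto elim!: eventually_mono)
  moreover have "((\<lambda>_. 0) has_derivative (\<lambda>_. 0)) (at z)" by (rule has_derivative_const)
  ultimately have "(\<phi> has_derivative (\<lambda>_. 0)) (at z)"
    using assms closure_subset[of "{x. \<phi> x \<noteq> 0}"]
    by (subst has_derivative_transform_eventually[of "\<lambda>_. 0"])
      (auto simp: eventually_at_filter elim!: eventually_mono)
  then show ?thesis using frechet_derivative_at by metis
qed

lemma test_function_derivative_props: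
  assumes "\<phi> \<in> test_functions \<Omega>"
  shows "(\<phi> has_derivative frechet_derivative \<phi> (at z)) (at z)"
    and "continuous_on UNIV (\<lambda>z. frechet_derivative \<phi> (at z) v)"
    and "continuous_on UNIV \<phi>"
proof -
  have Ck: "Ck k \<phi>" for k using assms by (simp add: test_functions_def)
  show "(\<phi> has_derivative frechet_derivative \<phi> (at z)) (at z)"
    using Ck_Suc_has_derivative[OF Ck] .
  have "\<forall>v. Ck 0 (\<lambda>z. frechet_derivative \<phi> (at z) v)" using Ck[of "Suc 0"] by auto
  then show "continuous_on UNIV (\<lambda>z. frechet_derivative \<phi> (at z) v)" by simp
  show "continuous_on UNIV \<phi>" using Ck[of 0] by simp
qed

lemma test_function_supportE:
  assumes "\<phi> \<in> test_functions \<Omega>"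
  obtains K where "compact K" "K \<subseteq> \<Omega>" "\<And>z. z \<notin> K \<Longrightarrow> \<phi> z = 0"
    "\<And>z v. z \<notin> K \<Longrightarrow> frechet_derivative \<phi> (at z) v = 0"
proof (rule that[of "closure {x. \<phi> x \<noteq> 0}"])
  show "compact (closure {x. \<phi> x \<noteq> 0})" "closure {x. \<phi> x \<noteq> 0} \<subseteq> \<Omega>"
    using assms by (auto simp: test_functions_def)
  show "\<phi> z = 0" if "z \<notin> closure {x. \<phi> x \<noteq> 0}" for z
    using that closure_subset[of "{x. \<phi> x \<noteq> 0}"] by auto
  show "frechet_derivative \<phi> (at z) v = 0" if "z \<notin> closure {x. \<phi> x \<noteq> 0}" for z v
    using frechet_derivative_eq_0_outside_support[OF that] by simp
qed

lemma compactly_supported_continuous_bounded: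
  fixes f :: "'a::euclidean_space \<Rightarrow> real"
  assumes "continuous_on UNIV f" "compact K" "\<And>z. z \<notin> K \<Longrightarrow> f z = 0"
  obtains B where "0 \<le> B" "\<And>z. \<bar>f z\<bar> \<le> B"
proof -
  have "bounded (f ` K)"
    using assms by (intro compact_imp_bounded compact_continuous_image) (auto intro: continuous_on_subset)
  then obtain B where B: "\<forall>z\<in>K. norm (f z) \<le> B" unfolding bounded_iff by auto
  have "\<bar>f z\<bar> \<le> max 0 B" for z
    using B assms(3)[of z] by (cases "z \<in> K") (auto simp: max_def)
  then show ?thesis by (intro that[of "max 0 B"]) auto
qed

lemma integrable_mult_bounded:
  fixes F :: "'a::euclidean_space \<Rightarrow> real"
  assumes F: "integrable lborel F" and [measurable]: "w \<in> borel_measurable borel" and B: "\<And>z. \<bar>w z\<bar> \<le> B"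
  shows "integrable lborel (\<lambda>z. F z * w z)"
proof -
  have [measurable]: "F \<in> borel_measurable borel" using borel_measurable_integrable[OF F] by simp
  show ?thesis
    by (rule Bochner_Integration.integrable_bound[OF integrable_mult_left[OF integrable_norm[OF F], of B]])
      (use B in \<open>auto simp: abs_mult intro!: mult_left_mono AE_I2 order_trans[OF B]\<close>)
qed

lemma ennreal_abs_integral_le:
  fixes f :: "'x \<Rightarrow> real"
  shows "ennreal \<bar>integral\<^sup>L M f\<bar> \<le> (\<integral>\<^sup>+x. ennreal \<bar>f x\<bar> \<partial>M)"
  using integral_norm_bound_ennreal[of M f] by (cases "integrable M f") (auto simp: not_integrable_integral_eq)

text \<open>
  The defining identity for Borel representatives, extended by linearity from the coordinate directions to an
  arbitrary direction \<open>v\<close>.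
\<close>

lemma weak_gradient_integral_lborel:
  fixes u :: "'a::euclidean_space \<Rightarrow> real"
  assumes "open \<Omega>" and G: "has_weak_gradient \<Omega> u G"
    and U: "integrable lborel U" "AE z in lebesgue. z \<in> \<Omega> \<longrightarrow> U z = u z"
    and H: "integrable lborel H" "AE z in lebesgue. z \<in> \<Omega> \<longrightarrow> H z = G z"
    and \<phi>: "\<phi> \<in> test_functions \<Omega>"
  shows "(\<integral>z. U z * frechet_derivative \<phi> (at z) v \<partial>lborel) = - (\<integral>z. (H z \<bullet> v) * \<phi> z \<partial>lborel)"
proof -
  obtain K where K: "compact K" "K \<subseteq> \<Omega>" and out: "\<And>z. z \<notin> K \<Longrightarrow> \<phi> z = 0"
    and out': "\<And>z v. z \<notin> K \<Longrightarrow> frechet_derivative \<phi> (at z) v = 0"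
    using test_function_supportE[OF \<phi>] by blast
  note \<phi>_props = test_function_derivative_props[OF \<phi>]
  have [measurable]: "(\<lambda>z. frechet_derivative \<phi> (at z) e) \<in> borel_measurable borel" "\<phi> \<in> borel_measurable borel" for e
    using \<phi>_props by (auto intro: borel_measurable_continuous_onI)
  have [measurable]: "U \<in> borel_measurable borel" "H \<in> borel_measurable borel"
    using borel_measurable_integrable[OF U(1)] borel_measurable_integrable[OF H(1)] by simp_all
  have loc: "u locally_integrable_on \<Omega>" "(\<lambda>z. G z \<bullet> e) locally_integrable_on \<Omega>" for e
    using G unfolding has_weak_gradient_def locally_integrable_on_def by auto
  have basis: "(\<integral>z. U z * frechet_derivative \<phi> (at z) e \<partial>lborel) = - (\<integral>z. (H z \<bullet> e) * \<phi> z \<partial>lborel)"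
    if "e \<in> Basis" for e
  proof -
    have "(LINT z|lebesgue_on \<Omega>. u z * frechet_derivative \<phi> (at z) e) = - (LINT z|lebesgue_on \<Omega>. (G z \<bullet> e) * \<phi> z)"
      using G \<phi> that by (simp add: has_weak_gradient_def)
    moreover have "(LINT z|lebesgue_on \<Omega>. u z * frechet_derivative \<phi> (at z) e) = (\<integral>z. U z * frechet_derivative \<phi> (at z) e \<partial>lborel)"
      using \<open>open \<Omega>\<close> loc K out' U(2) by (intro integral_lebesgue_on_compact_support) auto
    moreover have "(LINT z|lebesgue_on \<Omega>. (G z \<bullet> e) * \<phi> z) = (\<integral>z. (H z \<bullet> e) * \<phi> z \<partial>lborel)"
      using \<open>open \<Omega>\<close> loc K out H(2) by (intro integral_lebesgue_on_compact_support) auto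
    ultimately show ?thesis by simp
  qed
  have int: "integrable lborel (\<lambda>z. U z * frechet_derivative \<phi> (at z) e)" for e
  proof -
    obtain B where "0 \<le> B" and B: "\<And>z. \<bar>frechet_derivative \<phi> (at z) e\<bar> \<le> B"
      by (rule compactly_supported_continuous_bounded[OF \<phi>_props(2) K(1) out']) blast+
    show ?thesis by (rule integrable_mult_bounded[OF U(1) _ B]) measurable
  qed
  have int': "integrable lborel (\<lambda>z. (H z \<bullet> e) * \<phi> z)" for e
  proof -
    obtain B where "0 \<le> B" and B: "\<And>z. \<bar>\<phi> z\<bar> \<le> B"
      by (rule compactly_supported_continuous_bounded[OF \<phi>_props(3) K(1) out]) blast+
    show ?thesis by (rule integrable_mult_bounded[OF _ _ B]) (use H(1) in auto)
  qed
  have lin: "frechet_derivative \<phi> (at z) v = (\<Sum>e\<in>Basis. (v \<bullet> e) * frechet_derivative \<phi> (at z) e)" for z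
  proof -
    interpret linear "frechet_derivative \<phi> (at z)" using has_derivative_linear[OF \<phi>_props(1)] .
    have "frechet_derivative \<phi> (at z) v = frechet_derivative \<phi> (at z) (\<Sum>e\<in>Basis. (v \<bullet> e) *\<^sub>R e)"
      by (simp add: euclidean_representation)
    then show ?thesis by (simp add: sum scale)
  qed
  have "(\<integral>z. U z * frechet_derivative \<phi> (at z) v \<partial>lborel) =
      (\<integral>z. (\<Sum>e\<in>Basis. (v \<bullet> e) * (U z * frechet_derivative \<phi> (at z) e)) \<partial>lborel)"
    unfolding lin by (simp add: sum_distrib_left mult.left_commute)
  also have "\<dots> = (\<Sum>e\<in>Basis. (v \<bullet> e) * (\<integral>z. U z * frechet_derivative \<phi> (at z) e \<partial>lborel))"
    using int by (subst Bochner_Integration.integral_sum) auto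
  also have "\<dots> = (\<Sum>e\<in>Basis. (v \<bullet> e) * - (\<integral>z. (H z \<bullet> e) * \<phi> z \<partial>lborel))"
    using basis by simp
  also have "\<dots> = - (\<integral>z. (\<Sum>e\<in>Basis. (v \<bullet> e) * ((H z \<bullet> e) * \<phi> z)) \<partial>lborel)"
    using int' by (subst Bochner_Integration.integral_sum) (auto simp: sum_negf)
  also have "(\<lambda>z. \<Sum>e\<in>Basis. (v \<bullet> e) * ((H z \<bullet> e) * \<phi> z)) = (\<lambda>z. (H z \<bullet> v) * \<phi> z)"
    by (auto simp: fun_eq_iff euclidean_inner[of _ v] sum_distrib_left sum_distrib_right mult_ac)
  finally show ?thesis .
qed

context mollifier
begin

lemma scaled_kernel_test_function:
  assumes "0 < e" "cball z e \<subseteq> \<Omega>"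
  shows "(\<lambda>w. \<phi> ((z - w) /\<^sub>R e)) \<in> test_functions \<Omega>"
proof -
  have eq: "(\<lambda>w. \<phi> ((z - w) /\<^sub>R e)) = (\<lambda>w. \<phi> (z /\<^sub>R e + (- inverse e) *\<^sub>R w))"
    by (simp add: fun_eq_iff algebra_simps)
  have Ck: "Ck k (\<lambda>w. \<phi> ((z - w) /\<^sub>R e))" for k
    unfolding eq by (rule Ck_affine_comp[OF Ck_kernel])
  have "{w. \<phi> ((z - w) /\<^sub>R e) \<noteq> 0} \<subseteq> cball z e"
  proof (rule subsetI, rule ccontr)
    fix w assume w: "w \<in> {w. \<phi> ((z - w) /\<^sub>R e) \<noteq> 0}" "w \<notin> cball z e"
    then have "1 \<le> norm ((z - w) /\<^sub>R e)" using assms(1) by (simp add: dist_norm divide_simps)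
    with w kernel_support show False by auto
  qed
  then have sub: "closure {w. \<phi> ((z - w) /\<^sub>R e) \<noteq> 0} \<subseteq> cball z e" by (rule closure_minimal) simp
  moreover have "compact (closure {w. \<phi> ((z - w) /\<^sub>R e) \<noteq> 0})"
    using sub by (meson bounded_cball bounded_subset closed_closure compact_eq_bounded_closed)
  ultimately show ?thesis
    using Ck assms(2) by (auto simp: test_functions_def)
qed

lemma mollify_eq_convolution:
  assumes F: "F \<in> borel_measurable borel" and e: "0 < e"
  shows "(\<integral>w. F w * \<phi> ((z - w) /\<^sub>R e) \<partial>lborel) = e ^ DIM('a) * mollify e F z"
proof -
  note [measurable] = F
  have "(\<integral>w. F w * \<phi> ((z - w) /\<^sub>R e) \<partial>lborel) =
      (\<integral>w. F w * \<phi> ((z - w) /\<^sub>R e) \<partial>(density (distr lborel borel (\<lambda>x. z + (- e) *\<^sub>R x)) (\<lambda>_. ennreal (\<bar>- e\<bar>^DIM('a)))))"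
    using lborel_affine[of "- e" z] e by simp
  also have "\<dots> = (\<integral>w. e ^ DIM('a) * (F w * \<phi> ((z - w) /\<^sub>R e)) \<partial>distr lborel borel (\<lambda>x. z + (- e) *\<^sub>R x))"
    using e by (subst integral_density) auto
  also have "\<dots> = (\<integral>y. e ^ DIM('a) * (F (z - e *\<^sub>R y) * \<phi> y) \<partial>lborel)"
    using e by (subst integral_distr) auto
  finally show ?thesis by (simp add: mollify_def mult.commute)
qed

text \<open>
  Formally \<open>\<nabla>(u\<^sub>e) = (\<nabla>u)\<^sub>e\<close>, integrated along a segment. The difference
  of the two kernels is written as an integral of its derivative over the segment; after exchanging the
  integrals, the inner one pairs \<open>u\<close> with the derivative of a translated kernel. That kernel is a
  test function because its support, the ball of radius \<open>e\<close>, stays inside \<open>\<Omega>\<close>.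
\<close>

theorem mollify_difference_eq:
  fixes u :: "'a \<Rightarrow> real"
  assumes "open \<Omega>" and G: "has_weak_gradient \<Omega> u G"
    and U: "integrable lborel U" "AE z in lebesgue. z \<in> \<Omega> \<longrightarrow> U z = u z"
    and H: "integrable lborel H" "AE z in lebesgue. z \<in> \<Omega> \<longrightarrow> H z = G z"
    and e: "0 < e" and ball: "\<And>s. 0 \<le> s \<Longrightarrow> s \<le> 1 \<Longrightarrow> cball (z + s *\<^sub>R v) e \<subseteq> \<Omega>"
  shows "mollify e U (z + v) - mollify e U z =
    (\<integral>s. indicator {0..1} s * mollify e (\<lambda>w. H w \<bullet> v) (z + s *\<^sub>R v) \<partial>lborel)"
proof -
  note [measurable] = borel_measurable_integrable[OF U(1), simplified] borel_measurable_integrable[OF H(1), simplified]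
  define \<kappa> where "\<kappa> w = \<phi> (w /\<^sub>R e)" for w
  \<comment> \<open>The kernel at scale e, without its normalising factor, and its derivative in direction v.\<close>
  define D where "D w = frechet_derivative \<kappa> (at w) v" for w
  have Ck\<kappa>: "Ck k \<kappa>" for k
    using Ck_affine_comp[OF Ck_kernel, of k 0 "inverse e"] by (simp add: \<kappa>_def[abs_def])
  have \<kappa>_out: "\<kappa> w = 0" if "w \<notin> cball 0 e" for w
    using that e unfolding \<kappa>_def by (intro kernel_support) (simp add: divide_simps)
  have \<kappa>_deriv: "(\<kappa> has_derivative frechet_derivative \<kappa> (at w)) (at w)" for w
    by (rule Ck_Suc_has_derivative[OF Ck\<kappa>])
  have \<kappa>_cont: "continuous_on UNIV \<kappa>" using Ck\<kappa>[of 0] by simp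
  have D_cont: "continuous_on UNIV D"
    using Ck\<kappa>[of "Suc 0"] unfolding D_def by simp
  have D_out: "D w = 0" if "w \<notin> cball 0 e" for w
  proof -
    have "closure {x. \<kappa> x \<noteq> 0} \<subseteq> cball 0 e"
      by (rule closure_minimal) (use \<kappa>_out in blast, simp)
    then show ?thesis
      using frechet_derivative_eq_0_outside_support[of w \<kappa>] that by (force simp: D_def)
  qed
  have [measurable]: "\<kappa> \<in> borel_measurable borel" "D \<in> borel_measurable borel"
    using \<kappa>_cont D_cont by (auto intro: borel_measurable_continuous_onI)
  obtain B where B: "0 \<le> B" "\<And>w. \<bar>D w\<bar> \<le> B"
    using compactly_supported_continuous_bounded[OF D_cont compact_cball D_out] by blast
  obtain B' where B': "0 \<le> B'" "\<And>w. \<bar>\<kappa> w\<bar> \<le> B'"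
    using compactly_supported_continuous_bounded[OF \<kappa>_cont compact_cball \<kappa>_out] by blast
  have ftc: "\<kappa> (z + v - w) - \<kappa> (z - w) = (\<integral>s. indicator {0..1} s * D (z + s *\<^sub>R v - w) \<partial>lborel)" for w
  proof -
    have "((\<lambda>s. \<kappa> (z + s *\<^sub>R v - w)) has_vector_derivative D (z + s *\<^sub>R v - w)) (at s within {0..1})" for s
    proof -
      interpret linear "frechet_derivative \<kappa> (at (z + s *\<^sub>R v - w))" using has_derivative_linear[OF \<kappa>_deriv] .
      have "((\<lambda>s. \<kappa> (z + s *\<^sub>R v - w)) has_derivative (\<lambda>h. frechet_derivative \<kappa> (at (z + s *\<^sub>R v - w)) (h *\<^sub>R v))) (at s)"
        by (rule has_derivative_compose[OF _ \<kappa>_deriv]) (auto intro!: derivative_eq_intros)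
      then have "((\<lambda>s. \<kappa> (z + s *\<^sub>R v - w)) has_vector_derivative D (z + s *\<^sub>R v - w)) (at s)"
        unfolding has_vector_derivative_def D_def by (simp add: scale)
      then show ?thesis by (rule has_vector_derivative_at_within)
    qed
    moreover have "continuous_on {0..1} (\<lambda>s. D (z + s *\<^sub>R v - w))"
      by (intro continuous_on_compose2[OF D_cont] continuous_intros) auto
    ultimately have "(\<integral>s. indicator {0..1} s *\<^sub>R D (z + s *\<^sub>R v - w) \<partial>lborel) = \<kappa> (z + 1 *\<^sub>R v - w) - \<kappa> (z + 0 *\<^sub>R v - w)"
      by (intro integral_FTC_atLeastAtMost) auto
    then show ?thesis by simp
  qed
  have int_U\<kappa>: "integrable lborel (\<lambda>w. U w * \<kappa> (y - w))" for y
    by (rule integrable_mult_bounded[OF U(1) _ B'(2)]) measurable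
  have conv: "(\<integral>w. F w * \<kappa> (y - w) \<partial>lborel) = e ^ DIM('a) * mollify e F y" if "F \<in> borel_measurable borel" for F y
    unfolding \<kappa>_def by (rule mollify_eq_convolution[OF that e])
  have inner: "(\<integral>w. U w * D (y - w) \<partial>lborel) = (\<integral>w. (H w \<bullet> v) * \<kappa> (y - w) \<partial>lborel)" if "cball y e \<subseteq> \<Omega>" for y
  proof -
    have test: "(\<lambda>w. \<kappa> (y - w)) \<in> test_functions \<Omega>"
      unfolding \<kappa>_def by (rule scaled_kernel_test_function[OF e that])
    have "frechet_derivative (\<lambda>w. \<kappa> (y - w)) (at w) v = - D (y - w)" for w
    proof -
      interpret linear "frechet_derivative \<kappa> (at (y - w))" using has_derivative_linear[OF \<kappa>_deriv] .
      have "((\<lambda>w. \<kappa> (y - w)) has_derivative (\<lambda>h. frechet_derivative \<kappa> (at (y - w)) (- h))) (at w)"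
        by (rule has_derivative_compose[OF _ \<kappa>_deriv]) (auto intro!: derivative_eq_intros)
      then have "frechet_derivative (\<lambda>w. \<kappa> (y - w)) (at w) = (\<lambda>h. frechet_derivative \<kappa> (at (y - w)) (- h))"
        by (rule frechet_derivative_at[symmetric])
      then show ?thesis by (simp add: D_def neg)
    qed
    then show ?thesis
      using weak_gradient_integral_lborel[OF \<open>open \<Omega>\<close> G U H test, of v] by simp
  qed
  have "e ^ DIM('a) * (mollify e U (z + v) - mollify e U z) = (\<integral>w. U w * (\<kappa> (z + v - w) - \<kappa> (z - w)) \<partial>lborel)"
    using int_U\<kappa> by (simp add: right_diff_distrib conv[symmetric] Bochner_Integration.integral_diff)
  also have "\<dots> = (\<integral>w. (\<integral>s. U w * (indicator {0..1} s * D (z + s *\<^sub>R v - w)) \<partial>lborel) \<partial>lborel)"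
    unfolding ftc by simp
  also have "\<dots> = (\<integral>s. (\<integral>w. U w * (indicator {0..1} s * D (z + s *\<^sub>R v - w)) \<partial>lborel) \<partial>lborel)"
  proof (rule lborel_pair.Fubini_integral[symmetric])
    have "integrable (lborel \<Otimes>\<^sub>M lborel) (\<lambda>(w, s). \<bar>U w\<bar> * (B * indicator {0..1::real} s))"
    proof (rule lborel_pair.Fubini_integrable)
      show "AE w in lborel. integrable lborel (\<lambda>s. case (w, s) of (w, s) \<Rightarrow> \<bar>U w\<bar> * (B * indicator {0..1::real} s))"
        by (intro AE_I2) (auto intro!: integrable_mult_right)
    qed (use U(1) B in \<open>auto simp: abs_mult\<close>)
    then show "integrable (lborel \<Otimes>\<^sub>M lborel) (\<lambda>(w, s). U w * (indicator {0..1} s * D (z + s *\<^sub>R v - w)))"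
    proof (rule Bochner_Integration.integrable_bound)
      show "AE x in lborel \<Otimes>\<^sub>M lborel. norm (case x of (w, s) \<Rightarrow> U w * (indicator {0..1} s * D (z + s *\<^sub>R v - w)))
          \<le> norm (case x of (w, s) \<Rightarrow> \<bar>U w\<bar> * (B * indicator {0..1::real} s))"
        using B by (intro AE_I2) (auto simp: abs_mult indicator_def intro!: mult_left_mono)
    qed measurable
  qed
  also have "\<dots> = (\<integral>s. indicator {0..1} s * (\<integral>w. U w * D (z + s *\<^sub>R v - w) \<partial>lborel) \<partial>lborel)"
    by (simp add: mult.left_commute[of _ "indicator _ _"])
  also have "\<dots> = (\<integral>s. indicator {0..1} s * (e ^ DIM('a) * mollify e (\<lambda>w. H w \<bullet> v) (z + s *\<^sub>R v)) \<partial>lborel)"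
    using ball by (intro Bochner_Integration.integral_cong) (auto simp: indicator_def inner conv)
  also have "\<dots> = e ^ DIM('a) * (\<integral>s. indicator {0..1} s * mollify e (\<lambda>w. H w \<bullet> v) (z + s *\<^sub>R v) \<partial>lborel)"
    by (simp add: mult.left_commute[of _ "e ^ _"])
  finally show ?thesis using e by simp
qed

text \<open>
  The mollification of \<open>|\<nabla>u|\<close> is an upper gradient of the mollification of \<open>u\<close>
  on segments whose \<open>e\<close>-neighbourhood lies in \<open>\<Omega>\<close>. The path estimates below use
  no other property of Sobolev functions.
\<close>

corollary mollify_upper_gradient:
  fixes u :: "'a \<Rightarrow> real"
  assumes "open \<Omega>" and G: "has_weak_gradient \<Omega> u G"
    and U: "integrable lborel U" "AE z in lebesgue. z \<in> \<Omega> \<longrightarrow> U z = u z"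
    and H: "integrable lborel H" "AE z in lebesgue. z \<in> \<Omega> \<longrightarrow> H z = G z"
    and e: "0 < e" and ball: "\<And>s. 0 \<le> s \<Longrightarrow> s \<le> 1 \<Longrightarrow> cball (z + s *\<^sub>R v) e \<subseteq> \<Omega>"
  shows "ennreal \<bar>mollify e U (z + v) - mollify e U z\<bar> \<le>
    ennreal (norm v) * (\<integral>\<^sup>+s\<in>{0..1}. nn_mollify e (\<lambda>w. ennreal (norm (H w))) (z + s *\<^sub>R v) \<partial>lborel)"
proof -
  note [measurable] = borel_measurable_integrable[OF H(1), simplified]
  have pt: "ennreal \<bar>mollify e (\<lambda>w. H w \<bullet> v) y\<bar> \<le> ennreal (norm v) * nn_mollify e (\<lambda>w. ennreal (norm (H w))) y" for y
  proof -
    have "ennreal \<bar>mollify e (\<lambda>w. H w \<bullet> v) y\<bar> \<le> (\<integral>\<^sup>+x. ennreal \<bar>\<phi> x * (H (y - e *\<^sub>R x) \<bullet> v)\<bar> \<partial>lborel)"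
      unfolding mollify_def by (rule ennreal_abs_integral_le)
    also have "\<dots> \<le> (\<integral>\<^sup>+x. ennreal (norm v) * (ennreal (\<phi> x) * ennreal (norm (H (y - e *\<^sub>R x)))) \<partial>lborel)"
    proof (rule nn_integral_mono)
      fix x
      have "\<bar>\<phi> x * (H (y - e *\<^sub>R x) \<bullet> v)\<bar> \<le> \<phi> x * (norm (H (y - e *\<^sub>R x)) * norm v)"
        using kernel_nonneg[of x] Cauchy_Schwarz_ineq2[of "H (y - e *\<^sub>R x)" v]
        by (simp add: abs_mult mult_left_mono)
      also have "\<dots> = norm v * (\<phi> x * norm (H (y - e *\<^sub>R x)))" by simp
      finally show "ennreal \<bar>\<phi> x * (H (y - e *\<^sub>R x) \<bullet> v)\<bar> \<le> ennreal (norm v) * (ennreal (\<phi> x) * ennreal (norm (H (y - e *\<^sub>R x))))"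
        using kernel_nonneg by (simp flip: ennreal_mult)
    qed
    also have "\<dots> = ennreal (norm v) * nn_mollify e (\<lambda>w. ennreal (norm (H w))) y"
      unfolding nn_mollify_def by (rule nn_integral_cmult) measurable
    finally show ?thesis .
  qed
  have "ennreal \<bar>mollify e U (z + v) - mollify e U z\<bar> \<le>
      (\<integral>\<^sup>+s. ennreal \<bar>indicator {0..1} s * mollify e (\<lambda>w. H w \<bullet> v) (z + s *\<^sub>R v)\<bar> \<partial>lborel)"
    using ennreal_abs_integral_le[of lborel "\<lambda>s. indicator {0..1} s * mollify e (\<lambda>w. H w \<bullet> v) (z + s *\<^sub>R v)"]
    by (simp only: mollify_difference_eq[OF \<open>open \<Omega>\<close> G U H e ball])
  also have "\<dots> \<le> (\<integral>\<^sup>+s. ennreal (norm v) * (nn_mollify e (\<lambda>w. ennreal (norm (H w))) (z + s *\<^sub>R v) * indicator {0..1} s) \<partial>lborel)"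
    using pt by (intro nn_integral_mono) (auto simp: indicator_def)
  also have "\<dots> = ennreal (norm v) * (\<integral>\<^sup>+s\<in>{0..1}. nn_mollify e (\<lambda>w. ennreal (norm (H w))) (z + s *\<^sub>R v) \<partial>lborel)"
    by (rule nn_integral_cmult) measurable
  finally show ?thesis .
qed

end

section \<open>Pointwise estimates along paths\<close>

lemma emeasure_ball_scale:
  fixes a b :: "'a::euclidean_space"
  assumes "0 < s" "0 < r"
  shows "emeasure lborel (ball a (s * r)) = ennreal (s ^ DIM('a)) * emeasure lborel (ball b r)"
  using assms by (simp add: emeasure_ball power_mult_distrib mult.left_commute flip: ennreal_mult')

text \<open>
  The average over a ball of \<open>|v(w) - v(a)|\<close>, where the ball is only required to have a size
  comparable to its distance from \<open>a\<close>. At time \<open>s\<close> the segments from \<open>a\<close>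
  to the points of \<open>B(a, kr)\<close> fill \<open>B(a, skr)\<close>, and the substitution
  \<open>w \<mapsto> a + s (w - a)\<close> produces the factor \<open>s\<^sup>-\<^sup>n\<close>, which the
  measure of the smaller ball exactly compensates.
\<close>

lemma cone_average_le_maximal_function:
  fixes v :: "'a::euclidean_space \<Rightarrow> real" and f :: "'a \<Rightarrow> ennreal"
  assumes [measurable]: "f \<in> borel_measurable borel"
    and r: "0 < r" and k: "0 < k" and sub: "ball c r \<subseteq> ball a (k * r)"
    and ug: "\<And>w. w \<in> ball c r \<Longrightarrow>
      ennreal \<bar>v w - v a\<bar> \<le> ennreal (norm (w - a)) * (\<integral>\<^sup>+s\<in>{0..1}. f (a + s *\<^sub>R (w - a)) \<partial>lborel)"
  shows "(\<integral>\<^sup>+w\<in>ball c r. ennreal \<bar>v w - v a\<bar> \<partial>lborel) \<le>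
    ennreal (r * k ^ Suc (DIM('a))) * maximal_function f a * emeasure lborel (ball c r)"
proof -
  have [measurable]: "ball x q \<in> sets borel" for x :: 'a and q by simp
  have kr: "0 < k * r" using r k by simp
  have scaled: "(\<integral>\<^sup>+w\<in>ball a (k * r). f (a + s *\<^sub>R (w - a)) \<partial>lborel) \<le>
      maximal_function f a * emeasure lborel (ball a (k * r))" if s: "0 < s" for s
  proof -
    let ?I = "\<integral>\<^sup>+w\<in>ball a (k * r). f (a + s *\<^sub>R (w - a)) \<partial>lborel"
    have "ennreal (s ^ DIM('a)) * ?I =
      ennreal (\<bar>s\<bar> ^ DIM('a)) * (\<integral>\<^sup>+w. f ((a - s *\<^sub>R a) + s *\<^sub>R w) * indicator (ball a (s * (k * r))) ((a - s *\<^sub>R a) + s *\<^sub>R w) \<partial>lborel)"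
    proof -
      have "w \<in> ball a (k * r) \<longleftrightarrow> (a - s *\<^sub>R a) + s *\<^sub>R w \<in> ball a (s * (k * r))" for w
      proof -
        have "a - ((a - s *\<^sub>R a) + s *\<^sub>R w) = s *\<^sub>R (a - w)" by (simp add: algebra_simps)
        then show ?thesis using s by (simp add: dist_norm)
      qed
      then have "?I = (\<integral>\<^sup>+w. f ((a - s *\<^sub>R a) + s *\<^sub>R w) * indicator (ball a (s * (k * r))) ((a - s *\<^sub>R a) + s *\<^sub>R w) \<partial>lborel)"
        by (intro nn_integral_cong) (auto simp: indicator_def algebra_simps)
      then show ?thesis using s by simp
    qed
    also have "\<dots> = (\<integral>\<^sup>+w\<in>ball a (s * (k * r)). f w \<partial>lborel)"
      using s by (intro nn_integral_lborel_affine[symmetric]) auto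
    also have "\<dots> \<le> maximal_function f a * emeasure lborel (ball a (s * (k * r)))"
      using s kr by (intro ball_nn_integral_le_maximal_function) simp
    also have "emeasure lborel (ball a (s * (k * r))) = ennreal (s ^ DIM('a)) * emeasure lborel (ball a (k * r))"
      by (rule emeasure_ball_scale[OF s kr])
    finally have "ennreal (s ^ DIM('a)) * ?I \<le> ennreal (s ^ DIM('a)) * (maximal_function f a * emeasure lborel (ball a (k * r)))"
      by (simp add: mult.left_commute)
    then show ?thesis using s by (subst (asm) ennreal_mult_le_mult_iff) auto
  qed
  have "(\<integral>\<^sup>+w\<in>ball c r. ennreal \<bar>v w - v a\<bar> \<partial>lborel) \<le>
      (\<integral>\<^sup>+w. ennreal (k * r) * (\<integral>\<^sup>+s. f (a + s *\<^sub>R (w - a)) * indicator {0..1} s * indicator (ball a (k * r)) w \<partial>lborel) \<partial>lborel)"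
  proof (rule nn_integral_mono)
    fix w
    show "ennreal \<bar>v w - v a\<bar> * indicator (ball c r) w \<le>
      ennreal (k * r) * (\<integral>\<^sup>+s. f (a + s *\<^sub>R (w - a)) * indicator {0..1} s * indicator (ball a (k * r)) w \<partial>lborel)"
    proof (cases "w \<in> ball c r")
      case True
      then have w: "w \<in> ball a (k * r)" using sub by auto
      then have "norm (w - a) \<le> k * r" by (simp add: dist_norm norm_minus_commute)
      then have "ennreal (norm (w - a)) * (\<integral>\<^sup>+s\<in>{0..1}. f (a + s *\<^sub>R (w - a)) \<partial>lborel) \<le>
          ennreal (k * r) * (\<integral>\<^sup>+s\<in>{0..1}. f (a + s *\<^sub>R (w - a)) \<partial>lborel)"
        by (intro mult_right_mono ennreal_leI) auto
      with ug[OF True] show ?thesis using True w by simp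
    qed simp
  qed
  also have "\<dots> = ennreal (k * r) * (\<integral>\<^sup>+w. (\<integral>\<^sup>+s. f (a + s *\<^sub>R (w - a)) * indicator {0..1} s * indicator (ball a (k * r)) w \<partial>lborel) \<partial>lborel)"
    by (rule nn_integral_cmult) measurable
  also have "(\<integral>\<^sup>+w. (\<integral>\<^sup>+s. f (a + s *\<^sub>R (w - a)) * indicator {0..1} s * indicator (ball a (k * r)) w \<partial>lborel) \<partial>lborel)
     = (\<integral>\<^sup>+s. (\<integral>\<^sup>+w. f (a + s *\<^sub>R (w - a)) * indicator {0..1} s * indicator (ball a (k * r)) w \<partial>lborel) \<partial>lborel)"
    by (rule lborel_pair.Fubini') measurable
  also have "\<dots> \<le> (\<integral>\<^sup>+s. maximal_function f a * emeasure lborel (ball a (k * r)) * indicator {0..1::real} s \<partial>lborel)"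
  proof (rule nn_integral_mono_AE)
    have "AE s in lborel. s \<noteq> (0::real)" by (rule AE_lborel_singleton)
    then show "AE s in lborel. (\<integral>\<^sup>+w. f (a + s *\<^sub>R (w - a)) * indicator {0..1} s * indicator (ball a (k * r)) w \<partial>lborel)
        \<le> maximal_function f a * emeasure lborel (ball a (k * r)) * indicator {0..1} s"
      by eventually_elim (use scaled in \<open>auto simp: indicator_def\<close>)
  qed
  also have "\<dots> = maximal_function f a * emeasure lborel (ball a (k * r))"
    by (simp add: nn_integral_cmult_indicator)
  also have "ennreal (k * r) * (maximal_function f a * emeasure lborel (ball a (k * r))) =
      ennreal (r * k ^ Suc (DIM('a))) * maximal_function f a * emeasure lborel (ball c r)"
  proof -
    have "emeasure lborel (ball a (k * r)) = ennreal (k ^ DIM('a)) * emeasure lborel (ball c r)"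
      by (rule emeasure_ball_scale[OF k r])
    moreover have "ennreal (r * k ^ Suc (DIM('a))) = ennreal (k * r) * ennreal (k ^ DIM('a))"
      using k r by (simp add: mult.commute mult.left_commute flip: ennreal_mult')
    ultimately show ?thesis by (simp add: mult_ac)
  qed
  finally show ?thesis by (simp add: mult_left_mono)
qed

text \<open>
  Both points are joined to all points of one common ball, over which the estimate is averaged.
\<close>

lemma two_point_maximal_estimate:
  fixes v :: "'a::euclidean_space \<Rightarrow> real" and f :: "'a \<Rightarrow> ennreal"
  assumes [measurable]: "f \<in> borel_measurable borel" "v \<in> borel_measurable borel"
    and r: "0 < r" and k: "0 < k"
    and sub: "ball c r \<subseteq> ball a (k * r)" "ball c r \<subseteq> ball b (k * r)"
    and ug: "\<And>w x. w \<in> ball c r \<Longrightarrow> x \<in> {a, b} \<Longrightarrow>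
      ennreal \<bar>v w - v x\<bar> \<le> ennreal (norm (w - x)) * (\<integral>\<^sup>+s\<in>{0..1}. f (x + s *\<^sub>R (w - x)) \<partial>lborel)"
  shows "ennreal \<bar>v a - v b\<bar> \<le> ennreal (r * k ^ Suc (DIM('a))) * (maximal_function f a + maximal_function f b)"
proof -
  let ?C = "ennreal (r * k ^ Suc (DIM('a)))" and ?V = "emeasure lborel (ball c r)"
  have [measurable]: "ball c r \<in> sets borel" by simp
  have V: "?V \<noteq> 0" "?V < top" using emeasure_ball_pos[OF r] emeasure_ball_less_top by auto
  have "ennreal \<bar>v a - v b\<bar> * ?V = (\<integral>\<^sup>+w\<in>ball c r. ennreal \<bar>v a - v b\<bar> \<partial>lborel)"
    by (simp add: nn_integral_cmult_indicator)
  also have "\<dots> \<le> (\<integral>\<^sup>+w. ennreal \<bar>v w - v a\<bar> * indicator (ball c r) w + ennreal \<bar>v w - v b\<bar> * indicator (ball c r) w \<partial>lborel)"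
    by (intro nn_integral_mono) (auto simp: indicator_def simp flip: ennreal_plus intro!: ennreal_leI)
  also have "\<dots> = (\<integral>\<^sup>+w\<in>ball c r. ennreal \<bar>v w - v a\<bar> \<partial>lborel) + (\<integral>\<^sup>+w\<in>ball c r. ennreal \<bar>v w - v b\<bar> \<partial>lborel)"
    by (rule nn_integral_add) measurable
  also have "\<dots> \<le> ?C * maximal_function f a * ?V + ?C * maximal_function f b * ?V"
    using ug by (intro add_mono cone_average_le_maximal_function r k sub) auto
  also have "\<dots> = ?C * (maximal_function f a + maximal_function f b) * ?V"
    by (simp add: distrib_left distrib_right)
  finally have "?V * ennreal \<bar>v a - v b\<bar> \<le> ?V * (?C * (maximal_function f a + maximal_function f b))"
    by (simp add: mult.commute)
  then show ?thesis using V by (subst (asm) ennreal_mult_le_mult_iff) auto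
qed

text \<open>
  On a line the maximal function at one endpoint alone controls the integral of the upper gradient.
\<close>

lemma vertical_difference_le:
  fixes v :: "real \<times> 'a::euclidean_space \<Rightarrow> real" and f :: "real \<times> 'a \<Rightarrow> ennreal"
  assumes [measurable]: "f \<in> borel_measurable borel" and l: "\<bar>s - t\<bar> < l"
    and ug: "ennreal \<bar>v (s, x) - v (t, x)\<bar> \<le>
      ennreal (norm ((s, x) - (t, x))) * (\<integral>\<^sup>+q\<in>{0..1}. f ((t, x) + q *\<^sub>R ((s, x) - (t, x))) \<partial>lborel)"
  shows "ennreal \<bar>v (s, x) - v (t, x)\<bar> \<le> ennreal (2 * l) * slice_maximal_function f (t, x)"
proof (cases "s = t")
  case False
  have [measurable]: "ball t l \<in> sets borel" by simp
  have l0: "0 < l" using l by linarith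
  have "ennreal \<bar>v (s, x) - v (t, x)\<bar> \<le> ennreal \<bar>s - t\<bar> * (\<integral>\<^sup>+q\<in>{0..1}. f (t + (s - t) * q, x) \<partial>lborel)"
    using ug by (simp add: norm_Pair mult.commute[of "s - t"])
  also have "\<dots> \<le> ennreal \<bar>s - t\<bar> * (\<integral>\<^sup>+q. f (t + (s - t) * q, x) * indicator (ball t l) (t + (s - t) * q) \<partial>lborel)"
  proof (rule mult_left_mono, rule nn_integral_mono)
    fix q :: real
    have "t + (s - t) * q \<in> ball t l" if "0 \<le> q" "q \<le> 1"
    proof -
      have "\<bar>(s - t) * q\<bar> \<le> \<bar>s - t\<bar>" using that by (simp add: abs_mult mult_left_le)
      then show ?thesis using l by (simp add: dist_real_def)
    qed
    then show "f (t + (s - t) * q, x) * indicator {0..1} q \<le> f (t + (s - t) * q, x) * indicator (ball t l) (t + (s - t) * q)"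
      by (auto simp: indicator_def)
  qed simp
  also have "\<dots> = (\<integral>\<^sup>+q\<in>ball t l. f (q, x) \<partial>lborel)"
    using False by (intro nn_integral_real_affine[symmetric]) auto
  also have "\<dots> \<le> slice_maximal_function f (t, x) * emeasure lborel (ball t l)"
    unfolding slice_maximal_function_def using ball_nn_integral_le_maximal_function[OF l0] by simp
  also have "emeasure lborel (ball t l) = ennreal (2 * l)"
    using l0 by (simp add: ball_eq_greaterThanLessThan)
  finally show ?thesis by (simp add: mult.commute)
qed simp

text \<open>
  The path goes from \<open>(t1, x1)\<close> vertically to height \<open>s\<close>, across to
  \<open>(s, x2)\<close> and vertically to \<open>(t2, x2)\<close>. The horizontal part costs
  \<open>Mf(s, x1) + Mf(s, x2)\<close>, evaluated at points that depend on the path; averaging over the heights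
  \<open>s\<close> in an interval of length comparable to the distance turns this into the maximal function of
  \<open>Mf\<close> in the vertical variable, evaluated at the two given points.
\<close>

lemma hajlasz_estimate_along_paths:
  fixes v :: "real \<times> 'a::euclidean_space \<Rightarrow> real" and f :: "real \<times> 'a \<Rightarrow> ennreal"
  defines "Mf \<equiv> maximal_function f" and "S \<equiv> slice_maximal_function"
  assumes [measurable]: "f \<in> borel_measurable borel" "v \<in> borel_measurable borel"
    and ug: "\<And>a b. closed_segment a b \<subseteq> K \<Longrightarrow>
      ennreal \<bar>v b - v a\<bar> \<le> ennreal (norm (b - a)) * (\<integral>\<^sup>+s\<in>{0..1}. f (a + s *\<^sub>R (b - a)) \<partial>lborel)"
    and d: "0 < d" and c: "1 \<le> c" and k: "k = 4 * c + 3"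
    and x: "norm x1 \<le> R" "norm x2 \<le> R" "norm (x1 - x2) \<le> c * d"
    and l: "\<bar>q - t1\<bar> + d < l" "\<bar>q - t2\<bar> + d < l"
    and box: "{q - 2 * d..q + 2 * d} \<times> cball 0 R \<subseteq> K"
    and seg: "\<And>s. s \<in> {q - d..q + d} \<Longrightarrow> closed_segment (t1, x1) (s, x1) \<subseteq> K"
      "\<And>s. s \<in> {q - d..q + d} \<Longrightarrow> closed_segment (t2, x2) (s, x2) \<subseteq> K"
  shows "ennreal \<bar>v (t1, x1) - v (t2, x2)\<bar> \<le> ennreal (2 * l * k ^ Suc (DIM(real \<times> 'a))) *
    ((S f (t1, x1) + S Mf (t1, x1)) + (S f (t2, x2) + S Mf (t2, x2)))"
proof -
  let ?n = "Suc (DIM(real \<times> 'a))"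
  have [measurable]: "Mf \<in> borel_measurable borel" unfolding Mf_def by measurable
  have l0: "0 < l" using l d by linarith
  have k1: "1 \<le> k ^ ?n" using c k by (intro one_le_power) simp
  let ?I = "{q - d..q + d}"
  have middle: "ennreal \<bar>v (s, x1) - v (s, x2)\<bar> \<le> ennreal (d * k ^ ?n) * (Mf (s, x1) + Mf (s, x2))"
    if s: "s \<in> ?I" for s
  proof (cases "x1 = x2")
    case False
    \<comment> \<open>The common ball has centre (s, y), where y is x1 pulled towards the axis by r, so that it stays
      within distance R of the axis, and a radius r that is comparable to |x1 - x2| and at most d/4.\<close>
    define r where "r = norm (x1 - x2) / (4 * c)"
    have r0: "0 < r" using False c by (simp add: r_def)
    have nx: "norm (x1 - x2) = 4 * c * r" using c by (simp add: r_def)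
    have "4 * c * r \<le> 2 * R" using nx x norm_triangle_ineq4[of x1 x2] by linarith
    moreover have "4 * r \<le> 4 * c * r" using c r0 by simp
    ultimately have rR: "2 * r \<le> R" by linarith
    have "c * (4 * r) \<le> c * d" using x(3) nx by (simp add: mult_ac)
    then have rd: "4 * r \<le> d" using c by (simp add: mult_le_cancel_left_pos)
    define y where "y = (1 - r / R) *\<^sub>R x1"
    have R0: "0 < R" using rR r0 by linarith
    have "norm y = (1 - r / R) * norm x1"
      unfolding y_def using rR R0 r0 by (simp add: divide_simps)
    also have "\<dots> \<le> (1 - r / R) * R"
      using x(1) rR R0 r0 by (intro mult_left_mono) (auto simp: divide_simps)
    also have "\<dots> = R - r" using R0 by (simp add: field_simps)
    finally have yR: "norm y \<le> R - r" .
    have "y - x1 = - (r / R) *\<^sub>R x1" by (simp add: y_def algebra_simps)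
    then have "norm (y - x1) = (r / R) * norm x1" using r0 R0 by simp
    also have "\<dots> \<le> (r / R) * R" using x(1) r0 R0 by (intro mult_left_mono) auto
    finally have yx: "norm (y - x1) \<le> r" using R0 by simp
    have near1: "dist (s, x1) (s, y) \<le> r"
      using yx by (simp add: dist_Pair_Pair dist_norm norm_minus_commute)
    have near2: "dist (s, x2) (s, y) \<le> r + 4 * c * r"
      using yx nx norm_triangle_ineq[of "y - x1" "x1 - x2"]
      by (simp add: dist_Pair_Pair dist_norm norm_minus_commute)
    have cr: "r \<le> c * r" using c r0 by simp
    have sub: "ball (s, y) r \<subseteq> ball z (k * r)" if "dist z (s, y) \<le> r + 4 * c * r" for z
    proof
      fix w assume "w \<in> ball (s, y) r"
      then have "dist z w < 2 * r + 4 * c * r"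
        using that dist_triangle[of z w "(s, y)"] by simp
      also have "\<dots> \<le> k * r" using r0 by (simp add: k algebra_simps)
      finally show "w \<in> ball z (k * r)" by simp
    qed
    have sub_box: "ball (s, y) r \<subseteq> {q - 2 * d..q + 2 * d} \<times> cball 0 R"
    proof
      fix w assume w: "w \<in> ball (s, y) r"
      have "\<bar>s - fst w\<bar> < r" "dist y (snd w) < r"
        using w dist_fst_le[of "(s, y)" w] dist_snd_le[of "(s, y)" w] by (auto simp: dist_real_def)
      moreover have "norm (snd w) \<le> norm y + dist y (snd w)"
        using norm_triangle_sub[of "snd w" y] by (simp add: dist_norm norm_minus_commute)
      ultimately show "w \<in> {q - 2 * d..q + 2 * d} \<times> cball 0 R"
        using s rd r0 d yR by (auto simp: mem_Times_iff)
    qed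
    have "convex ({q - 2 * d..q + 2 * d} \<times> cball (0::'a) R)"
      by (intro convex_Times convex_real_interval convex_cball)
    moreover have "(s, x1) \<in> {q - 2 * d..q + 2 * d} \<times> cball 0 R" "(s, x2) \<in> {q - 2 * d..q + 2 * d} \<times> cball 0 R"
      using s d x by auto
    ultimately have seg_box: "closed_segment z w \<subseteq> K" if "w \<in> ball (s, y) r" "z \<in> {(s, x1), (s, x2)}" for z w
      using that sub_box box by (intro order_trans[OF closed_segment_subset box]) auto
    have "ennreal \<bar>v (s, x1) - v (s, x2)\<bar> \<le> ennreal (r * k ^ ?n) * (Mf (s, x1) + Mf (s, x2))"
      unfolding Mf_def
    proof (rule two_point_maximal_estimate[where c="(s, y)"])
      show "ball (s, y) r \<subseteq> ball (s, x1) (k * r)" "ball (s, y) r \<subseteq> ball (s, x2) (k * r)"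
        using near1 near2 c r0 by (auto intro!: sub elim!: order_trans)
    qed (use r0 k c ug seg_box in auto)
    also have "\<dots> \<le> ennreal (d * k ^ ?n) * (Mf (s, x1) + Mf (s, x2))"
      using rd r0 k c by (intro mult_right_mono ennreal_leI) auto
    finally show ?thesis .
  qed simp
  have vertical: "ennreal \<bar>v (s, x) - v (t, x)\<bar> \<le> ennreal (2 * l) * S f (t, x)"
    if "s \<in> ?I" "\<bar>q - t\<bar> + d < l" "closed_segment (t, x) (s, x) \<subseteq> K" for s t x
    unfolding S_def using that by (intro vertical_difference_le ug) auto
  have average: "(\<integral>\<^sup>+s\<in>?I. Mf (s, x) \<partial>lborel) \<le> ennreal (2 * l) * S Mf (t, x)" if "\<bar>q - t\<bar> + d < l" for t x
  proof -
    have "(\<integral>\<^sup>+s\<in>?I. Mf (s, x) \<partial>lborel) \<le> (\<integral>\<^sup>+s\<in>ball t l. Mf (s, x) \<partial>lborel)"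
      using that by (intro nn_integral_mono) (auto simp: indicator_def dist_real_def)
    also have "\<dots> \<le> S Mf (t, x) * emeasure lborel (ball t l)"
      unfolding S_def slice_maximal_function_def using ball_nn_integral_le_maximal_function[OF l0] by simp
    also have "emeasure lborel (ball t l) = ennreal (2 * l)"
      using l0 by (simp add: ball_eq_greaterThanLessThan)
    finally show ?thesis by (simp add: mult.commute)
  qed
  define A where "A = ennreal (2 * l) * (S f (t1, x1) + S f (t2, x2))"
  define B where "B = S Mf (t1, x1) + S Mf (t2, x2)"
  let ?X = "ennreal \<bar>v (t1, x1) - v (t2, x2)\<bar>" and ?D = "ennreal (d * k ^ ?n)"
  have pt: "?X \<le> A + ?D * (Mf (s, x1) + Mf (s, x2))" if s: "s \<in> ?I" for s
  proof -
    have "?X \<le> ennreal \<bar>v (s, x1) - v (t1, x1)\<bar> + ennreal \<bar>v (s, x2) - v (t2, x2)\<bar> + ennreal \<bar>v (s, x1) - v (s, x2)\<bar>"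
      by (simp flip: ennreal_plus)
    also have "\<dots> \<le> ennreal (2 * l) * S f (t1, x1) + ennreal (2 * l) * S f (t2, x2) + ?D * (Mf (s, x1) + Mf (s, x2))"
      using s l seg by (intro add_mono vertical middle) auto
    finally show ?thesis by (simp add: A_def distrib_left)
  qed
  have "ennreal (2 * d) * ?X = (\<integral>\<^sup>+s\<in>?I. ?X \<partial>lborel)"
    using d by (subst nn_integral_cmult_indicator) (auto simp: mult.commute)
  also have "\<dots> \<le> (\<integral>\<^sup>+s. A * indicator ?I s + ?D * (Mf (s, x1) * indicator ?I s + Mf (s, x2) * indicator ?I s) \<partial>lborel)"
    using pt by (intro nn_integral_mono) (auto simp: indicator_def)
  also have "\<dots> = A * ennreal (2 * d) + ?D * ((\<integral>\<^sup>+s\<in>?I. Mf (s, x1) \<partial>lborel) + (\<integral>\<^sup>+s\<in>?I. Mf (s, x2) \<partial>lborel))"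
    using d by (simp add: nn_integral_add nn_integral_cmult nn_integral_cmult_indicator)
  also have "\<dots> \<le> A * ennreal (2 * d) + ?D * (ennreal (2 * l) * S Mf (t1, x1) + ennreal (2 * l) * S Mf (t2, x2))"
    using l by (intro add_left_mono mult_left_mono add_mono average) auto
  also have "\<dots> = ennreal (2 * d) * (A + ennreal (l * k ^ ?n) * B)"
  proof -
    have "?D * ennreal (2 * l) = ennreal (2 * d) * ennreal (l * k ^ ?n)"
      using d l0 k1 by (simp add: mult_ac flip: ennreal_mult')
    then show ?thesis by (simp add: B_def distrib_left mult.assoc[symmetric] mult.commute[of A])
  qed
  finally have "?X \<le> A + ennreal (l * k ^ ?n) * B"
    using d by (subst (asm) ennreal_mult_le_mult_iff) auto
  also have "\<dots> \<le> ennreal (2 * l * k ^ ?n) * (S f (t1, x1) + S f (t2, x2)) + ennreal (2 * l * k ^ ?n) * B"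
    unfolding A_def using l0 k1 by (intro add_mono mult_right_mono ennreal_leI) (auto simp: mult_left_le)
  also have "\<dots> = ennreal (2 * l * k ^ ?n) * ((S f (t1, x1) + S Mf (t1, x1)) + (S f (t2, x2) + S Mf (t2, x2)))"
    unfolding B_def distrib_left[symmetric] by (simp add: ac_simps)
  finally show ?thesis .
qed

section \<open>Paths in the cusp domain\<close>

lemma cusp_domain_iff:
  "(t, x) \<in> cusp_domain \<psi> \<longleftrightarrow> 0 < t \<and> t < 2 \<and> norm x < \<psi> (min t 1)"
  by (cases t "1::real" rule: linorder_cases) (auto simp: cusp_domain_def min_def)

text \<open>
  The dilation factor \<open>k = 4c + 3\<close> of the path estimate for
  \<open>c = max 8 (16 \<psi>(1))\<close>. It depends on \<open>\<psi>(1)\<close> because the vertical room is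
  bounded, whereas horizontal distances range up to \<open>2 \<psi>(1)\<close>.
\<close>

definition cusp_ratio :: "(real \<Rightarrow> real) \<Rightarrow> real"
  where "cusp_ratio \<psi> = 4 * max 8 (16 * \<psi> 1) + 3"

text \<open>
  Monotonicity of \<open>\<psi>\<close> enters here, twice: the vertical segment from \<open>(t, x)\<close> to
  any greater height stays in the domain, and at heights above both points, or in the cylindrical part, the
  horizontal ball through the outer point does. The compact set \<open>K\<close> of all paths that are needed is
  chosen before \<open>v\<close> and \<open>f\<close>, so that the estimate applies to mollifications at all
  sufficiently small scales.
\<close>

theorem cusp_domain_hajlasz_estimate:
  fixes \<psi> :: "real \<Rightarrow> real" and z1 z2 :: "real \<times> (real ^ 'm::finite)"
  assumes mono: "mono_on {0<..1} \<psi>" and z: "z1 \<in> cusp_domain \<psi>" "z2 \<in> cusp_domain \<psi>"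
  shows "\<exists>K. compact K \<and> K \<subseteq> cusp_domain \<psi> \<and>
    (\<forall>v\<in>borel_measurable borel. \<forall>f\<in>borel_measurable borel.
      (\<forall>a b. closed_segment a b \<subseteq> K \<longrightarrow>
        ennreal \<bar>v b - v a\<bar> \<le> ennreal (norm (b - a)) * (\<integral>\<^sup>+s\<in>{0..1}. f (a + s *\<^sub>R (b - a)) \<partial>lborel)) \<longrightarrow>
      ennreal \<bar>v z1 - v z2\<bar> \<le> ennreal (5 * norm (z1 - z2) * cusp_ratio \<psi> ^ Suc (DIM(real \<times> (real ^ 'm)))) *
        ((slice_maximal_function f z1 + slice_maximal_function (maximal_function f) z1) +
         (slice_maximal_function f z2 + slice_maximal_function (maximal_function f) z2)))"
    (is "?P z1 z2")
proof -
  have monoD: "\<psi> (min s 1) \<le> \<psi> (min t 1)" if "0 < s" "min s 1 \<le> t" for s t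
    using that by (intro mono_onD[OF mono]) auto
  have ordered: "?P (t1, x1) (t2, x2)" if z1: "(t1, x1) \<in> cusp_domain \<psi>" and z2: "(t2, x2) \<in> cusp_domain \<psi>"
    and t12: "t1 \<le> t2" and ne: "(t1, x1) \<noteq> (t2, x2)" for t1 t2 and x1 x2 :: "real ^ 'm"
  proof -
    define r where "r = norm ((t1, x1) - (t2, x2))"
    define h where "h = min r 1 / 2"
    \<comment> \<open>The heights fill the interval [a, a+h] of length h, at most half the distance. The shift a - t2 keeps it
      below 2 when t2 is in the cylindrical part and vanishes when t2 is in the cusp.\<close>
    define a where "a = t2 - h * max 0 (t2 - 1)"
    define d where "d = h / 4"
    define q where "q = a + 2 * d"
    define c where "c = max 8 (16 * \<psi> 1)"
    define R where "R = max (norm x1) (norm x2)"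
    have r0: "0 < r" using ne by (simp add: r_def zero_prod_def)
    have h0: "0 < h" "h \<le> 1 / 2" "h \<le> r / 2" using r0 by (auto simp: h_def)
    have d0: "0 < d" using h0 by (simp add: d_def)
    have t: "0 < t1" "t1 < 2" "0 < t2" "t2 < 2" using z1 z2 by (auto simp: cusp_domain_iff)
    have x1: "norm x1 < \<psi> (min t1 1)" and x2: "norm x2 < \<psi> (min t2 1)"
      using z1 z2 by (auto simp: cusp_domain_iff)
    have "\<bar>t1 - t2\<bar> \<le> r" unfolding r_def using norm_fst_le[where x="t1 - t2" and y="x1 - x2"] by simp
    then have dt: "t2 - t1 \<le> 4 * h" using t t12 by (auto simp: h_def min_def)
    have xr: "norm (x1 - x2) \<le> r" unfolding r_def using norm_snd_le[where x="t1 - t2" and y="x1 - x2"] by simp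
    have "\<psi> (min t1 1) \<le> \<psi> 1" "\<psi> (min t2 1) \<le> \<psi> 1" using monoD[of _ 1] t by auto
    then have x12: "norm (x1 - x2) \<le> 2 * \<psi> 1" and "0 \<le> \<psi> 1"
      using x1 x2 norm_triangle_ineq4[of x1 x2] norm_ge_zero[of x1] by linarith+
    have xc: "norm (x1 - x2) \<le> c * d"
    proof (cases "r \<le> 1")
      case True
      then have "norm (x1 - x2) \<le> 8 * d" using xr by (simp add: d_def h_def)
      also have "\<dots> \<le> c * d" using d0 by (intro mult_right_mono) (auto simp: c_def)
      finally show ?thesis .
    next
      case False
      then have "norm (x1 - x2) \<le> (16 * \<psi> 1) * d" using x12 by (simp add: d_def h_def)
      also have "\<dots> \<le> c * d" using d0 by (intro mult_right_mono) (auto simp: c_def)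
      finally show ?thesis .
    qed
    have "a \<le> t2" using h0 by (simp add: a_def)
    have "t2 - h \<le> a"
    proof -
      have "h * max 0 (t2 - 1) \<le> h * 1" using h0 t by (intro mult_left_mono) auto
      then show ?thesis by (simp add: a_def)
    qed
    have a_ge: "min t2 1 \<le> a"
    proof (cases "t2 \<le> 1")
      case False
      have "h * (t2 - 1) \<le> t2 - 1" using h0 False by (intro mult_left_le_one_le) auto
      then have "1 \<le> t2 - h * (t2 - 1)" by (simp add: algebra_simps)
      then show ?thesis using False by (simp add: a_def)
    qed (simp add: a_def)
    have a_lt: "a + h < 2"
    proof (cases "t2 \<le> 1")
      case False
      have "h * (2 - t2) < 1 * (2 - t2)" using h0 t by (intro mult_strict_right_mono) auto
      then show ?thesis using False by (simp add: a_def algebra_simps)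
    qed (use h0 in \<open>simp add: a_def\<close>)
    have a0: "0 < a" using a_ge t by linarith
    have box: "{a..a + h} \<times> cball (0 :: real ^ 'm) R \<subseteq> cusp_domain \<psi>"
    proof
      fix w assume "w \<in> {a..a + h} \<times> cball (0 :: real ^ 'm) R"
      then obtain s x where w: "w = (s, x)" and s: "s \<in> {a..a + h}" and x: "x \<in> cball 0 R" by auto
      have "\<psi> (min t1 1) \<le> \<psi> (min s 1)" "\<psi> (min t2 1) \<le> \<psi> (min s 1)"
        using s a_ge t t12 by (auto intro!: monoD)
      then have "norm x < \<psi> (min s 1)" using x x1 x2 by (auto simp: R_def)
      then show "w \<in> cusp_domain \<psi>" using s a0 a_lt by (simp add: w cusp_domain_iff)
    qed
    define V where "V t x = {min t a..max t (a + h)} \<times> {x}" for t and x :: "real ^ 'm"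
    have V_sub: "V t x \<subseteq> cusp_domain \<psi>" if "(t, x) \<in> cusp_domain \<psi>" "t \<le> t2" for t x
    proof
      fix w assume "w \<in> V t x"
      then obtain s where w: "w = (s, x)" and s: "min t a \<le> s" "s \<le> max t (a + h)" by (auto simp: V_def)
      have tt: "0 < t" "t < 2" "norm x < \<psi> (min t 1)" using that by (auto simp: cusp_domain_iff)
      have "\<psi> (min t 1) \<le> \<psi> (min s 1)" using s tt a_ge that(2) by (intro monoD) auto
      then show "w \<in> cusp_domain \<psi>" using tt s a0 a_lt by (auto simp: w cusp_domain_iff)
    qed
    have V_seg: "closed_segment (t, x) (s, x) \<subseteq> V t x" if "s \<in> {a..a + h}" for s t x
      unfolding V_def using that
      by (intro closed_segment_subset convex_Times convex_real_interval convex_singleton) auto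
    let ?K = "{a..a + h} \<times> cball 0 R \<union> V t1 x1 \<union> V t2 x2"
    have "compact ?K" unfolding V_def by (intro compact_Un compact_Times) auto
    moreover have "?K \<subseteq> cusp_domain \<psi>" using box V_sub[OF z1 t12] V_sub[OF z2] by auto
    moreover have "ennreal \<bar>v (t1, x1) - v (t2, x2)\<bar> \<le>
        ennreal (5 * norm ((t1, x1) - (t2, x2)) * cusp_ratio \<psi> ^ Suc (DIM(real \<times> (real ^ 'm)))) *
        ((slice_maximal_function f (t1, x1) + slice_maximal_function (maximal_function f) (t1, x1)) +
         (slice_maximal_function f (t2, x2) + slice_maximal_function (maximal_function f) (t2, x2)))"
      if meas: "v \<in> borel_measurable borel" "f \<in> borel_measurable borel"
      and ug: "\<forall>a b. closed_segment a b \<subseteq> ?K \<longrightarrow>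
        ennreal \<bar>v b - v a\<bar> \<le> ennreal (norm (b - a)) * (\<integral>\<^sup>+s\<in>{0..1}. f (a + s *\<^sub>R (b - a)) \<partial>lborel)"
      for v :: "real \<times> (real ^ 'm) \<Rightarrow> real" and f :: "real \<times> (real ^ 'm) \<Rightarrow> ennreal"
    proof -
      let ?k = "cusp_ratio \<psi>"
      have "ennreal \<bar>v (t1, x1) - v (t2, x2)\<bar> \<le> ennreal (2 * (5 * h) * ?k ^ Suc (DIM(real \<times> (real ^ 'm)))) *
        ((slice_maximal_function f (t1, x1) + slice_maximal_function (maximal_function f) (t1, x1)) +
         (slice_maximal_function f (t2, x2) + slice_maximal_function (maximal_function f) (t2, x2)))"
      proof (rule hajlasz_estimate_along_paths[OF meas(2) meas(1), where K="?K" and d=d and c=c and q=q and R=R])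
        show "\<bar>q - t1\<bar> + d < 5 * h" "\<bar>q - t2\<bar> + d < 5 * h"
          using \<open>a \<le> t2\<close> \<open>t2 - h \<le> a\<close> dt t12 h0 by (auto simp: q_def d_def abs_less_iff)
        show "{q - 2 * d..q + 2 * d} \<times> cball 0 R \<subseteq> ?K" by (auto simp: q_def d_def)
        have "{q - d..q + d} \<subseteq> {a..a + h}" using h0 by (auto simp: q_def d_def)
        then show "closed_segment (t1, x1) (s, x1) \<subseteq> ?K" "closed_segment (t2, x2) (s, x2) \<subseteq> ?K"
          if "s \<in> {q - d..q + d}" for s
          using V_seg[of s t1 x1] V_seg[of s t2 x2] that by blast+
      qed (use ug d0 xc in \<open>auto simp: c_def R_def cusp_ratio_def\<close>)
      also have "\<dots> \<le> ennreal (5 * r * ?k ^ Suc (DIM(real \<times> (real ^ 'm)))) *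
        ((slice_maximal_function f (t1, x1) + slice_maximal_function (maximal_function f) (t1, x1)) +
         (slice_maximal_function f (t2, x2) + slice_maximal_function (maximal_function f) (t2, x2)))"
        using h0 by (intro mult_right_mono ennreal_leI zero_le_power) (auto simp: cusp_ratio_def)
      finally show ?thesis by (simp add: r_def)
    qed
    ultimately show ?thesis
      by (intro exI[of _ ?K] conjI ballI impI) assumption+
  qed
  show ?thesis
  proof (cases "z1 = z2")
    case True
    then show ?thesis using z by (intro exI[of _ "{}"]) auto
  next
    case False
    obtain t1 x1 t2 x2 where eq: "z1 = (t1, x1)" "z2 = (t2, x2)" by (cases z1; cases z2)
    show ?thesis
    proof (cases "t1 \<le> t2")
      case True
      have "z1 \<noteq> z2" by fact
      then show ?thesis using z True unfolding eq by (intro ordered)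
    next
      case False
      have "z2 \<noteq> z1" "t2 \<le> t1" using \<open>z1 \<noteq> z2\<close> False by auto
      then have "?P (t2, x2) (t1, x1)" using z unfolding eq by (intro ordered)
      then show ?thesis
        unfolding eq by (simp only: abs_minus_commute norm_minus_commute[of "(t2, x2)"] add.commute)
    qed
  qed
qed

section \<open>Hajlasz gradients from weak gradients\<close>

lemma AE_lborel_affine:
  fixes t :: "'a::euclidean_space"
  assumes "AE x in lborel. P x" and c: "c \<noteq> 0"
  shows "AE x in lborel. P (t + c *\<^sub>R x)"
proof -
  obtain N where N: "{x. \<not> P x} \<subseteq> N" "N \<in> sets borel" "emeasure lborel N = 0"
    using AE_E[OF assms(1)] by auto
  note [measurable] = N(2)
  have "(\<integral>\<^sup>+x. indicator N x \<partial>lborel) = 0" using N by simp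
  then have "(\<integral>\<^sup>+x. indicator N (t + c *\<^sub>R x) \<partial>lborel) = 0"
    using c by (subst (asm) nn_integral_lborel_affine[OF _ c, of _ t]) auto
  then have "AE x in lborel. indicator N (t + c *\<^sub>R x) = (0::ennreal)"
    by (subst (asm) nn_integral_0_iff_AE) auto
  then show ?thesis
    by eventually_elim (use N(1) in \<open>auto simp: indicator_def split: if_splits\<close>)
qed

text \<open>
  The maximal functions are finite almost everywhere, but need not be integrable on the whole space. Near
  \<open>\<Omega>\<close>, mollification at scales below \<open>1\<close> sees only their restriction to a
  bounded ball, which is integrable.
\<close>

lemma (in mollifier) nn_mollify_eq_mollify:
  assumes [measurable]: "h \<in> borel_measurable borel"
    and fin: "(\<integral>\<^sup>+z\<in>ball 0 (b + 1). h z \<partial>lborel) < \<infinity>"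
    and z: "norm z < b" and e: "0 < e" "e < 1"
  defines "F \<equiv> \<lambda>z. indicator (ball 0 (b + 1)) z * enn2real (h z)"
  shows "integrable lborel F" "nn_mollify e h z = ennreal (mollify e F z)"
    "AE z in lborel. norm z < b \<longrightarrow> h z = ennreal (F z)"
proof -
  have [measurable]: "ball (0::'a) (b + 1) \<in> sets borel" by simp
  have "AE w in lborel. h w * indicator (ball 0 (b + 1)) w \<noteq> \<infinity>"
    using fin by (intro nn_integral_PInf_AE) auto
  then have AE_F: "AE w in lborel. w \<in> ball 0 (b + 1) \<longrightarrow> h w = ennreal (F w)"
    by eventually_elim (auto simp: F_def less_top)
  then show "AE z in lborel. norm z < b \<longrightarrow> h z = ennreal (F z)"
    by eventually_elim auto
  have [measurable]: "F \<in> borel_measurable borel" unfolding F_def by measurable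
  have "(\<integral>\<^sup>+w. ennreal (norm (F w)) \<partial>lborel) \<le> (\<integral>\<^sup>+z\<in>ball 0 (b + 1). h z \<partial>lborel)"
    by (intro nn_integral_mono) (auto simp: F_def indicator_def ennreal_enn2real_if)
  then show int: "integrable lborel F"
    using fin by (intro integrableI_bounded) auto
  have "nn_mollify e h z = nn_mollify e (\<lambda>z. ennreal (F z)) z"
    unfolding nn_mollify_def
  proof (rule nn_integral_cong_AE)
    have "AE y in lborel. z + (- e) *\<^sub>R y \<in> ball 0 (b + 1) \<longrightarrow> h (z + (- e) *\<^sub>R y) = ennreal (F (z + (- e) *\<^sub>R y))"
      using AE_lborel_affine[OF AE_F, of "- e" z] e by simp
    then show "AE y in lborel. ennreal (\<phi> y) * h (z - e *\<^sub>R y) = ennreal (\<phi> y) * ennreal (F (z - e *\<^sub>R y))"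
    proof eventually_elim
      case (elim y)
      show ?case
      proof (cases "norm y < 1")
        case True
        have "norm (z - e *\<^sub>R y) \<le> norm z + e * norm y"
          using norm_triangle_ineq4[of z "e *\<^sub>R y"] e by simp
        also have "\<dots> < b + 1"
          using z e True mult_strict_mono[of e 1 "norm y" 1] by simp
        finally show ?thesis using elim by simp
      qed (simp add: kernel_support)
    qed
  qed
  also have "\<dots> = ennreal (mollify e F z)"
    by (intro nn_mollify_ennreal int e) (simp add: F_def)
  finally show "nn_mollify e h z = ennreal (mollify e F z)" .
qed

lemma compact_subset_open_cball:
  fixes K :: "'a::euclidean_space set"
  assumes "compact K" "open S" "K \<subseteq> S"
  obtains d where "0 < d" "\<And>z. z \<in> K \<Longrightarrow> cball z d \<subseteq> S"
proof (cases "K = {} \<or> S = UNIV")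
  case True
  then show ?thesis by (intro that[of 1]) auto
next
  case False
  have cl: "closed (- S)" using assms(2) by auto
  have "0 < setdist K (- S)"
    using setdist_gt_0_compact_closed[OF assms(1) cl] False assms(3) by auto
  then show ?thesis
  proof (intro that[of "setdist K (- S) / 2"])
    fix z assume "z \<in> K"
    show "cball z (setdist K (- S) / 2) \<subseteq> S"
    proof (rule ccontr)
      assume "\<not> cball z (setdist K (- S) / 2) \<subseteq> S"
      then obtain w where "w \<in> cball z (setdist K (- S) / 2)" "w \<in> - S" by blast
      moreover have "setdist K (- S) \<le> dist z w"
        using \<open>z \<in> K\<close> \<open>w \<in> - S\<close> by (rule setdist_le_dist)
      ultimately show False using \<open>0 < setdist K (- S)\<close> by simp
    qed
  qed simp
qed

text \<open>
  Up to a constant, this is a Hajlasz gradient of \<open>u\<close> when \<open>f = |\<nabla>u|\<close>.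
\<close>

definition cusp_gradient :: "(real \<times> (real ^ 'm::finite) \<Rightarrow> ennreal) \<Rightarrow> real \<times> (real ^ 'm) \<Rightarrow> ennreal"
  where "cusp_gradient f z = slice_maximal_function f z + slice_maximal_function (maximal_function f) z"

lemma borel_measurable_cusp_gradient [measurable]:
  assumes [measurable]: "f \<in> borel_measurable borel"
  shows "cusp_gradient f \<in> borel_measurable borel"
  unfolding cusp_gradient_def[abs_def] by measurable

lemma slice_maximal_function_mono:
  "(\<And>z. f z \<le> g z) \<Longrightarrow> slice_maximal_function f z \<le> slice_maximal_function g z"
  unfolding slice_maximal_function_def by (intro maximal_function_mono)

text \<open>
  The estimate for the domain is applied to the mollifications of \<open>u\<close> and of
  \<open>|\<nabla>u|\<close>. By the commutation inequalities, its right-hand side is at most the mollification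
  of \<open>cusp_gradient |\<nabla>u|\<close>, and both sides converge almost everywhere along a common sequence
  of scales. The set \<open>E\<close> collects the points where convergence fails or the gradient is infinite.
\<close>

theorem weak_gradient_imp_hajlasz:
  fixes \<psi> :: "real \<Rightarrow> real" and u :: "real \<times> (real ^ 'm::finite) \<Rightarrow> real"
  defines "\<Omega> \<equiv> cusp_domain \<psi>"
  defines "C \<equiv> 5 * cusp_ratio \<psi> ^ Suc (DIM(real \<times> (real ^ 'm)))"
  assumes mono: "mono_on {0<..1} \<psi>" and "open \<Omega>" and pos: "0 \<le> \<psi> 1"
    and G: "has_weak_gradient \<Omega> u G"
    and U: "integrable lborel U" "AE z in lebesgue. z \<in> \<Omega> \<longrightarrow> U z = u z"
    and H: "integrable lborel H" "AE z in lebesgue. z \<in> \<Omega> \<longrightarrow> H z = G z"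
    and b: "\<And>z. z \<in> \<Omega> \<Longrightarrow> norm z < b"
    and fin: "(\<integral>\<^sup>+z\<in>ball 0 (b + 1). cusp_gradient (\<lambda>w. ennreal (norm (H w))) z \<partial>lborel) < \<infinity>"
  obtains E where "E \<in> null_sets lborel"
    "\<And>z1 z2. z1 \<in> \<Omega> - E \<Longrightarrow> z2 \<in> \<Omega> - E \<Longrightarrow> \<bar>U z1 - U z2\<bar> \<le>
      norm (z1 - z2) * (C * enn2real (cusp_gradient (\<lambda>w. ennreal (norm (H w))) z1) +
                        C * enn2real (cusp_gradient (\<lambda>w. ennreal (norm (H w))) z2))"
proof -
  obtain \<phi> :: "real \<times> (real ^ 'm) \<Rightarrow> real" where \<phi>: "\<And>k. Ck k \<phi>" "\<And>z. 0 \<le> \<phi> z"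
    "\<And>z. 1 \<le> norm z \<Longrightarrow> \<phi> z = 0" "integrable lborel \<phi>" "(\<integral>z. \<phi> z \<partial>lborel) = 1"
    using exists_mollifier by blast
  interpret mollifier \<phi> by unfold_locales (use \<phi> in auto)
  note [measurable] = borel_measurable_integrable[OF U(1), simplified] borel_measurable_integrable[OF H(1), simplified]
  define f where "f = (\<lambda>w. ennreal (norm (H w)))"
  have [measurable]: "f \<in> borel_measurable borel" unfolding f_def by measurable
  define h where "h = cusp_gradient f"
  have [measurable]: "h \<in> borel_measurable borel" unfolding h_def by measurable
  have C0: "0 \<le> C" using pos by (simp add: C_def cusp_ratio_def)
  have fin': "(\<integral>\<^sup>+z\<in>ball 0 (b + 1). h z \<partial>lborel) < \<infinity>" using fin by (simp add: h_def f_def)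
  define F where "F = (\<lambda>z. indicator (ball 0 (b + 1)) z * enn2real (h z))"
  define e where "e n = 1 / 2 * (1 / (real n + 1))" for n
  have e: "0 < e n" "e n < 1" for n by (auto simp: e_def field_simps)
  have e_lim: "e \<longlonglongrightarrow> 0"
  proof -
    have "e \<longlonglongrightarrow> 1 / 2 * 0" unfolding e_def by (intro tendsto_intros one_div_Suc_tendsto_0)
    then show ?thesis by simp
  qed
  have F: "integrable lborel F" and hF: "AE z in lborel. norm z < b \<longrightarrow> h z = ennreal (F z)" if "\<Omega> \<noteq> {}"
  proof -
    obtain z where "z \<in> \<Omega>" using \<open>\<Omega> \<noteq> {}\<close> by blast
    from nn_mollify_eq_mollify[OF _ fin' b[OF this] e[of 0]]
    show "integrable lborel F" "AE z in lborel. norm z < b \<longrightarrow> h z = ennreal (F z)" by (auto simp: F_def)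
  qed
  have nnF: "nn_mollify (e n) h z = ennreal (mollify (e n) F z)" if "z \<in> \<Omega>" for n z
    using nn_mollify_eq_mollify(2)[OF _ fin' b[OF that] e[of n]] by (simp add: F_def)
  show ?thesis
  proof (cases "\<Omega> = {}")
    case True
    then show ?thesis by (intro that[of "{}"]) auto
  next
    case False
    obtain r1 where r1: "strict_mono r1" "AE z in lborel. (\<lambda>n. mollify (e (r1 n)) U z) \<longlonglongrightarrow> U z"
      using mollify_tendsto_AE_subseq[OF U(1) e(1) e_lim] by blast
    have e_lim1: "(\<lambda>n. e (r1 n)) \<longlonglongrightarrow> 0"
      using LIMSEQ_subseq_LIMSEQ[OF e_lim r1(1)] by (simp add: comp_def)
    obtain r2 where r2: "strict_mono r2" "AE z in lborel. (\<lambda>n. mollify (e (r1 (r2 n))) F z) \<longlonglongrightarrow> F z"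
      using mollify_tendsto_AE_subseq[OF F[OF False] e(1) e_lim1] by blast
    define s where "s n = e (r1 (r2 n))" for n
    have s_lim: "s \<longlonglongrightarrow> 0"
      using LIMSEQ_subseq_LIMSEQ[OF e_lim1 r2(1)] by (simp add: comp_def s_def[abs_def])
    have "AE z in lborel. (\<lambda>n. mollify (s n) U z) \<longlonglongrightarrow> U z \<and> (\<lambda>n. mollify (s n) F z) \<longlonglongrightarrow> F z \<and> (norm z < b \<longrightarrow> h z = ennreal (F z))"
      using r1(2) r2(2) hF[OF False]
    proof eventually_elim
      case (elim z)
      then show ?case
        using LIMSEQ_subseq_LIMSEQ[OF elim(1) r2(1)] by (simp add: comp_def s_def)
    qed
    from AE_E3[OF this] obtain E where E: "\<And>z. z \<in> space lborel - E \<Longrightarrow> (\<lambda>n. mollify (s n) U z) \<longlonglongrightarrow> U z \<and> (\<lambda>n. mollify (s n) F z) \<longlonglongrightarrow> F z \<and> (norm z < b \<longrightarrow> h z = ennreal (F z))"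
      "E \<in> null_sets lborel" by metis
    have E': "(\<lambda>n. mollify (s n) U z) \<longlonglongrightarrow> U z" "(\<lambda>n. mollify (s n) F z) \<longlonglongrightarrow> F z" "F z = enn2real (h z)"
      if "z \<in> \<Omega> - E" for z
      using that E(1)[of z] b[of z] by (auto simp: F_def)
    show ?thesis
    proof (rule that[OF E(2)])
      fix z1 z2 assume z: "z1 \<in> \<Omega> - E" "z2 \<in> \<Omega> - E"
      then have zO: "z1 \<in> \<Omega>" "z2 \<in> \<Omega>" by auto
      have C_eq: "5 * norm (z1 - z2) * cusp_ratio \<psi> ^ Suc (DIM(real \<times> (real ^ 'm))) = norm (z1 - z2) * C"
        by (simp add: C_def)
      obtain K where K: "compact K" "K \<subseteq> \<Omega>" and est: "\<forall>v\<in>borel_measurable borel. \<forall>f\<in>borel_measurable borel.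
        (\<forall>a b. closed_segment a b \<subseteq> K \<longrightarrow>
        ennreal \<bar>v b - v a\<bar> \<le> ennreal (norm (b - a)) * (\<integral>\<^sup>+s\<in>{0..1}. f (a + s *\<^sub>R (b - a)) \<partial>lborel)) \<longrightarrow>
        ennreal \<bar>v z1 - v z2\<bar> \<le> ennreal (norm (z1 - z2) * C) * (cusp_gradient f z1 + cusp_gradient f z2)"
        using cusp_domain_hajlasz_estimate[OF mono zO[unfolded \<Omega>_def]]
        unfolding C_eq \<Omega>_def[symmetric] cusp_gradient_def by (elim exE conjE)
      obtain d where d: "0 < d" "\<And>z. z \<in> K \<Longrightarrow> cball z d \<subseteq> \<Omega>"
        using compact_subset_open_cball[OF K(1) \<open>open \<Omega>\<close> K(2)] by blast
      have ineq: "\<bar>mollify (s n) U z1 - mollify (s n) U z2\<bar> \<le> norm (z1 - z2) * (C * mollify (s n) F z1 + C * mollify (s n) F z2)"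
        if n: "s n < d" for n
      proof -
        have s: "0 < s n" using e by (simp add: s_def)
        have "ennreal \<bar>mollify (s n) U z1 - mollify (s n) U z2\<bar> \<le>
          ennreal (norm (z1 - z2) * C) * (cusp_gradient (nn_mollify (s n) f) z1 + cusp_gradient (nn_mollify (s n) f) z2)"
        proof (rule est[rule_format])
          fix a b assume ab: "closed_segment a b \<subseteq> K"
          have "cball (a + q *\<^sub>R (b - a)) (s n) \<subseteq> \<Omega>" if "0 \<le> q" "q \<le> 1" for q
          proof -
            have "a + q *\<^sub>R (b - a) \<in> closed_segment a b"
              using that by (auto simp: closed_segment_def algebra_simps intro!: exI[of _ q])
            then have "cball (a + q *\<^sub>R (b - a)) d \<subseteq> \<Omega>" using ab by (intro d(2)) blast
            moreover have "cball (a + q *\<^sub>R (b - a)) (s n) \<subseteq> cball (a + q *\<^sub>R (b - a)) d"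
              using n by (intro subset_cball) simp
            ultimately show ?thesis by (rule order_trans[rotated])
          qed
          from mollify_upper_gradient[OF \<open>open \<Omega>\<close> G U H s this]
          show "ennreal \<bar>mollify (s n) U b - mollify (s n) U a\<bar> \<le> ennreal (norm (b - a)) *
              (\<integral>\<^sup>+q\<in>{0..1}. nn_mollify (s n) f (a + q *\<^sub>R (b - a)) \<partial>lborel)"
            by (simp add: f_def)
        qed measurable
        also have "\<dots> \<le> ennreal (norm (z1 - z2) * C) * (nn_mollify (s n) h z1 + nn_mollify (s n) h z2)"
        proof (intro mult_left_mono add_mono)
          have "cusp_gradient (nn_mollify (s n) f) z \<le> nn_mollify (s n) h z" for z
          proof -
            have "slice_maximal_function (maximal_function (nn_mollify (s n) f)) z \<le>
                slice_maximal_function (nn_mollify (s n) (maximal_function f)) z"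
              by (intro slice_maximal_function_mono maximal_function_nn_mollify_le) measurable
            also have "\<dots> \<le> nn_mollify (s n) (slice_maximal_function (maximal_function f)) z"
              by (intro slice_maximal_function_nn_mollify_le mollifier_axioms) measurable
            finally have "cusp_gradient (nn_mollify (s n) f) z \<le>
               nn_mollify (s n) (slice_maximal_function f) z + nn_mollify (s n) (slice_maximal_function (maximal_function f)) z"
              unfolding cusp_gradient_def
              by (intro add_mono slice_maximal_function_nn_mollify_le mollifier_axioms) measurable
            also have "\<dots> = nn_mollify (s n) h z"
              unfolding h_def cusp_gradient_def[abs_def] by (rule nn_mollify_add[symmetric]) measurable
            finally show ?thesis .
          qed
          then show "cusp_gradient (nn_mollify (s n) f) z1 \<le> nn_mollify (s n) h z1"
            "cusp_gradient (nn_mollify (s n) f) z2 \<le> nn_mollify (s n) h z2" by auto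
        qed simp
        also have "\<dots> = ennreal (norm (z1 - z2) * C) * ennreal (mollify (s n) F z1 + mollify (s n) F z2)"
        proof -
          have "0 \<le> mollify (s n) F z" for z
            unfolding mollify_def by (intro integral_nonneg_AE AE_I2) (simp add: F_def \<phi>(2))
          then show ?thesis using nnF zO by (simp add: s_def)
        qed
        also have "\<dots> = ennreal (norm (z1 - z2) * (C * mollify (s n) F z1 + C * mollify (s n) F z2))"
          using C0 by (simp add: ennreal_mult'[symmetric] algebra_simps)
        finally show ?thesis
          using C0 by (subst (asm) ennreal_le_iff) (auto intro!: mult_nonneg_nonneg add_nonneg_nonneg integral_nonneg_AE AE_I2 simp: F_def \<phi>(2) mollify_def)
      qed
      have "\<forall>\<^sub>F n in sequentially. s n < d" using order_tendstoD(2)[OF s_lim d(1)] .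
      then have ev: "\<forall>\<^sub>F n in sequentially. \<bar>mollify (s n) U z1 - mollify (s n) U z2\<bar> \<le> norm (z1 - z2) * (C * mollify (s n) F z1 + C * mollify (s n) F z2)"
        by eventually_elim (rule ineq)
      have "\<bar>U z1 - U z2\<bar> \<le> norm (z1 - z2) * (C * F z1 + C * F z2)"
        by (rule tendsto_le[OF sequentially_bot _ _ ev]) (intro tendsto_intros E' z)+
      then show "\<bar>U z1 - U z2\<bar> \<le> norm (z1 - z2) * (C * enn2real (cusp_gradient (\<lambda>w. ennreal (norm (H w))) z1) +
                        C * enn2real (cusp_gradient (\<lambda>w. ennreal (norm (H w))) z2))"
        using E'(3)[OF z(1)] E'(3)[OF z(2)] by (simp add: h_def f_def)
    qed
  qed
qed

section \<open>Limits of convex combinations\<close>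

text \<open>
  The convex combinations that arise by repeatedly taking midpoints. They suffice for the parallelogram law and
  let bounds pass to the hull by rule induction.
\<close>

inductive_set midpoint_hull :: "('a \<Rightarrow> real) set \<Rightarrow> ('a \<Rightarrow> real) set" for S
  where
    base: "f \<in> S \<Longrightarrow> f \<in> midpoint_hull S"
  | midpoint: "f \<in> midpoint_hull S \<Longrightarrow> g \<in> midpoint_hull S \<Longrightarrow> (\<lambda>x. (f x + g x) / 2) \<in> midpoint_hull S"

lemma midpoint_hull_mono: "S \<subseteq> T \<Longrightarrow> midpoint_hull S \<subseteq> midpoint_hull T"
proof
  fix f assume "S \<subseteq> T" "f \<in> midpoint_hull S"
  from this(2,1) show "f \<in> midpoint_hull T"
    by (induction rule: midpoint_hull.induct) (auto intro: midpoint_hull.intros)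
qed

lemma abs_midpoint_diff_le:
  fixes x y :: real
  shows "\<bar>x - c\<bar> \<le> b \<Longrightarrow> \<bar>y - c\<bar> \<le> b \<Longrightarrow> \<bar>(x + y) / 2 - c\<bar> \<le> b"
  unfolding abs_le_iff by (auto simp: field_simps)

lemma midpoint_hull_abs_le:
  assumes "f \<in> midpoint_hull S" "\<And>f. f \<in> S \<Longrightarrow> \<bar>f x - c\<bar> \<le> b"
  shows "\<bar>f x - c\<bar> \<le> b"
  using assms by (induction rule: midpoint_hull.induct) (auto intro!: abs_midpoint_diff_le)

lemma midpoint_hull_integrable:
  assumes "f \<in> midpoint_hull S" "\<And>f. f \<in> S \<Longrightarrow> integrable M f"
  shows "integrable M f"
  using assms by (induction rule: midpoint_hull.induct) auto

lemma midpoint_hull_integral_le: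
  assumes "f \<in> midpoint_hull S" "\<And>f. f \<in> S \<Longrightarrow> integrable M (\<lambda>x. f x * w x)"
    "\<And>f. f \<in> S \<Longrightarrow> \<bar>(\<integral>x. f x * w x \<partial>M) - c\<bar> \<le> b"
  shows "integrable M (\<lambda>x. f x * w x) \<and> \<bar>(\<integral>x. f x * w x \<partial>M) - c\<bar> \<le> b"
  using assms
proof (induction rule: midpoint_hull.induct)
  case (midpoint f g)
  then have int: "integrable M (\<lambda>x. f x * w x)" "integrable M (\<lambda>x. g x * w x)"
    and le: "\<bar>(\<integral>x. f x * w x \<partial>M) - c\<bar> \<le> b" "\<bar>(\<integral>x. g x * w x \<partial>M) - c\<bar> \<le> b" by auto
  have eq: "(\<lambda>x. (f x + g x) / 2 * w x) = (\<lambda>x. (f x * w x + g x * w x) / 2)"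
    by (auto simp: algebra_simps)
  show ?case unfolding eq using int abs_midpoint_diff_le[OF le] by simp
qed auto

text \<open>
  A substitute for weak compactness in \<open>L\<^sup>1\<close> of a dominated sequence. With the weight
  \<open>1/h\<close>, the domination \<open>|f\<^sub>n| \<le> h\<close> bounds
  \<open>q(f) = \<integral> f\<^sup>2 / h\<close> by \<open>\<integral> h\<close>, and \<open>q\<close> obeys
  the parallelogram law. Near-minimisers of \<open>q\<close> over the hulls of the tails therefore form a Cauchy
  sequence with respect to \<open>q\<close>, hence in \<open>L\<^sup>1\<close>, and a subsequence converges
  almost everywhere. Where \<open>h = 0\<close> all functions vanish and the convention \<open>x / 0 = 0\<close>
  is harmless.
\<close>

theorem dominated_midpoint_limit:
  fixes f :: "nat \<Rightarrow> 'a \<Rightarrow> real" and h :: "'a \<Rightarrow> real"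
  assumes f: "\<And>n. integrable M (f n)" and h: "integrable M h" and dom: "\<And>n x. \<bar>f n x\<bar> \<le> h x"
  obtains g G where "\<And>n. g n \<in> midpoint_hull (f ` {n..})" "integrable M G" "AE x in M. (\<lambda>n. g n x) \<longlonglongrightarrow> G x"
proof -
  define K where "K n = midpoint_hull (f ` {n..})" for n
  define q where "q k = (\<integral>x. (k x)\<^sup>2 / h x \<partial>M)" for k
  have h0: "0 \<le> h x" for x using dom[of 0 x] by linarith
  have K_mono: "K m \<subseteq> K n" if "n \<le> m" for n m
    unfolding K_def using that by (intro midpoint_hull_mono image_mono) auto
  have K_int: "integrable M k" if "k \<in> K n" for k n
    using that unfolding K_def by (rule midpoint_hull_integrable) (use f in auto)
  have K_dom: "\<bar>k x\<bar> \<le> h x" if "k \<in> K n" for k n x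
    using midpoint_hull_abs_le[of k "f ` {n..}" x 0 "h x"] that dom unfolding K_def by auto
  note [measurable] = borel_measurable_integrable[OF h]
  have sq_le: "y\<^sup>2 / h x \<le> h x" if "\<bar>y\<bar> \<le> h x" for x y
  proof (cases "h x = 0")
    case False
    then have "0 < h x" using h0[of x] by simp
    moreover have "y\<^sup>2 \<le> (h x)\<^sup>2" using that by (metis abs_le_square_iff abs_of_nonneg h0)
    ultimately show ?thesis by (simp add: divide_simps power2_eq_square)
  qed simp
  have sq_int: "integrable M (\<lambda>x. (k x)\<^sup>2 / h x)" if "k \<in> borel_measurable M" "\<And>x. \<bar>k x\<bar> \<le> h x" for k
  proof (rule Bochner_Integration.integrable_bound[OF h])
    show "(\<lambda>x. (k x)\<^sup>2 / h x) \<in> borel_measurable M" using that(1) by measurable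
    show "AE x in M. norm ((k x)\<^sup>2 / h x) \<le> norm (h x)"
      using sq_le[OF that(2)] h0 by (intro AE_I2) simp
  qed
  have K_sq_int: "integrable M (\<lambda>x. (k x)\<^sup>2 / h x)" if "k \<in> K n" for k n
    using K_int[OF that] K_dom[OF that] by (intro sq_int) auto
  have q0: "0 \<le> q k" for k
    unfolding q_def by (intro integral_nonneg_AE AE_I2) (simp add: h0)
  have q_le: "q k \<le> (\<integral>x. h x \<partial>M)" if "k \<in> K n" for k n
    unfolding q_def using sq_le[OF K_dom[OF that]] by (intro integral_mono K_sq_int[OF that] h)
  define d where "d n = Inf (q ` K n)" for n
  have bdd: "bdd_below (q ` K n)" for n using q0 by (intro bdd_belowI[of _ 0]) auto
  have fK: "f n \<in> K n" for n unfolding K_def by (rule midpoint_hull.base) simp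
  have d_le: "d n \<le> q k" if "k \<in> K n" for n k
    unfolding d_def using that by (intro cInf_lower bdd) auto
  have d_mono: "d n \<le> d m" if "n \<le> m" for n m
    unfolding d_def using fK[of m] K_mono[OF that] by (intro cInf_superset_mono bdd) auto
  have d_bound: "d n \<le> (\<integral>x. h x \<partial>M)" for n using d_le[OF fK] q_le[OF fK] by (rule order_trans)
  obtain L where L: "d \<longlonglongrightarrow> L"
    by (rule incseq_convergent[of d "\<integral>x. h x \<partial>M"]) (use d_mono d_bound in \<open>auto simp: incseq_def\<close>)
  define w where "w n = 1 / (real n + 1)" for n
  have w_pos: "0 < w n" for n by (simp add: w_def)
  have "\<exists>k. k \<in> K n \<and> q k < d n + w n" for n
  proof -
    have "Inf (q ` K n) < d n + w n" using w_pos by (simp add: d_def)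
    then show ?thesis using fK[of n] bdd by (subst (asm) cInf_less_iff) auto
  qed
  then obtain g where gK: "\<And>n. g n \<in> K n" and gq: "\<And>n. q (g n) < d n + w n" by metis
  have parallelogram: "(a - b)\<^sup>2 / c = 2 * (a\<^sup>2 / c) + 2 * (b\<^sup>2 / c) - 4 * (((a + b) / 2)\<^sup>2 / c)" for a b c :: real
  proof -
    have "(a - b)\<^sup>2 = 2 * a\<^sup>2 + 2 * b\<^sup>2 - 4 * ((a + b) / 2)\<^sup>2"
      by (simp add: power2_eq_square field_simps)
    then show ?thesis by (simp only: add_divide_distrib diff_divide_distrib times_divide_eq_right)
  qed
  have diff_q: "q (\<lambda>x. g n x - g m x) \<le> 2 * (d m - d n) + 4 * w n" if nm: "n \<le> m" for n m
  proof -
    have mid: "(\<lambda>x. (g n x + g m x) / 2) \<in> K n"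
      using gK[of n] gK[of m] K_mono[OF nm] unfolding K_def by (intro midpoint_hull.midpoint) auto
    have "q (\<lambda>x. g n x - g m x) = (\<integral>x. 2 * ((g n x)\<^sup>2 / h x) + 2 * ((g m x)\<^sup>2 / h x) - 4 * (((g n x + g m x) / 2)\<^sup>2 / h x) \<partial>M)"
      unfolding q_def by (simp only: parallelogram)
    also have "\<dots> = 2 * q (g n) + 2 * q (g m) - 4 * q (\<lambda>x. (g n x + g m x) / 2)"
      unfolding q_def using K_sq_int[OF gK[of n]] K_sq_int[OF gK[of m]] K_sq_int[OF mid]
      by (simp del: times_divide_eq_right)
    also have "\<dots> \<le> 2 * (d n + w n) + 2 * (d m + w m) - 4 * d n"
    proof -
      have "a + b - 2 * c \<le> (dn + wn) + (dm + wm) - 2 * dn" if "a < dn + wn" "b < dm + wm" "dn \<le> c" for a b c dn wn dm wm :: real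
        using that by linarith
      from this[OF gq[of n] gq[of m] d_le[OF mid]] show ?thesis by (simp add: algebra_simps)
    qed
    also have "w m \<le> w n" unfolding w_def using nm by (intro divide_left_mono) auto
    finally show ?thesis by simp
  qed
  \<comment> \<open>Since |y| is at most (t/2) h + y^2 / (2 t h) for every t > 0, the weighted square norm controls the L1 norm.\<close>
  have L1_le: "(\<integral>x. \<bar>g n x - g m x\<bar> \<partial>M) \<le> t / 2 * (\<integral>x. h x \<partial>M) + q (\<lambda>x. g n x - g m x) / (2 * t)" if t: "0 < t" for n m t
  proof -
    have int: "integrable M (\<lambda>x. (g n x - g m x)\<^sup>2 / h x)"
    proof (rule Bochner_Integration.integrable_bound)
      show "integrable M (\<lambda>x. 2 * ((g n x)\<^sup>2 / h x) + 2 * ((g m x)\<^sup>2 / h x))"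
        by (intro Bochner_Integration.integrable_add integrable_mult_right K_sq_int[OF gK])
      show "(\<lambda>x. (g n x - g m x)\<^sup>2 / h x) \<in> borel_measurable M"
        using borel_measurable_integrable[OF K_int[OF gK[of n]]] borel_measurable_integrable[OF K_int[OF gK[of m]]]
        by measurable
      have "(g n x - g m x)\<^sup>2 / h x \<le> (2 * (g n x)\<^sup>2 + 2 * (g m x)\<^sup>2) / h x" for x
        using h0[of x] zero_le_power2[of "g n x + g m x"]
        by (intro divide_right_mono) (auto simp: power2_eq_square algebra_simps)
      then show "AE x in M. norm ((g n x - g m x)\<^sup>2 / h x) \<le> norm (2 * ((g n x)\<^sup>2 / h x) + 2 * ((g m x)\<^sup>2 / h x))"
        using h0 by (intro AE_I2) (simp add: add_divide_distrib)
    qed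
    have "\<bar>y\<bar> \<le> t / 2 * h x + y\<^sup>2 / h x / (2 * t)" if "\<bar>y\<bar> \<le> 2 * h x" for x y
    proof (cases "h x = 0")
      case False
      then have hx: "0 < h x" using h0[of x] by simp
      have "0 \<le> (t * h x - \<bar>y\<bar>)\<^sup>2" by simp
      then have "2 * (t * h x * \<bar>y\<bar>) \<le> (t * h x)\<^sup>2 + y\<^sup>2"
        by (simp add: power2_eq_square algebra_simps)
      then show ?thesis using hx t by (simp add: field_simps power2_eq_square)
    qed (use that in simp)
    moreover have "\<bar>g n x - g m x\<bar> \<le> 2 * h x" for x
      using K_dom[OF gK[of n], of x] K_dom[OF gK[of m], of x] by linarith
    ultimately have "(\<integral>x. \<bar>g n x - g m x\<bar> \<partial>M) \<le> (\<integral>x. t / 2 * h x + (g n x - g m x)\<^sup>2 / h x / (2 * t) \<partial>M)"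
      using K_int[OF gK[of n]] K_int[OF gK[of m]] h int
      by (intro integral_mono integrable_abs Bochner_Integration.integrable_diff Bochner_Integration.integrable_add Bochner_Integration.integrable_mult_right Bochner_Integration.integrable_divide) auto
    also have "\<dots> = t / 2 * (\<integral>x. h x \<partial>M) + q (\<lambda>x. g n x - g m x) / (2 * t)"
      unfolding q_def using h int by (simp del: times_divide_eq_left times_divide_eq_right divide_divide_eq_left)
    finally show ?thesis .
  qed
  have cauchy: "\<exists>N. \<forall>i\<ge>N. \<forall>j\<ge>N. (\<integral>x. norm (g i x - g j x) \<partial>M) < e" if e: "0 < e" for e
  proof -
    define t where "t = e / ((\<integral>x. h x \<partial>M) + 1)"
    have Ih: "0 \<le> (\<integral>x. h x \<partial>M)" by (intro integral_nonneg_AE AE_I2 h0)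
    have t: "0 < t" using e Ih by (simp add: t_def)
    have tI: "t * (\<integral>x. h x \<partial>M) < e" using e Ih by (simp add: t_def field_simps)
    have "\<forall>\<^sub>F n in sequentially. \<bar>d n - L\<bar> < t * e / 8"
      using tendstoD[OF L, of "t * e / 8"] t e by (simp add: dist_real_def)
    moreover have "\<forall>\<^sub>F n in sequentially. 4 * w n < t * e / 2"
    proof -
      have "w \<longlonglongrightarrow> 0"
        unfolding w_def by (rule one_div_Suc_tendsto_0)
      then have "(\<lambda>n. 4 * w n) \<longlonglongrightarrow> 4 * 0" by (intro tendsto_intros)
      then show ?thesis using t e by (intro order_tendstoD(2)[of _ 0]) auto
    qed
    ultimately have "\<forall>\<^sub>F n in sequentially. \<bar>d n - L\<bar> < t * e / 8 \<and> 4 * w n < t * e / 2"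
      by eventually_elim simp
    then obtain N where N: "\<And>n. n \<ge> N \<Longrightarrow> \<bar>d n - L\<bar> < t * e / 8" "\<And>n. n \<ge> N \<Longrightarrow> 4 * w n < t * e / 2"
      unfolding eventually_sequentially by blast
    have ord: "(\<integral>x. \<bar>g i x - g j x\<bar> \<partial>M) < e" if "N \<le> i" "i \<le> j" for i j
    proof -
      have "q (\<lambda>x. g i x - g j x) < t * e"
      proof -
        have "N \<le> j" using that by simp
        then have "\<bar>d i - L\<bar> < t * e / 8" "\<bar>d j - L\<bar> < t * e / 8" "4 * w i < t * e / 2" using N that by auto
        moreover have "2 * (b - a) + 4 * c < s" if "\<bar>a - l\<bar> < s / 8" "\<bar>b - l\<bar> < s / 8" "4 * c < s / 2"
          for a b c l s :: real using that unfolding abs_less_iff by (auto simp: field_simps)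
        ultimately have "2 * (d j - d i) + 4 * w i < t * e" by blast
        with diff_q[OF that(2)] show ?thesis by (rule le_less_trans)
      qed
      then have "q (\<lambda>x. g i x - g j x) / (2 * t) < e / 2" using t by (simp add: field_simps)
      then show ?thesis using L1_le[OF t, of i j] tI by simp
    qed
    have "(\<integral>x. norm (g i x - g j x) \<partial>M) < e" if "N \<le> i" "N \<le> j" for i j
      using ord[of i j] ord[of j i] that by (cases "i \<le> j") (auto simp: abs_minus_commute)
    then show ?thesis by blast
  qed
  obtain r where r: "strict_mono r" "AE x in M. Cauchy (\<lambda>i. g (r i) x)"
    by (rule cauchy_L1_AE_cauchy_subseq[of M g]) (use K_int[OF gK] cauchy in auto)
  define G where "G x = lim (\<lambda>i. g (r i) x)" for x
  have lim: "AE x in M. (\<lambda>i. g (r i) x) \<longlonglongrightarrow> G x"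
    using r(2) by eventually_elim (simp add: G_def Cauchy_convergent_iff convergent_LIMSEQ_iff)
  have [measurable]: "g i \<in> borel_measurable M" for i
    using borel_measurable_integrable[OF K_int[OF gK]] .
  have [measurable]: "G \<in> borel_measurable M" unfolding G_def by measurable
  have "integrable M G"
    by (rule integrable_dominated_convergence[OF _ _ h lim]) (use K_dom[OF gK] h0 in auto)
  moreover have "g (r n) \<in> midpoint_hull (f ` {n..})" for n
    using gK[of "r n"] K_mono[of n "r n"] seq_suble[OF r(1), of n] unfolding K_def by auto
  ultimately show ?thesis using lim by (intro that[of "\<lambda>n. g (r n)" G])
qed

section \<open>Weak derivatives from Hajlasz gradients\<close>

text \<open>
  Summable \<open>L\<^sup>1\<close> errors, so that the sum of the differences is an integrable majorant.
\<close>

lemma fast_translation_sequence: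
  fixes g :: "'a::euclidean_space \<Rightarrow> real"
  assumes g: "integrable lborel g"
  obtains t :: "nat \<Rightarrow> real" where "\<And>j. 0 < t j" "t \<longlonglongrightarrow> 0"
    "\<And>j. (\<integral>z. \<bar>g (z + t j *\<^sub>R e) - g z\<bar> \<partial>lborel) \<le> (1/2) ^ j"
proof -
  define w where "w n = 1 / (real n + 1)" for n
  have w: "w \<longlonglongrightarrow> 0"
    unfolding w_def by (rule one_div_Suc_tendsto_0)
  have "(\<lambda>n. w n *\<^sub>R e) \<longlonglongrightarrow> 0 *\<^sub>R e" by (intro tendsto_scaleR w tendsto_const)
  then have lim: "(\<lambda>n. \<integral>z. \<bar>g (z + w n *\<^sub>R e) - g z\<bar> \<partial>lborel) \<longlonglongrightarrow> 0"
    using integrable_imp_L1_translation_continuous[OF g]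
    unfolding L1_translation_continuous_def by (auto dest!: spec[of _ "\<lambda>n. w n *\<^sub>R e"])
  have "\<exists>n\<ge>j. (\<integral>z. \<bar>g (z + w n *\<^sub>R e) - g z\<bar> \<partial>lborel) < (1/2) ^ j" for j
  proof -
    have "\<forall>\<^sub>F n in sequentially. (\<integral>z. \<bar>g (z + w n *\<^sub>R e) - g z\<bar> \<partial>lborel) < (1/2) ^ j \<and> j \<le> n"
      by (intro eventually_conj order_tendstoD(2)[OF lim] eventually_ge_at_top) simp
    then show ?thesis by (auto dest!: eventually_happens)
  qed
  then obtain r where r: "\<And>j. j \<le> r j" "\<And>j. (\<integral>z. \<bar>g (z + w (r j) *\<^sub>R e) - g z\<bar> \<partial>lborel) < (1/2) ^ j" by metis
  have "filterlim r at_top sequentially"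
    by (rule filterlim_at_top_mono[OF filterlim_ident]) (simp add: r(1))
  then have "(\<lambda>j. w (r j)) \<longlonglongrightarrow> 0" by (rule filterlim_compose[OF w])
  then show ?thesis
    by (intro that[of "\<lambda>j. w (r j)"]) (auto simp: w_def less_imp_le[OF r(2)[unfolded w_def]])
qed

lemma test_function_difference_quotient:
  fixes \<phi> :: "'a::euclidean_space \<Rightarrow> real"
  assumes \<phi>: "\<phi> \<in> test_functions \<Omega>" and B: "\<And>z. \<bar>frechet_derivative \<phi> (at z) e\<bar> \<le> B"
  shows "0 < s \<Longrightarrow> \<bar>(\<phi> (z - s *\<^sub>R e) - \<phi> z) / s\<bar> \<le> B"
    and "(\<And>j. 0 < t j) \<Longrightarrow> t \<longlonglongrightarrow> 0 \<Longrightarrow> (\<lambda>j. (\<phi> (z - t j *\<^sub>R e) - \<phi> z) / t j) \<longlonglongrightarrow> - frechet_derivative \<phi> (at z) e"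
proof -
  have deriv: "((\<lambda>s. \<phi> (z - s *\<^sub>R e)) has_real_derivative - frechet_derivative \<phi> (at (z - s *\<^sub>R e)) e) (at s)" for s
  proof -
    interpret linear "frechet_derivative \<phi> (at (z - s *\<^sub>R e))"
      using has_derivative_linear[OF test_function_derivative_props(1)[OF \<phi>]] .
    have "((\<lambda>s. \<phi> (z - s *\<^sub>R e)) has_derivative (\<lambda>h. frechet_derivative \<phi> (at (z - s *\<^sub>R e)) (- (h *\<^sub>R e)))) (at s)"
      by (rule has_derivative_compose[OF _ test_function_derivative_props(1)[OF \<phi>]])
        (auto intro!: derivative_eq_intros)
    then show ?thesis
      unfolding has_field_derivative_def by (rule has_derivative_eq_rhs) (simp add: neg scale fun_eq_iff)
  qed
  show "\<bar>(\<phi> (z - s *\<^sub>R e) - \<phi> z) / s\<bar> \<le> B" if s: "0 < s"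
  proof -
    obtain x where "\<phi> (z - s *\<^sub>R e) - \<phi> (z - 0 *\<^sub>R e) = (s - 0) * - frechet_derivative \<phi> (at (z - x *\<^sub>R e)) e"
      using MVT2[OF s deriv] by blast
    then have "(\<phi> (z - s *\<^sub>R e) - \<phi> z) / s = - frechet_derivative \<phi> (at (z - x *\<^sub>R e)) e" using s by simp
    then show ?thesis using B by simp
  qed
  assume t: "\<And>j. 0 < t j" "t \<longlonglongrightarrow> 0"
  have "((\<lambda>h. (\<phi> (z - h *\<^sub>R e) - \<phi> z) / h) \<longlongrightarrow> - frechet_derivative \<phi> (at z) e) (at 0)"
    using deriv[of 0] by (simp add: DERIV_def)
  moreover have "filterlim t (at 0) sequentially"
    unfolding filterlim_at using t by (auto intro!: always_eventually simp: less_imp_neq[symmetric] order_less_imp_not_eq2)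
  ultimately show "(\<lambda>j. (\<phi> (z - t j *\<^sub>R e) - \<phi> z) / t j) \<longlonglongrightarrow> - frechet_derivative \<phi> (at z) e"
    by (rule filterlim_compose)
qed

text \<open>
  The difference quotients of \<open>U\<close> in direction \<open>e\<close> are bounded by
  \<open>g(z) + g(z + t\<^sub>j e)\<close>, hence by
  \<open>h = 2g + \<Sum>\<^sub>j |g(\<cdot> + t\<^sub>j e) - g|\<close>, which is integrable along a fast
  sequence \<open>t\<^sub>j\<close>. Midpoint combinations of the quotients thus converge almost everywhere to a
  function \<open>D\<close>. Paired with a test function, the quotients converge to minus the integral on the
  left-hand side, and so do their combinations. The bound \<open>|D| \<le> 2g\<close> survives because
  \<open>g(z + t\<^sub>j e) \<rightarrow> g(z)\<close> for almost every \<open>z\<close>.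
\<close>

theorem hajlasz_imp_weak_directional_derivative:
  fixes U g :: "'a::euclidean_space \<Rightarrow> real"
  assumes "open \<Omega>" and U: "integrable lborel U" and g: "integrable lborel g" and g0: "\<And>z. 0 \<le> g z"
    and N: "N \<in> null_sets lborel" and e: "norm e = 1"
    and haj: "\<And>z w. z \<in> \<Omega> - N \<Longrightarrow> w \<in> \<Omega> - N \<Longrightarrow> \<bar>U z - U w\<bar> \<le> norm (z - w) * (g z + g w)"
  obtains D where "integrable lborel D" "AE z in lborel. \<bar>D z\<bar> \<le> 2 * g z"
    "\<And>\<phi>. \<phi> \<in> test_functions \<Omega> \<Longrightarrow>
      (\<integral>z. U z * frechet_derivative \<phi> (at z) e \<partial>lborel) = - (\<integral>z. D z * \<phi> z \<partial>lborel)"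
proof -
  obtain t where t: "\<And>j. 0 < t j" "t \<longlonglongrightarrow> 0" and fast: "\<And>j. (\<integral>z. \<bar>g (z + t j *\<^sub>R e) - g z\<bar> \<partial>lborel) \<le> (1/2) ^ j"
    using fast_translation_sequence[OF g] by metis
  have [measurable]: "\<Omega> \<in> sets borel" "N \<in> sets borel" "U \<in> borel_measurable borel" "g \<in> borel_measurable borel"
    using \<open>open \<Omega>\<close> N borel_measurable_integrable[OF U] borel_measurable_integrable[OF g] by auto
  define S where "S z = (\<Sum>j. ennreal \<bar>g (z + t j *\<^sub>R e) - g z\<bar>)" for z
  have [measurable]: "S \<in> borel_measurable borel" unfolding S_def by measurable
  have S_fin: "(\<integral>\<^sup>+z. S z \<partial>lborel) < \<infinity>"
  proof -
    have "(\<integral>\<^sup>+z. S z \<partial>lborel) = (\<Sum>j. \<integral>\<^sup>+z. ennreal \<bar>g (z + t j *\<^sub>R e) - g z\<bar> \<partial>lborel)"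
      unfolding S_def by (rule nn_integral_suminf) measurable
    also have "\<dots> \<le> (\<Sum>j. ennreal ((1/2) ^ j))"
    proof (rule suminf_le)
      fix j
      have "integrable lborel (\<lambda>z. \<bar>g (z + t j *\<^sub>R e) - g z\<bar>)"
        using integrable_lborel_shift[OF g] g by (intro integrable_abs Bochner_Integration.integrable_diff)
      then show "(\<integral>\<^sup>+z. ennreal \<bar>g (z + t j *\<^sub>R e) - g z\<bar> \<partial>lborel) \<le> ennreal ((1/2) ^ j)"
        using fast[of j] by (subst nn_integral_eq_integral) (auto intro: ennreal_leI)
    qed auto
    also have "\<dots> = ennreal (\<Sum>j. (1/2) ^ j)"
      by (rule suminf_ennreal2) (simp, rule summable_geometric, simp)
    also have "\<dots> < \<infinity>" by simp
    finally show ?thesis .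
  qed
  have S_AE: "AE z in lborel. S z \<noteq> \<infinity>" 
    by (rule nn_integral_PInf_AE) (use S_fin in simp_all)
  have S_term: "\<bar>g (z + t j *\<^sub>R e) - g z\<bar> \<le> enn2real (S z)" if "S z \<noteq> \<infinity>" for z j
  proof -
    have "sum (\<lambda>j. ennreal \<bar>g (z + t j *\<^sub>R e) - g z\<bar>) {j} \<le> S z"
      unfolding S_def by (rule sum_le_suminf) (simp_all add: summableI)
    from enn2real_mono[OF this] show ?thesis using that by (simp add: less_top)
  qed
  \<comment> \<open>The quotients are set to 0 at the exceptional points, to make the domination by h hold everywhere.\<close>
  define P where "P j z \<longleftrightarrow> z \<in> \<Omega> - N \<and> z + t j *\<^sub>R e \<in> \<Omega> - N \<and> S z \<noteq> \<infinity>" for j z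
  have [measurable]: "Measurable.pred borel (P j)" for j unfolding P_def by measurable
  define f where "f j z = (if P j z then (U (z + t j *\<^sub>R e) - U z) / t j else 0)" for j z
  define h where "h z = 2 * g z + enn2real (S z)" for z
  have f_bound: "\<bar>f j z\<bar> \<le> 2 * g z + \<bar>g (z + t j *\<^sub>R e) - g z\<bar>" for j z
  proof (cases "P j z")
    case True
    then have "\<bar>U (z + t j *\<^sub>R e) - U z\<bar> \<le> t j * (g (z + t j *\<^sub>R e) + g z)"
      using haj[of "z + t j *\<^sub>R e" z] e t(1)[of j] by (simp add: P_def)
    then have "\<bar>f j z\<bar> \<le> g (z + t j *\<^sub>R e) + g z"
      using True t(1)[of j] by (simp add: f_def field_simps)
    then show ?thesis by linarith
  qed (simp add: f_def g0)
  have f_dom: "\<bar>f j z\<bar> \<le> h z" for j z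
    using f_bound[of j z] S_term[of z j] g0[of z] by (cases "P j z") (auto simp: h_def P_def f_def intro: add_nonneg_nonneg)
  have h_int: "integrable lborel h"
  proof -
    have "integrable lborel (\<lambda>z. enn2real (S z))"
    proof (rule integrableI_bounded)
      have "(\<integral>\<^sup>+z. ennreal (norm (enn2real (S z))) \<partial>lborel) \<le> (\<integral>\<^sup>+z. S z \<partial>lborel)"
        by (intro nn_integral_mono) (simp add: ennreal_enn2real_if)
      also note S_fin
      finally show "(\<integral>\<^sup>+z. ennreal (norm (enn2real (S z))) \<partial>lborel) < \<infinity>" .
    qed measurable
    then show ?thesis unfolding h_def using g by simp
  qed
  have h0: "0 \<le> h z" for z using g0 by (simp add: h_def)
  have f_int: "integrable lborel (f j)" for j
  proof (rule Bochner_Integration.integrable_bound[OF h_int])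
    show "f j \<in> borel_measurable lborel" unfolding f_def[abs_def] by measurable
  qed (simp add: f_dom h0)
  obtain k D where k: "\<And>n. k n \<in> midpoint_hull (f ` {n..})" and D: "integrable lborel D"
    and lim: "AE z in lborel. (\<lambda>n. k n z) \<longlonglongrightarrow> D z"
    by (rule dominated_midpoint_limit[of lborel f h, OF f_int h_int f_dom]) blast
  have k_dom: "\<bar>k n z\<bar> \<le> h z" for n z
    using midpoint_hull_abs_le[OF k[of n], of z 0 "h z"] f_dom by fastforce
  have D_le: "AE z in lborel. \<bar>D z\<bar> \<le> 2 * g z"
    using lim S_AE
  proof eventually_elim
    case (elim z)
    have "summable (\<lambda>j. \<bar>g (z + t j *\<^sub>R e) - g z\<bar>)"
      using elim(2) unfolding S_def by (intro summable_suminf_not_top) (auto simp: infinity_ennreal_def)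
    then have g_lim: "(\<lambda>j. \<bar>g (z + t j *\<^sub>R e) - g z\<bar>) \<longlonglongrightarrow> 0" by (rule summable_LIMSEQ_zero)
    have "\<bar>D z\<bar> \<le> 2 * g z + d" if d: "0 < d" for d
    proof -
      obtain n where n: "\<And>j. n \<le> j \<Longrightarrow> \<bar>g (z + t j *\<^sub>R e) - g z\<bar> < d"
        using order_tendstoD(2)[OF g_lim d] unfolding eventually_sequentially by blast
      have "\<bar>k m z\<bar> \<le> 2 * g z + d" if "n \<le> m" for m
      proof -
        have "\<bar>k m z - 0\<bar> \<le> 2 * g z + d"
        proof (rule midpoint_hull_abs_le[OF k])
          fix y assume "y \<in> f ` {m..}"
          then obtain j where "y = f j" "m \<le> j" by auto
          then show "\<bar>y z - 0\<bar> \<le> 2 * g z + d" using f_bound[of j z] n[of j] that by simp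
        qed
        then show ?thesis by simp
      qed
      moreover have "(\<lambda>m. \<bar>k m z\<bar>) \<longlonglongrightarrow> \<bar>D z\<bar>" using elim(1) by (intro tendsto_intros)
      ultimately show ?thesis by (intro LIMSEQ_le_const2) auto
    qed
    then show ?case by (rule field_le_epsilon)
  qed
  have "(\<integral>z. U z * frechet_derivative \<phi> (at z) e \<partial>lborel) = - (\<integral>z. D z * \<phi> z \<partial>lborel)"
    if \<phi>: "\<phi> \<in> test_functions \<Omega>" for \<phi>
  proof -
    obtain K where K: "compact K" "K \<subseteq> \<Omega>" and out: "\<And>z. z \<notin> K \<Longrightarrow> \<phi> z = 0"
      and out': "\<And>z v. z \<notin> K \<Longrightarrow> frechet_derivative \<phi> (at z) v = 0"
      using test_function_supportE[OF \<phi>] by blast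
    note \<phi>_props = test_function_derivative_props[OF \<phi>]
    have [measurable]: "(\<lambda>z. frechet_derivative \<phi> (at z) e) \<in> borel_measurable borel" "\<phi> \<in> borel_measurable borel"
      using \<phi>_props by (auto intro: borel_measurable_continuous_onI)
    obtain B where B: "0 \<le> B" "\<And>z. \<bar>frechet_derivative \<phi> (at z) e\<bar> \<le> B"
      by (rule compactly_supported_continuous_bounded[OF \<phi>_props(2) K(1) out']) blast+
    obtain B' where B': "0 \<le> B'" "\<And>z. \<bar>\<phi> z\<bar> \<le> B'"
      by (rule compactly_supported_continuous_bounded[OF \<phi>_props(3) K(1) out]) blast+
    note quot = test_function_difference_quotient[OF \<phi> B(2)]
    define L where "L = - (\<integral>z. U z * frechet_derivative \<phi> (at z) e \<partial>lborel)"
    have fphi_int: "integrable lborel (\<lambda>z. f j z * \<phi> z)" for j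
      by (rule integrable_mult_bounded[OF f_int _ B'(2)]) measurable
    obtain d where d: "0 < d" "\<And>z. z \<in> K \<Longrightarrow> cball z d \<subseteq> \<Omega>"
      using compact_subset_open_cball[OF K(1) \<open>open \<Omega>\<close> K(2)] by blast
    have small: "(\<integral>z. f j z * \<phi> z \<partial>lborel) = (\<integral>z. U z * ((\<phi> (z - t j *\<^sub>R e) - \<phi> z) / t j) \<partial>lborel)" if j: "t j < d" for j
    proof -
      have "AE z in lborel. z \<notin> N" using N by (rule AE_not_in)
      moreover then have "AE z in lborel. z + t j *\<^sub>R e \<notin> N"
        using AE_lborel_affine[of "\<lambda>z. z \<notin> N" 1 "t j *\<^sub>R e"] by (simp add: add.commute)
      ultimately have "AE z in lborel. f j z * \<phi> z = (U (z + t j *\<^sub>R e) * \<phi> z - U z * \<phi> z) / t j"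
        using S_AE
      proof eventually_elim
        case (elim z)
        show ?case
        proof (cases "z \<in> K")
          case True
          then have "z + t j *\<^sub>R e \<in> cball z d" using e t(1)[of j] j by (simp add: dist_norm)
          then have "P j z" using True K(2) d(2)[OF True] elim by (auto simp: P_def)
          then show ?thesis by (simp add: f_def algebra_simps diff_divide_distrib)
        qed (simp add: out)
      qed
      then have "(\<integral>z. f j z * \<phi> z \<partial>lborel) = (\<integral>z. (U (z + t j *\<^sub>R e) * \<phi> z - U z * \<phi> z) / t j \<partial>lborel)"
        by (intro integral_cong_AE) (auto simp: f_def[abs_def])
      also have "\<dots> = ((\<integral>z. U (z + t j *\<^sub>R e) * \<phi> z \<partial>lborel) - (\<integral>z. U z * \<phi> z \<partial>lborel)) / t j"
        using integrable_mult_bounded[OF integrable_lborel_shift[OF U] _ B'(2)] integrable_mult_bounded[OF U _ B'(2)]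
        by simp
      also have "(\<integral>z. U (z + t j *\<^sub>R e) * \<phi> z \<partial>lborel) = (\<integral>z. U z * \<phi> (z - t j *\<^sub>R e) \<partial>lborel)"
        using integral_lborel_shift[of "\<lambda>z. U z * \<phi> (z - t j *\<^sub>R e)" "t j *\<^sub>R e"] by simp
      also have "((\<integral>z. U z * \<phi> (z - t j *\<^sub>R e) \<partial>lborel) - (\<integral>z. U z * \<phi> z \<partial>lborel)) / t j =
          (\<integral>z. (U z * \<phi> (z - t j *\<^sub>R e) - U z * \<phi> z) / t j \<partial>lborel)"
      proof -
        have "integrable lborel (\<lambda>z. U z * \<phi> (z - t j *\<^sub>R e))"
          by (rule integrable_mult_bounded[OF U _ B'(2)]) measurable
        then show ?thesis using integrable_mult_bounded[OF U _ B'(2)] by simp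
      qed
      finally show ?thesis by (simp add: right_diff_distrib)
    qed
    have "(\<lambda>j. \<integral>z. U z * ((\<phi> (z - t j *\<^sub>R e) - \<phi> z) / t j) \<partial>lborel) \<longlonglongrightarrow> (\<integral>z. U z * - frechet_derivative \<phi> (at z) e \<partial>lborel)"
    proof (rule integral_dominated_convergence[where w="\<lambda>z. \<bar>U z\<bar> * B"])
      show "AE z in lborel. (\<lambda>j. U z * ((\<phi> (z - t j *\<^sub>R e) - \<phi> z) / t j)) \<longlonglongrightarrow> U z * - frechet_derivative \<phi> (at z) e"
        by (intro AE_I2 tendsto_mult tendsto_const quot(2) t)
      show "AE z in lborel. norm (U z * ((\<phi> (z - t j *\<^sub>R e) - \<phi> z) / t j)) \<le> \<bar>U z\<bar> * B" for j
      proof (rule AE_I2)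
        fix z show "norm (U z * ((\<phi> (z - t j *\<^sub>R e) - \<phi> z) / t j)) \<le> \<bar>U z\<bar> * B"
          using quot(1)[OF t(1)[of j], of z] by (simp only: real_norm_def abs_mult) (intro mult_left_mono, auto)
      qed
    qed (use U in auto)
    then have "(\<lambda>j. \<integral>z. U z * ((\<phi> (z - t j *\<^sub>R e) - \<phi> z) / t j) \<partial>lborel) \<longlonglongrightarrow> L" by (simp add: L_def)
    moreover have "\<forall>\<^sub>F j in sequentially. (\<integral>z. U z * ((\<phi> (z - t j *\<^sub>R e) - \<phi> z) / t j) \<partial>lborel) = (\<integral>z. f j z * \<phi> z \<partial>lborel)"
      using order_tendstoD(2)[OF t(2) d(1)] by eventually_elim (rule small[symmetric])
    ultimately have f_lim: "(\<lambda>j. \<integral>z. f j z * \<phi> z \<partial>lborel) \<longlonglongrightarrow> L" by (rule Lim_transform_eventually)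
    have k_lim: "(\<lambda>n. \<integral>z. k n z * \<phi> z \<partial>lborel) \<longlonglongrightarrow> L"
    proof (rule LIMSEQ_I)
      fix r :: real assume r: "0 < r"
      obtain n where n: "\<And>j. n \<le> j \<Longrightarrow> norm ((\<integral>z. f j z * \<phi> z \<partial>lborel) - L) < r / 2"
        using LIMSEQ_D[OF f_lim, of "r / 2"] r by auto
      have "norm ((\<integral>z. k m z * \<phi> z \<partial>lborel) - L) < r" if "n \<le> m" for m
      proof -
        have "\<bar>(\<integral>z. k m z * \<phi> z \<partial>lborel) - L\<bar> \<le> r / 2"
          by (rule conjunct2[OF midpoint_hull_integral_le[OF k[of m]]]) (use fphi_int n that in \<open>auto intro: less_imp_le\<close>)
        then show ?thesis using r by simp
      qed
      then show "\<exists>no. \<forall>n\<ge>no. norm ((\<integral>z. k n z * \<phi> z \<partial>lborel) - L) < r" by blast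
    qed
    have [measurable]: "k n \<in> borel_measurable borel" for n
      using borel_measurable_integrable[OF midpoint_hull_integrable[OF k[of n]], of lborel] f_int by auto
    have "(\<lambda>n. \<integral>z. k n z * \<phi> z \<partial>lborel) \<longlonglongrightarrow> (\<integral>z. D z * \<phi> z \<partial>lborel)"
    proof (rule integral_dominated_convergence[where w="\<lambda>z. h z * B'"])
      show "AE z in lborel. (\<lambda>n. k n z * \<phi> z) \<longlonglongrightarrow> D z * \<phi> z"
        using lim by eventually_elim (intro tendsto_intros)
      show "AE z in lborel. norm (k n z * \<phi> z) \<le> h z * B'" for n
        using k_dom B' by (intro AE_I2) (auto simp: abs_mult intro!: mult_mono order_trans[OF abs_ge_zero k_dom])
    qed (use borel_measurable_integrable[OF D] h_int in auto)
    then have "(\<integral>z. D z * \<phi> z \<partial>lborel) = L" using k_lim by (rule LIMSEQ_unique)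
    then show ?thesis by (simp add: L_def)
  qed
  then show ?thesis using D D_le by (intro that)
qed

section \<open>Topology of the cusp domain\<close>

text \<open>
  Left continuity gives some \<open>r < min t 1\<close> with \<open>\<psi>(r) > |x|\<close>, and monotonicity
  extends this bound to all heights above \<open>r\<close>.
\<close>

lemma open_cusp_domain:
  assumes mono: "mono_on {0<..1} \<psi>"
    and left_cont: "\<And>t. t \<in> {0<..1} \<Longrightarrow> continuous (at_left t) \<psi>"
  shows "open (cusp_domain \<psi> :: (real \<times> (real ^ 'm::finite)) set)"
proof (subst open_subopen, rule ballI)
  fix z :: "real \<times> (real ^ 'm)" assume "z \<in> cusp_domain \<psi>"
  then obtain t x where z: "z = (t, x)" and t: "0 < t" "t < 2" and x: "norm x < \<psi> (min t 1)"
    by (cases z) (auto simp: cusp_domain_iff)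
  define s where "s = min t 1"
  have s: "s \<in> {0<..1}" using t by (auto simp: s_def)
  obtain c where c: "norm x < c" "c < \<psi> s" using dense[OF x] by (auto simp: s_def)
  have "(\<psi> \<longlongrightarrow> \<psi> s) (at_left s)" using left_cont[OF s] by (simp add: continuous_within)
  then have "\<forall>\<^sub>F r in at_left s. c < \<psi> r" using c(2) by (rule order_tendstoD(1))
  moreover have "\<forall>\<^sub>F r in at_left s. r \<in> {0<..<s}"
    using s by (intro eventually_at_left_real) auto
  ultimately have "\<forall>\<^sub>F r in at_left s. c < \<psi> r \<and> r \<in> {0<..<s}" by eventually_elim simp
  then obtain r where r: "c < \<psi> r" "0 < r" "r < s" by (auto dest!: eventually_happens)
  have "{r<..<2} \<times> ball 0 c \<subseteq> (cusp_domain \<psi> :: (real \<times> (real ^ 'm)) set)"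
  proof
    fix w :: "real \<times> (real ^ 'm)" assume "w \<in> {r<..<2} \<times> ball 0 c"
    then obtain q y where w: "w = (q, y)" "r < q" "q < 2" "norm y < c" by auto
    have "\<psi> r \<le> \<psi> (min q 1)" using r s w by (intro mono_onD[OF mono]) auto
    then show "w \<in> cusp_domain \<psi>" using w r by (simp add: cusp_domain_iff)
  qed
  moreover have "z \<in> {r<..<2} \<times> ball 0 c" using z r t c by (auto simp: s_def)
  moreover have "open ({r<..<2} \<times> ball (0::real ^ 'm) c)" by (intro open_Times) auto
  ultimately show "\<exists>T. open T \<and> z \<in> T \<and> T \<subseteq> cusp_domain \<psi>" by blast
qed

lemma cusp_domain_norm_less:
  assumes mono: "mono_on {0<..1} \<psi>" and z: "z \<in> cusp_domain \<psi>"
  shows "norm z < 2 + \<psi> 1"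
proof -
  obtain t x where tx: "z = (t, x)" "0 < t" "t < 2" "norm x < \<psi> (min t 1)"
    using z by (cases z) (auto simp: cusp_domain_iff)
  have "\<psi> (min t 1) \<le> \<psi> 1" using tx by (intro mono_onD[OF mono]) auto
  moreover have "norm z \<le> \<bar>t\<bar> + norm x" using norm_Pair_le[of t x] by (simp add: tx)
  ultimately show ?thesis using tx by linarith
qed

section \<open>Lebesgue spaces and representatives\<close>

text \<open>
  The measure of \<open>\<Omega>\<close> must not vanish because the essential supremum on a null space is
  \<open>-\<infinity>\<close>.
\<close>

lemma Lp_infinity_iff:
  fixes f :: "'a::euclidean_space \<Rightarrow> 'b::euclidean_space"
  assumes "\<Omega> \<in> sets lebesgue" "emeasure lebesgue \<Omega> \<noteq> 0"
  shows "f \<in> Lp \<infinity> \<Omega> \<longleftrightarrow> f \<in> borel_measurable (lebesgue_on \<Omega>) \<and> (\<exists>c\<ge>0. AE z in lebesgue_on \<Omega>. norm (f z) \<le> c)"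
    and "f \<in> Lp \<infinity> \<Omega> \<Longrightarrow> 0 \<le> Lp_norm \<infinity> \<Omega> f"
    and "f \<in> Lp \<infinity> \<Omega> \<Longrightarrow> AE z in lebesgue_on \<Omega>. norm (f z) \<le> Lp_norm \<infinity> \<Omega> f"
    and "f \<in> Lp \<infinity> \<Omega> \<Longrightarrow> AE z in lebesgue_on \<Omega>. norm (f z) \<le> c \<Longrightarrow> Lp_norm \<infinity> \<Omega> f \<le> c"
proof -
  let ?M = "lebesgue_on \<Omega>"
  let ?s = "esssup ?M (\<lambda>z. ereal (norm (f z)))"
  have M: "emeasure ?M (space ?M) \<noteq> 0"
    using assms by (simp add: emeasure_restrict_space)
  have nonneg: "0 \<le> ?s"
  proof -
    have "esssup ?M (\<lambda>_. 0::ereal) \<le> ?s" by (rule esssup_mono) auto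
    then show ?thesis by (simp add: esssup_const[OF M])
  qed
  have le: "?s \<le> ereal c" if "f \<in> borel_measurable ?M" "AE z in ?M. norm (f z) \<le> c" for c
    by (rule esssup_I) (use that in auto)
  have fin: "0 \<le> Lp_norm \<infinity> \<Omega> f \<and> ereal (Lp_norm \<infinity> \<Omega> f) = ?s" if "f \<in> Lp \<infinity> \<Omega>"
  proof -
    have "?s < \<infinity>" using that by (simp add: Lp_def)
    then obtain r where "?s = ereal r" using nonneg by (cases ?s) auto
    then show ?thesis using nonneg by (simp add: Lp_norm_def)
  qed
  show nn: "0 \<le> Lp_norm \<infinity> \<Omega> f" if "f \<in> Lp \<infinity> \<Omega>" using fin[OF that] by simp
  show ae: "AE z in ?M. norm (f z) \<le> Lp_norm \<infinity> \<Omega> f" if "f \<in> Lp \<infinity> \<Omega>"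
  proof -
    have "AE z in ?M. ereal (norm (f z)) \<le> ?s" by (rule esssup_AE)
    then show ?thesis unfolding conjunct2[OF fin[OF that], symmetric] by simp
  qed
  show "Lp_norm \<infinity> \<Omega> f \<le> c" if "f \<in> Lp \<infinity> \<Omega>" "AE z in ?M. norm (f z) \<le> c"
  proof -
    have "f \<in> borel_measurable ?M" using that(1) by (simp add: Lp_def)
    from le[OF this that(2)] show ?thesis using fin[OF that(1)] by (metis ereal_less_eq(3))
  qed
  show "f \<in> Lp \<infinity> \<Omega> \<longleftrightarrow> f \<in> borel_measurable ?M \<and> (\<exists>c\<ge>0. AE z in ?M. norm (f z) \<le> c)"
  proof
    assume f: "f \<in> Lp \<infinity> \<Omega>"
    then show "f \<in> borel_measurable ?M \<and> (\<exists>c\<ge>0. AE z in ?M. norm (f z) \<le> c)"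
      using nn[OF f] ae[OF f] by (auto simp: Lp_def)
  next
    assume "f \<in> borel_measurable ?M \<and> (\<exists>c\<ge>0. AE z in ?M. norm (f z) \<le> c)"
    then obtain c where f: "f \<in> borel_measurable ?M" and "AE z in ?M. norm (f z) \<le> c" by blast
    then have "?s \<le> ereal c" by (intro le)
    also have "\<dots> < \<infinity>" by simp
    finally show "f \<in> Lp \<infinity> \<Omega>" using f by (simp add: Lp_def)
  qed
qed

lemma Lp_finite_iff:
  fixes f :: "'a::euclidean_space \<Rightarrow> 'b::euclidean_space"
  assumes "p < \<infinity>"
  shows "f \<in> Lp p \<Omega> \<longleftrightarrow> f \<in> borel_measurable (lebesgue_on \<Omega>) \<and>
      (\<integral>\<^sup>+z. ennreal (norm (f z) powr enn2real p) \<partial>lebesgue_on \<Omega>) < \<infinity>"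
    and "f \<in> Lp p \<Omega> \<Longrightarrow> ennreal (LINT z|lebesgue_on \<Omega>. norm (f z) powr enn2real p) =
      (\<integral>\<^sup>+z. ennreal (norm (f z) powr enn2real p) \<partial>lebesgue_on \<Omega>)"
proof -
  show "f \<in> Lp p \<Omega> \<longleftrightarrow> f \<in> borel_measurable (lebesgue_on \<Omega>) \<and>
      (\<integral>\<^sup>+z. ennreal (norm (f z) powr enn2real p) \<partial>lebesgue_on \<Omega>) < \<infinity>"
    using assms by (auto simp: Lp_def integrable_iff_bounded)
  assume "f \<in> Lp p \<Omega>"
  then have "integrable (lebesgue_on \<Omega>) (\<lambda>z. norm (f z) powr enn2real p)"
    using assms by (auto simp: Lp_def)
  then show "ennreal (LINT z|lebesgue_on \<Omega>. norm (f z) powr enn2real p) =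
      (\<integral>\<^sup>+z. ennreal (norm (f z) powr enn2real p) \<partial>lebesgue_on \<Omega>)"
    by (intro nn_integral_eq_integral[symmetric]) auto
qed

lemma enn2real_gt_1:
  assumes "1 < p" "p \<noteq> \<infinity>"
  shows "1 < enn2real p"
proof (cases p)
  case (real r)
  then have "ennreal 1 < ennreal r" using assms by simp
  then show ?thesis using real by (subst (asm) ennreal_less_iff) auto
qed (use assms in simp)

lemma Lp_norm_nonneg:
  fixes f :: "'a::euclidean_space \<Rightarrow> 'b::euclidean_space"
  assumes "\<Omega> \<in> sets lebesgue" "emeasure lebesgue \<Omega> \<noteq> 0" "f \<in> Lp p \<Omega>"
  shows "0 \<le> Lp_norm p \<Omega> f"
  using Lp_infinity_iff(2)[OF assms(1,2)] assms(3) by (cases "p = \<infinity>") (auto simp: Lp_norm_def)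

text \<open>
  Comparison of \<open>p\<close>-norms from an inequality between integrals of \<open>p\<close>-th powers, which
  is the form in which the strong type inequality arrives.
\<close>

lemma Lp_norm_finite_le:
  fixes f :: "'a::euclidean_space \<Rightarrow> 'b::euclidean_space" and g :: "'a \<Rightarrow> 'c::euclidean_space"
  assumes p: "1 < p" "p < \<infinity>" and g: "g \<in> Lp p \<Omega>" and f: "f \<in> borel_measurable (lebesgue_on \<Omega>)" and A: "0 \<le> A"
    and le: "(\<integral>\<^sup>+z. ennreal (norm (f z) powr enn2real p) \<partial>lebesgue_on \<Omega>) \<le>
      ennreal A * (\<integral>\<^sup>+z. ennreal (norm (g z) powr enn2real p) \<partial>lebesgue_on \<Omega>)"
  shows "f \<in> Lp p \<Omega>" "Lp_norm p \<Omega> f \<le> A powr (1 / enn2real p) * Lp_norm p \<Omega> g"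
proof -
  let ?q = "enn2real p"
  have q: "0 < ?q" using p by (cases p) (auto simp: ennreal_less_iff)
  have "(\<integral>\<^sup>+z. ennreal (norm (g z) powr ?q) \<partial>lebesgue_on \<Omega>) < \<infinity>"
    using Lp_finite_iff(1)[OF p(2)] g by auto
  then have "ennreal A * (\<integral>\<^sup>+z. ennreal (norm (g z) powr ?q) \<partial>lebesgue_on \<Omega>) < \<infinity>"
    by (simp add: ennreal_mult_less_top)
  then show fL: "f \<in> Lp p \<Omega>" using le f Lp_finite_iff(1)[OF p(2)] by (auto intro: le_less_trans)
  let ?I = "\<lambda>h. LINT z|lebesgue_on \<Omega>. h z powr ?q"
  have I0: "0 \<le> (LINT z|lebesgue_on \<Omega>. norm (f z) powr ?q)" "0 \<le> (LINT z|lebesgue_on \<Omega>. norm (g z) powr ?q)" by auto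
  have "ennreal (LINT z|lebesgue_on \<Omega>. norm (f z) powr ?q) \<le> ennreal (A * (LINT z|lebesgue_on \<Omega>. norm (g z) powr ?q))"
    using le unfolding Lp_finite_iff(2)[OF p(2) fL, symmetric] Lp_finite_iff(2)[OF p(2) g, symmetric]
    using A by (simp add: ennreal_mult')
  then have "(LINT z|lebesgue_on \<Omega>. norm (f z) powr ?q) \<le> A * (LINT z|lebesgue_on \<Omega>. norm (g z) powr ?q)"
    using A I0 by (subst (asm) ennreal_le_iff) auto
  then have "(LINT z|lebesgue_on \<Omega>. norm (f z) powr ?q) powr (1 / ?q) \<le>
      (A * (LINT z|lebesgue_on \<Omega>. norm (g z) powr ?q)) powr (1 / ?q)"
    using I0 q by (intro powr_mono2) auto
  also have "\<dots> = A powr (1 / ?q) * (LINT z|lebesgue_on \<Omega>. norm (g z) powr ?q) powr (1 / ?q)"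
    using A I0 by (simp add: powr_mult)
  finally show "Lp_norm p \<Omega> f \<le> A powr (1 / ?q) * Lp_norm p \<Omega> g"
    using p by (simp add: Lp_norm_def)
qed

lemma Lp_dominated:
  fixes f :: "'a::euclidean_space \<Rightarrow> 'b::euclidean_space" and g :: "'a \<Rightarrow> 'c::euclidean_space"
  assumes \<Omega>: "\<Omega> \<in> sets lebesgue" "emeasure lebesgue \<Omega> \<noteq> 0" and p: "1 < p"
    and g: "g \<in> Lp p \<Omega>" and f: "f \<in> borel_measurable (lebesgue_on \<Omega>)" and C: "0 < C"
    and le: "AE z in lebesgue_on \<Omega>. norm (f z) \<le> C * norm (g z)"
  shows "f \<in> Lp p \<Omega>" "Lp_norm p \<Omega> f \<le> C * Lp_norm p \<Omega> g"
proof -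
  have "f \<in> Lp p \<Omega> \<and> Lp_norm p \<Omega> f \<le> C * Lp_norm p \<Omega> g"
  proof (cases "p = \<infinity>")
    case True
    have "AE z in lebesgue_on \<Omega>. norm (g z) \<le> Lp_norm \<infinity> \<Omega> g"
      using Lp_infinity_iff(3)[OF \<Omega>] g True by auto
    with le have ae: "AE z in lebesgue_on \<Omega>. norm (f z) \<le> C * Lp_norm \<infinity> \<Omega> g"
    proof eventually_elim
      case (elim z)
      have "C * norm (g z) \<le> C * Lp_norm \<infinity> \<Omega> g" using elim(2) C by (intro mult_left_mono) auto
      with elim(1) show ?case by (rule order_trans)
    qed
    moreover have "0 \<le> C * Lp_norm \<infinity> \<Omega> g"
      using Lp_infinity_iff(2)[OF \<Omega>, of g] g C unfolding True by simp
    ultimately have fL: "f \<in> Lp \<infinity> \<Omega>" using Lp_infinity_iff(1)[OF \<Omega>, of f] f by blast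
    then show ?thesis using Lp_infinity_iff(4)[OF \<Omega> fL ae] True by simp
  next
    case False
    then have pf: "p < \<infinity>" by (simp add: less_top)
    let ?q = "enn2real p"
    have q: "0 < ?q" using p pf by (cases p) (auto simp: ennreal_less_iff)
    have [measurable]: "f \<in> borel_measurable (lebesgue_on \<Omega>)" "g \<in> borel_measurable (lebesgue_on \<Omega>)"
      using f g by (auto simp: Lp_def)
    have "(\<integral>\<^sup>+z. ennreal (norm (f z) powr ?q) \<partial>lebesgue_on \<Omega>) \<le>
        (\<integral>\<^sup>+z. ennreal (C powr ?q) * ennreal (norm (g z) powr ?q) \<partial>lebesgue_on \<Omega>)"
    proof (rule nn_integral_mono_AE)
      show "AE z in lebesgue_on \<Omega>. ennreal (norm (f z) powr ?q) \<le> ennreal (C powr ?q) * ennreal (norm (g z) powr ?q)"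
        using le
      proof eventually_elim
        case (elim z)
        then have "norm (f z) powr ?q \<le> (C * norm (g z)) powr ?q" using q by (intro powr_mono2) auto
        then show ?case using C by (simp add: powr_mult ennreal_leI flip: ennreal_mult)
      qed
    qed
    also have "\<dots> = ennreal (C powr ?q) * (\<integral>\<^sup>+z. ennreal (norm (g z) powr ?q) \<partial>lebesgue_on \<Omega>)"
      by (rule nn_integral_cmult) measurable
    finally have "(\<integral>\<^sup>+z. ennreal (norm (f z) powr ?q) \<partial>lebesgue_on \<Omega>) \<le>
        ennreal (C powr ?q) * (\<integral>\<^sup>+z. ennreal (norm (g z) powr ?q) \<partial>lebesgue_on \<Omega>)" .
    from Lp_norm_finite_le[OF p pf g f _ this] show ?thesis
      using C q by (simp add: powr_powr)
  qed
  then show "f \<in> Lp p \<Omega>" "Lp_norm p \<Omega> f \<le> C * Lp_norm p \<Omega> g" by auto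
qed

lemma Lp_imp_integrable:
  fixes f :: "'a::euclidean_space \<Rightarrow> 'b::euclidean_space"
  assumes \<Omega>: "\<Omega> \<in> lmeasurable" "emeasure lebesgue \<Omega> \<noteq> 0" and p: "1 < p" and f: "f \<in> Lp p \<Omega>"
  shows "integrable (lebesgue_on \<Omega>) f"
proof -
  have \<Omega>': "\<Omega> \<in> sets lebesgue" using \<Omega> by (simp add: fmeasurableD)
  have const: "integrable (lebesgue_on \<Omega>) (\<lambda>_. c)" for c :: real
    using \<Omega> \<Omega>' by (simp add: fmeasurable_def emeasure_restrict_space integrable_iff_bounded ennreal_mult_less_top)
  have f_meas: "f \<in> borel_measurable (lebesgue_on \<Omega>)" using f by (simp add: Lp_def)
  show ?thesis
  proof (cases "p = \<infinity>")
    case True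
    then have "AE z in lebesgue_on \<Omega>. norm (f z) \<le> Lp_norm \<infinity> \<Omega> f"
      using Lp_infinity_iff(3)[OF \<Omega>' \<Omega>(2)] f by auto
    then show ?thesis
      by (intro Bochner_Integration.integrable_bound[OF const[of "Lp_norm \<infinity> \<Omega> f"] f_meas])
        (auto elim!: eventually_mono)
  next
    case False
    let ?q = "enn2real p"
    have q: "1 < ?q" using p False by (intro enn2real_gt_1) auto
    have "integrable (lebesgue_on \<Omega>) (\<lambda>z. norm (f z) powr ?q)" using f False by (simp add: Lp_def)
    then have int: "integrable (lebesgue_on \<Omega>) (\<lambda>z. 1 + norm (f z) powr ?q)"
      by (intro Bochner_Integration.integrable_add const)
    have le: "x \<le> 1 + x powr ?q" if "0 \<le> x" for x :: real
    proof (cases "x \<le> 1")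
      case False
      then have "x powr 1 \<le> x powr ?q" using q by (intro powr_mono) auto
      then show ?thesis using False by simp
    qed (simp add: add_increasing2)
    show ?thesis
      by (rule Bochner_Integration.integrable_bound[OF int f_meas]) (use le in \<open>auto intro!: AE_I2 simp: abs_of_nonneg\<close>)
  qed
qed

lemma integrable_imp_locally_integrable:
  assumes "\<Omega> \<in> sets lebesgue" "integrable (lebesgue_on \<Omega>) f"
  shows "f locally_integrable_on \<Omega>"
  unfolding locally_integrable_on_def
proof (intro allI impI)
  fix K assume K: "compact K \<and> K \<subseteq> \<Omega>"
  then have KL: "K \<in> sets lebesgue" by (simp add: borel_compact)
  have "integrable lebesgue (\<lambda>z. indicator K z *\<^sub>R (indicator \<Omega> z *\<^sub>R f z))"
    by (rule integrable_mult_indicator[OF KL]) (use assms in \<open>simp add: integrable_restrict_space\<close>)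
  also have "(\<lambda>z. indicator K z *\<^sub>R (indicator \<Omega> z *\<^sub>R f z)) = (\<lambda>z. indicator K z *\<^sub>R f z)"
    using K by (auto simp: indicator_def fun_eq_iff)
  finally show "integrable (lebesgue_on K) f" using KL by (simp add: integrable_restrict_space)
qed

lemma AE_lebesgue_on_iff:
  "\<Omega> \<in> sets lebesgue \<Longrightarrow> (AE z in lebesgue_on \<Omega>. P z) \<longleftrightarrow> (AE z in lebesgue. z \<in> \<Omega> \<longrightarrow> P z)"
  by (simp add: AE_restrict_space_iff)

lemma borel_representative_real:
  fixes f :: "'a::euclidean_space \<Rightarrow> real"
  assumes "\<Omega> \<in> sets lebesgue" "integrable (lebesgue_on \<Omega>) f"
  obtains F where "integrable lborel F" "AE z in lebesgue. F z = indicator \<Omega> z * f z"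
proof -
  have int: "integrable lebesgue (\<lambda>z. indicator \<Omega> z * f z)"
    using assms by (simp add: integrable_restrict_space)
  then obtain F where F: "F \<in> borel_measurable lborel" "AE z in lborel. indicator \<Omega> z * f z = F z"
    using completion_ex_borel_measurable_real[OF borel_measurable_integrable[OF int]] by blast
  have ae: "AE z in lebesgue. F z = indicator \<Omega> z * f z"
    using AE_completion[OF F(2)] by eventually_elim simp
  have "integrable lebesgue F"
    using F(1) ae by (intro integrable_cong_AE_imp[OF int]) (auto intro: measurable_completion elim!: eventually_mono)
  then show ?thesis using F(1) ae by (intro that) (auto simp: integrable_completion)
qed

text \<open>
  Componentwise, since a Borel representative of a function that is measurable for the completed measure is
  first found for real values.
\<close>

lemma borel_representative:
  fixes f :: "'a::euclidean_space \<Rightarrow> 'b::euclidean_space"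
  assumes \<Omega>: "\<Omega> \<in> sets lebesgue" and f: "integrable (lebesgue_on \<Omega>) f"
  obtains F where "integrable lborel F" "AE z in lebesgue. F z = indicator \<Omega> z *\<^sub>R f z"
proof -
  have "\<exists>F. integrable lborel F \<and> (AE z in lebesgue. F z = indicator \<Omega> z * (f z \<bullet> b))" for b
    using borel_representative_real[OF \<Omega>, of "\<lambda>z. f z \<bullet> b"] f by auto
  then obtain F where F: "\<And>b. integrable lborel (F b)" "\<And>b. AE z in lebesgue. F b z = indicator \<Omega> z * (f z \<bullet> b)"
    by metis
  have "integrable lborel (\<lambda>z. \<Sum>b\<in>Basis. F b z *\<^sub>R b)" using F(1) by auto
  moreover have "AE z in lebesgue. (\<Sum>b\<in>Basis. F b z *\<^sub>R b) = indicator \<Omega> z *\<^sub>R f z"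
  proof -
    have "AE z in lebesgue. \<forall>b\<in>Basis. F b z = indicator \<Omega> z * (f z \<bullet> b)"
      using F(2) by (subst AE_finite_all) auto
    then show ?thesis
    proof eventually_elim
      case (elim z)
      then have "(\<Sum>b\<in>Basis. F b z *\<^sub>R b) = (\<Sum>b\<in>Basis. (indicator \<Omega> z *\<^sub>R f z \<bullet> b) *\<^sub>R b)"
        by (intro sum.cong) auto
      then show ?case by (simp only: euclidean_representation)
    qed
  qed
  ultimately show ?thesis by (rule that)
qed

section \<open>Uniqueness of weak gradients\<close>

text \<open>
  The difference of two weak gradients is orthogonal to all test functions. Locally, its mollifications
  therefore vanish, and so does their almost everywhere limit. Countably many small balls cover
  \<open>\<Omega>\<close>.
\<close>

theorem weak_gradient_unique:
  fixes u :: "'a::euclidean_space \<Rightarrow> real"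
  assumes "open \<Omega>" and G: "has_weak_gradient \<Omega> u G" and G': "has_weak_gradient \<Omega> u G'"
  shows "AE z in lebesgue. z \<in> \<Omega> \<longrightarrow> G z = G' z"
proof -
  obtain \<phi> :: "'a \<Rightarrow> real" where \<phi>: "\<And>k. Ck k \<phi>" "\<And>z. 0 \<le> \<phi> z"
    "\<And>z. 1 \<le> norm z \<Longrightarrow> \<phi> z = 0" "integrable lborel \<phi>" "(\<integral>z. \<phi> z \<partial>lborel) = 1"
    using exists_mollifier by blast
  interpret mollifier \<phi> by unfold_locales (use \<phi> in auto)
  have local: "AE z in lebesgue. z \<in> cball a (r / 2) \<longrightarrow> G z \<bullet> b = G' z \<bullet> b"
    if sub: "cball a r \<subseteq> \<Omega>" and r: "0 < r" and b: "b \<in> Basis" for a r b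
  proof -
    let ?K = "cball a r"
    have K: "?K \<in> sets lebesgue" by simp
    have intK: "integrable (lebesgue_on ?K) G" "integrable (lebesgue_on ?K) G'"
      using G G' sub by (auto simp: has_weak_gradient_def locally_integrable_on_def)
    obtain F where F: "integrable lborel F" "AE z in lebesgue. F z = indicator ?K z * (G z \<bullet> b - G' z \<bullet> b)"
      using borel_representative_real[OF K, of "\<lambda>z. G z \<bullet> b - G' z \<bullet> b"] intK by auto
    note [measurable] = borel_measurable_integrable[OF F(1), simplified]
    have zero: "mollify e F z = 0" if z: "z \<in> cball a (r / 2)" and e: "0 < e" "e \<le> r / 2" for z e
    proof -
      have "dist a w \<le> r" if "dist z w \<le> e" for w
        using dist_triangle[of a w z] z e that by simp
      then have ball: "cball z e \<subseteq> ?K" by auto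
      define w where "w = (\<lambda>y. \<phi> ((z - y) /\<^sub>R e))"
      have w_test: "w \<in> test_functions \<Omega>"
        unfolding w_def using ball sub by (intro scaled_kernel_test_function e) auto
      have w_out: "w y = 0" if "y \<notin> ?K" for y
      proof -
        have "y \<notin> cball z e" using that ball by auto
        then show ?thesis unfolding w_def using e by (intro kernel_support) (simp add: dist_norm divide_simps)
      qed
      have [measurable]: "w \<in> borel_measurable borel"
        using test_function_derivative_props(3)[OF w_test] by (intro borel_measurable_continuous_onI)
      obtain B where B: "0 \<le> B" "\<And>y. \<bar>w y\<bar> \<le> B"
        by (rule compactly_supported_continuous_bounded[OF test_function_derivative_props(3)[OF w_test] compact_cball w_out]) blast+
      have eq: "(LINT y|lebesgue_on \<Omega>. (H y \<bullet> b) * w y) = (LINT y|lebesgue_on ?K. (H y \<bullet> b) * w y)" for H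
      proof -
        have "(\<lambda>y. indicator \<Omega> y *\<^sub>R ((H y \<bullet> b) * w y)) = (\<lambda>y. indicator ?K y *\<^sub>R ((H y \<bullet> b) * w y))"
        proof
          fix y show "indicator \<Omega> y *\<^sub>R ((H y \<bullet> b) * w y) = indicator ?K y *\<^sub>R ((H y \<bullet> b) * w y)"
            using sub w_out[of y] by (cases "y \<in> ?K") (auto simp: indicator_def)
        qed
        moreover have "\<Omega> \<inter> space lebesgue \<in> sets lebesgue" using \<open>open \<Omega>\<close> by simp
        moreover have "?K \<inter> space lebesgue \<in> sets lebesgue" by simp
        ultimately show ?thesis by (simp only: integral_restrict_space)
      qed
      have wK: "w \<in> borel_measurable (lebesgue_on ?K)"
        by (intro measurable_restrict_space1 measurable_completion) simp
      have int: "integrable (lebesgue_on ?K) (\<lambda>y. (H y \<bullet> b) * w y)" if "integrable (lebesgue_on ?K) H" for H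
      proof (rule Bochner_Integration.integrable_bound)
        show "integrable (lebesgue_on ?K) (\<lambda>y. norm (H y \<bullet> b) * B)" using that by auto
        show "(\<lambda>y. (H y \<bullet> b) * w y) \<in> borel_measurable (lebesgue_on ?K)"
          by (intro borel_measurable_times borel_measurable_inner borel_measurable_integrable[OF that] wK) simp
        show "AE y in lebesgue_on ?K. norm ((H y \<bullet> b) * w y) \<le> norm (norm (H y \<bullet> b) * B)"
        proof (rule AE_I2)
          fix y show "norm ((H y \<bullet> b) * w y) \<le> norm (norm (H y \<bullet> b) * B)"
            using B(1) mult_left_mono[OF B(2)[of y], of "\<bar>H y \<bullet> b\<bar>"] by (simp add: abs_mult)
        qed
      qed
      have "(LINT y|lebesgue_on \<Omega>. (G y \<bullet> b) * w y) = (LINT y|lebesgue_on \<Omega>. (G' y \<bullet> b) * w y)"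
      proof -
        have "(LINT y|lebesgue_on \<Omega>. u y * frechet_derivative w (at y) b) = - (LINT y|lebesgue_on \<Omega>. (G y \<bullet> b) * w y)"
          using G b w_test by (simp add: has_weak_gradient_def)
        moreover have "(LINT y|lebesgue_on \<Omega>. u y * frechet_derivative w (at y) b) = - (LINT y|lebesgue_on \<Omega>. (G' y \<bullet> b) * w y)"
          using G' b w_test by (simp add: has_weak_gradient_def)
        ultimately show ?thesis by simp
      qed
      then have "0 = (LINT y|lebesgue_on ?K. (G y \<bullet> b) * w y - (G' y \<bullet> b) * w y)"
        using int[OF intK(1)] int[OF intK(2)] by (simp add: eq)
      also have "\<dots> = (LINT y|lebesgue. F y * w y)"
      proof (subst integral_restrict_space)
        have "(\<lambda>y. indicator ?K y *\<^sub>R ((G y \<bullet> b) * w y - (G' y \<bullet> b) * w y)) \<in> borel_measurable lebesgue"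
          using borel_measurable_integrable[OF Bochner_Integration.integrable_diff[OF int[OF intK(1)] int[OF intK(2)]]] K
          by (subst (asm) borel_measurable_restrict_space_iff) auto
        moreover have "(\<lambda>y. F y * w y) \<in> borel_measurable lebesgue" by (intro measurable_completion) measurable
        ultimately show "(LINT y|lebesgue. indicator ?K y *\<^sub>R ((G y \<bullet> b) * w y - (G' y \<bullet> b) * w y)) = (LINT y|lebesgue. F y * w y)"
        proof (rule integral_cong_AE)
          show "AE y in lebesgue. indicator ?K y *\<^sub>R ((G y \<bullet> b) * w y - (G' y \<bullet> b) * w y) = F y * w y"
            using F(2) by eventually_elim (simp add: left_diff_distrib right_diff_distrib)
        qed
      qed simp
      also have "\<dots> = (\<integral>y. F y * w y \<partial>lborel)" by (rule integral_completion) measurable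
      also have "\<dots> = e ^ DIM('a) * mollify e F z"
        unfolding w_def by (rule mollify_eq_convolution) (use e in auto)
      finally show ?thesis using e by simp
    qed
    define s where "s n = r / 2 * (1 / (real n + 1))" for n
    have s: "0 < s n" "s n \<le> r / 2" for n using r by (auto simp: s_def field_simps)
    have s_lim: "s \<longlonglongrightarrow> 0"
    proof -
      have "s \<longlonglongrightarrow> r / 2 * 0" unfolding s_def by (intro tendsto_intros one_div_Suc_tendsto_0)
      then show ?thesis by simp
    qed
    obtain m where m: "AE z in lborel. (\<lambda>n. mollify (s (m n)) F z) \<longlonglongrightarrow> F z"
      using mollify_tendsto_AE_subseq[OF F(1) s(1) s_lim] by blast
    show ?thesis
      using AE_completion[OF m] F(2)
    proof eventually_elim
      case (elim z)
      show ?case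
      proof
        assume z: "z \<in> cball a (r / 2)"
        then have "(\<lambda>n. mollify (s (m n)) F z) = (\<lambda>_. 0)" using zero s by auto
        with elim(1) have "(\<lambda>_. 0) \<longlonglongrightarrow> F z" by (simp only:)
        then have "F z = 0" by (simp add: LIMSEQ_const_iff)
        moreover have "z \<in> ?K" using z r by auto
        ultimately show "G z \<bullet> b = G' z \<bullet> b" using elim(2) by simp
      qed
    qed
  qed
  have "\<exists>r. 0 < r \<and> cball a r \<subseteq> \<Omega>" if "a \<in> \<Omega>" for a
    using \<open>open \<Omega>\<close> that open_contains_cball by blast
  then obtain R where R: "\<And>a. a \<in> \<Omega> \<Longrightarrow> 0 < R a" "\<And>a. a \<in> \<Omega> \<Longrightarrow> cball a (R a) \<subseteq> \<Omega>" by metis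
  obtain \<B> where \<B>: "\<B> \<subseteq> (\<lambda>a. ball a (R a / 2)) ` \<Omega>" "countable \<B>" "\<Union>\<B> = (\<Union>a\<in>\<Omega>. ball a (R a / 2))"
    by (rule Lindelof[of "(\<lambda>a. ball a (R a / 2)) ` \<Omega>"]) auto
  have "AE z in lebesgue. \<forall>B\<in>\<B>. \<forall>b\<in>Basis. z \<in> B \<longrightarrow> G z \<bullet> b = G' z \<bullet> b"
  proof (subst AE_ball_countable[OF \<B>(2)], intro ballI)
    fix B assume "B \<in> \<B>"
    then obtain a where a: "a \<in> \<Omega>" "B = ball a (R a / 2)" using \<B>(1) by auto
    show "AE z in lebesgue. \<forall>b\<in>Basis. z \<in> B \<longrightarrow> G z \<bullet> b = G' z \<bullet> b"
    proof (subst AE_finite_all, simp, intro ballI)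
      fix b :: 'a assume b: "b \<in> Basis"
      show "AE z in lebesgue. z \<in> B \<longrightarrow> G z \<bullet> b = G' z \<bullet> b"
        using local[OF R(2)[OF a(1)] R(1)[OF a(1)] b] by eventually_elim (use a in auto)
    qed
  qed
  then show ?thesis
  proof eventually_elim
    case (elim z)
    show ?case
    proof
      assume "z \<in> \<Omega>"
      then have "z \<in> ball z (R z / 2)" using R(1) by simp
      with \<open>z \<in> \<Omega>\<close> have "z \<in> \<Union>\<B>" unfolding \<B>(3) by blast
      then obtain B where B: "B \<in> \<B>" "z \<in> B" by blast
      show "G z = G' z" by (rule euclidean_eqI) (use elim B in blast)
    qed
  qed
qed

section \<open>Comparison of the norms\<close>

text \<open>
  The directional derivatives along the coordinate axes assemble to a weak gradient, each component of which is
  at most \<open>2g\<close>.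
\<close>

theorem hajlasz_imp_weak_gradient:
  fixes u g :: "'a::euclidean_space \<Rightarrow> real"
  assumes "open \<Omega>" and \<Omega>: "\<Omega> \<in> lmeasurable" "emeasure lebesgue \<Omega> \<noteq> 0" and p: "1 < p"
    and u: "u \<in> Lp p \<Omega>" and g: "g \<in> hajlasz_gradients p \<Omega> u"
  obtains G where "has_weak_gradient \<Omega> u G" "G \<in> Lp p \<Omega>" "Lp_norm p \<Omega> G \<le> 2 * DIM('a) * Lp_norm p \<Omega> g"
proof -
  have \<Omega>': "\<Omega> \<in> sets lebesgue" using \<Omega> by (simp add: fmeasurableD)
  have gL: "g \<in> Lp p \<Omega>" and g0: "\<And>z. z \<in> \<Omega> \<Longrightarrow> 0 \<le> g z" using g by (auto simp: hajlasz_gradients_def)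
  obtain E where E: "E \<subseteq> \<Omega>" "E \<in> null_sets lebesgue"
    and haj: "\<And>z w. z \<in> \<Omega> - E \<Longrightarrow> w \<in> \<Omega> - E \<Longrightarrow> \<bar>u z - u w\<bar> \<le> norm (z - w) * (g z + g w)"
    using g unfolding hajlasz_gradients_def by blast
  note intu = Lp_imp_integrable[OF \<Omega> p u] and intg = Lp_imp_integrable[OF \<Omega> p gL]
  obtain U where U: "integrable lborel U" "AE z in lebesgue. U z = indicator \<Omega> z * u z"
    using borel_representative_real[OF \<Omega>' intu] by blast
  obtain h0 where h0: "integrable lborel h0" "AE z in lebesgue. h0 z = indicator \<Omega> z * g z"
    using borel_representative_real[OF \<Omega>' intg] by blast
  define h where "h z = \<bar>h0 z\<bar>" for z
  have h: "integrable lborel h" using h0(1) by (simp add: h_def[abs_def])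
  have hg: "AE z in lebesgue. z \<in> \<Omega> \<longrightarrow> h z = g z"
    using h0(2) by eventually_elim (auto simp: h_def g0)
  have Uu: "AE z in lebesgue. z \<in> \<Omega> \<longrightarrow> U z = u z"
    using U(2) by eventually_elim auto
  have "AE z in lebesgue. z \<notin> E" using E(2) by (rule AE_not_in)
  with hg Uu have "AE z in lebesgue. z \<in> \<Omega> \<longrightarrow> h z = g z \<and> U z = u z \<and> z \<notin> E"
    by eventually_elim auto
  then have "AE z in lborel. z \<in> \<Omega> \<longrightarrow> h z = g z \<and> U z = u z \<and> z \<notin> E"
    by (simp only: AE_completion_iff)
  from AE_E3[OF this] obtain N where N: "N \<in> null_sets lborel"
    and N': "\<And>z. z \<in> space lborel - N \<Longrightarrow> z \<in> \<Omega> \<longrightarrow> h z = g z \<and> U z = u z \<and> z \<notin> E"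
    by metis
  have good: "h z = g z \<and> U z = u z \<and> z \<notin> E" if "z \<in> \<Omega> - N" for z
    using N'[of z] that by simp
  have hajN: "\<bar>U z - U w\<bar> \<le> norm (z - w) * (h z + h w)" if "z \<in> \<Omega> - N" "w \<in> \<Omega> - N" for z w
    using haj[of z w] good[OF that(1)] good[OF that(2)] that by auto
  have h_nonneg: "0 \<le> h z" for z by (simp add: h_def)
  have "\<forall>b\<in>Basis. \<exists>D. integrable lborel D \<and> (AE z in lborel. \<bar>D z\<bar> \<le> 2 * h z) \<and>
      (\<forall>\<phi>\<in>test_functions \<Omega>. (\<integral>z. U z * frechet_derivative \<phi> (at z) b \<partial>lborel) = - (\<integral>z. D z * \<phi> z \<partial>lborel))"
  proof
    fix b :: 'a assume b: "b \<in> Basis"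
    show "\<exists>D. integrable lborel D \<and> (AE z in lborel. \<bar>D z\<bar> \<le> 2 * h z) \<and>
      (\<forall>\<phi>\<in>test_functions \<Omega>. (\<integral>z. U z * frechet_derivative \<phi> (at z) b \<partial>lborel) = - (\<integral>z. D z * \<phi> z \<partial>lborel))"
      by (rule hajlasz_imp_weak_directional_derivative[OF \<open>open \<Omega>\<close> U(1) h h_nonneg N norm_Basis[OF b] hajN]) blast+
  qed
  from bchoice[OF this] obtain D where D: "\<And>b. b \<in> Basis \<Longrightarrow> integrable lborel (D b)"
    "\<And>b. b \<in> Basis \<Longrightarrow> AE z in lborel. \<bar>D b z\<bar> \<le> 2 * h z"
    "\<And>b \<phi>. b \<in> Basis \<Longrightarrow> \<phi> \<in> test_functions \<Omega> \<Longrightarrow>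
      (\<integral>z. U z * frechet_derivative \<phi> (at z) b \<partial>lborel) = - (\<integral>z. D b z * \<phi> z \<partial>lborel)"
    by blast
  define G where "G z = (\<Sum>b\<in>Basis. D b z *\<^sub>R b)" for z
  have G: "integrable lborel G" unfolding G_def using D(1) by auto
  have Gb: "G z \<bullet> b = D b z" if "b \<in> Basis" for z b using that by (simp add: G_def)
  have G_meas: "G \<in> borel_measurable borel" using borel_measurable_integrable[OF G] by simp
  have G_leb: "integrable lebesgue G" using G G_meas by (simp add: integrable_completion)
  have G_loc: "G locally_integrable_on \<Omega>"
    unfolding locally_integrable_on_def
  proof (intro allI impI)
    fix K assume "compact K \<and> K \<subseteq> \<Omega>"
    then have "K \<in> sets lebesgue" by (simp add: borel_compact)
    then show "integrable (lebesgue_on K) G"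
      using integrable_mult_indicator[OF _ G_leb, of K] by (simp add: integrable_restrict_space)
  qed
  have u_loc: "u locally_integrable_on \<Omega>" by (rule integrable_imp_locally_integrable[OF \<Omega>' intu])
  have weak: "has_weak_gradient \<Omega> u G"
    unfolding has_weak_gradient_def
  proof (intro conjI ballI u_loc G_loc)
    fix \<phi> :: "'a \<Rightarrow> real" and b :: 'a assume \<phi>: "\<phi> \<in> test_functions \<Omega>" and b: "b \<in> Basis"
    obtain K where K: "compact K" "K \<subseteq> \<Omega>" and out: "\<And>z. z \<notin> K \<Longrightarrow> \<phi> z = 0"
      and out': "\<And>z v. z \<notin> K \<Longrightarrow> frechet_derivative \<phi> (at z) v = 0"
      using test_function_supportE[OF \<phi>] by blast
    note \<phi>_props = test_function_derivative_props[OF \<phi>]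
    have meas: "(\<lambda>z. frechet_derivative \<phi> (at z) b) \<in> borel_measurable borel" "\<phi> \<in> borel_measurable borel"
      using \<phi>_props by (auto intro: borel_measurable_continuous_onI)
    have "(LINT z|lebesgue_on \<Omega>. u z * frechet_derivative \<phi> (at z) b) = (\<integral>z. U z * frechet_derivative \<phi> (at z) b \<partial>lborel)"
      by (rule integral_lebesgue_on_compact_support[OF \<open>open \<Omega>\<close> u_loc K _ Uu meas(1) out'])
        (use borel_measurable_integrable[OF U(1)] in auto)
    moreover have "(LINT z|lebesgue_on \<Omega>. (G z \<bullet> b) * \<phi> z) = (\<integral>z. (G z \<bullet> b) * \<phi> z \<partial>lborel)"
    proof (rule integral_lebesgue_on_compact_support[OF \<open>open \<Omega>\<close> _ K _ _ meas(2) out])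
      show "(\<lambda>z. G z \<bullet> b) locally_integrable_on \<Omega>" using G_loc by (auto simp: locally_integrable_on_def)
      show "(\<lambda>z. G z \<bullet> b) \<in> borel_measurable borel" using G_meas by simp
    qed auto
    ultimately show "(LINT z|lebesgue_on \<Omega>. u z * frechet_derivative \<phi> (at z) b) = - (LINT z|lebesgue_on \<Omega>. (G z \<bullet> b) * \<phi> z)"
      using D(3)[OF b \<phi>] by (simp add: Gb[OF b])
  qed
  have "AE z in lborel. \<forall>b\<in>Basis. \<bar>D b z\<bar> \<le> 2 * h z"
    using D(2) by (subst AE_finite_all) auto
  from AE_completion[OF this] hg
  have "AE z in lebesgue. z \<in> \<Omega> \<longrightarrow> norm (G z) \<le> 2 * DIM('a) * norm (g z)"
  proof eventually_elim
    case (elim z)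
    have "norm (G z) \<le> (\<Sum>b\<in>Basis. \<bar>D b z\<bar>)"
      unfolding G_def by (rule order_trans[OF norm_sum]) simp
    also have "\<dots> \<le> (\<Sum>b\<in>(Basis::'a set). 2 * h z)" using elim by (intro sum_mono) auto
    finally have "norm (G z) \<le> 2 * DIM('a) * h z" by simp
    also have "\<dots> \<le> 2 * DIM('a) * \<bar>h z\<bar>" by (simp add: h_def)
    finally show ?case using elim(2) by auto
  qed
  then have le: "AE z in lebesgue_on \<Omega>. norm (G z) \<le> 2 * DIM('a) * norm (g z)"
    by (simp add: AE_lebesgue_on_iff[OF \<Omega>'])
  have "G \<in> borel_measurable (lebesgue_on \<Omega>)"
    using G_meas by (intro measurable_restrict_space1 measurable_completion) simp
  from Lp_dominated[OF \<Omega>' \<Omega>(2) p gL this _ le] weak show ?thesis by (intro that) auto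
qed

lemma cusp_gradient_le_const:
  assumes "\<And>z. f z \<le> c"
  shows "cusp_gradient f z \<le> c + c"
  unfolding cusp_gradient_def slice_maximal_function_def
  by (intro add_mono maximal_function_le_const assms)

text \<open>
  The maximal theorem is used on slices, and a second time for the iterated maximal function.
\<close>

lemma cusp_gradient_strong_type:
  assumes q: "1 < q"
  obtains A where "0 \<le> A" "\<And>f :: real \<times> (real ^ 'm::finite) \<Rightarrow> ennreal. f \<in> borel_measurable borel \<Longrightarrow>
    (\<integral>\<^sup>+z. ennpow (cusp_gradient f z) q \<partial>lborel) \<le> ennreal A * (\<integral>\<^sup>+z. ennpow (f z) q \<partial>lborel)"
proof -
  define a where "a n = 5 ^ n * 2 powr q * q / (q - 1)" for n :: nat
  have a0: "0 \<le> a n" for n using q by (simp add: a_def)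
  let ?n = "DIM(real \<times> (real ^ 'm))"
  show ?thesis
  proof (rule that[of "2 powr q * (a 1 + a 1 * a ?n)"])
    show "0 \<le> 2 powr q * (a 1 + a 1 * a ?n)" using a0 by simp
    fix f :: "real \<times> (real ^ 'm) \<Rightarrow> ennreal" assume [measurable]: "f \<in> borel_measurable borel"
    let ?I = "\<integral>\<^sup>+z. ennpow (f z) q \<partial>lborel"
    have slice: "(\<integral>\<^sup>+z. ennpow (slice_maximal_function h z) q \<partial>lborel) \<le> ennreal (a 1) * (\<integral>\<^sup>+z. ennpow (h z) q \<partial>lborel)"
      if "h \<in> borel_measurable borel" for h :: "real \<times> (real ^ 'm) \<Rightarrow> ennreal"
      using slice_maximal_function_strong_type[OF that q] by (simp add: a_def)
    have "(\<integral>\<^sup>+z. ennpow (slice_maximal_function (maximal_function f) z) q \<partial>lborel) \<le>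
        ennreal (a 1) * (\<integral>\<^sup>+z. ennpow (maximal_function f z) q \<partial>lborel)"
      by (rule slice) measurable
    also have "\<dots> \<le> ennreal (a 1) * (ennreal (a ?n) * ?I)"
      using maximal_function_strong_type[of f q] q by (intro mult_left_mono) (auto simp: a_def)
    finally have iter: "(\<integral>\<^sup>+z. ennpow (slice_maximal_function (maximal_function f) z) q \<partial>lborel) \<le> ennreal (a 1) * (ennreal (a ?n) * ?I)" .
    have "(\<integral>\<^sup>+z. ennpow (cusp_gradient f z) q \<partial>lborel) \<le>
        (\<integral>\<^sup>+z. ennreal (2 powr q) * (ennpow (slice_maximal_function f z) q + ennpow (slice_maximal_function (maximal_function f) z) q) \<partial>lborel)"
      unfolding cusp_gradient_def using q by (intro nn_integral_mono ennpow_add_le) simp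
    also have "\<dots> = ennreal (2 powr q) * ((\<integral>\<^sup>+z. ennpow (slice_maximal_function f z) q \<partial>lborel) +
        (\<integral>\<^sup>+z. ennpow (slice_maximal_function (maximal_function f) z) q \<partial>lborel))"
      by (subst nn_integral_cmult, measurable, subst nn_integral_add, measurable)
    also have "\<dots> \<le> ennreal (2 powr q) * (ennreal (a 1) * ?I + ennreal (a 1) * (ennreal (a ?n) * ?I))"
      by (intro mult_left_mono add_mono slice iter) auto
    also have "\<dots> = ennreal (2 powr q * (a 1 + a 1 * a ?n)) * ?I"
      using a0[of 1] a0[of ?n] by (simp add: ennreal_mult' ennreal_plus distrib_left distrib_right mult.assoc del: ennreal_plus[symmetric])
    finally show "(\<integral>\<^sup>+z. ennpow (cusp_gradient f z) q \<partial>lborel) \<le> ennreal (2 powr q * (a 1 + a 1 * a ?n)) * ?I" .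
  qed
qed

lemma le_one_plus_ennpow: "1 \<le> q \<Longrightarrow> x \<le> 1 + ennpow x q"
proof (cases x)
  case (real r)
  assume q: "1 \<le> q"
  have "r \<le> 1 + r powr q"
  proof (cases "r \<le> 1")
    case False
    then have "r powr 1 \<le> r powr q" using q by (intro powr_mono) auto
    then show ?thesis using False by simp
  qed (simp add: add_increasing2)
  then have "ennreal r \<le> ennreal (1 + r powr q)" by (rule ennreal_leI)
  then show ?thesis using real by (simp add: ennreal_plus)
qed simp

text \<open>
  For finite \<open>p\<close> the norm estimate is the maximal theorem. For \<open>p = \<infinity>\<close> a
  maximal function is bounded by the supremum of its argument; to obtain this from an essential bound, the
  representative \<open>H\<close> of the gradient is set to \<open>0\<close> on the null set where it is too
  large.
\<close>

theorem weak_gradient_imp_hajlasz_gradient: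
  fixes \<psi> :: "real \<Rightarrow> real" and \<Omega> :: "(real \<times> (real ^ 'm::finite)) set"
  assumes mono: "mono_on {0<..1} \<psi>" and \<Omega>_eq: "\<Omega> = cusp_domain \<psi>" and "open \<Omega>" and pos: "0 < \<psi> 1"
    and \<Omega>: "\<Omega> \<in> lmeasurable" "emeasure lebesgue \<Omega> \<noteq> 0" and p: "1 < p"
  obtains C where "0 < C" "\<And>u G. u \<in> Lp p \<Omega> \<Longrightarrow> has_weak_gradient \<Omega> u G \<Longrightarrow> G \<in> Lp p \<Omega> \<Longrightarrow>
    \<exists>g\<in>hajlasz_gradients p \<Omega> u. Lp_norm p \<Omega> g \<le> C * Lp_norm p \<Omega> G"
proof -
  have \<Omega>': "\<Omega> \<in> sets lebesgue" using \<Omega> by (simp add: fmeasurableD)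
  define C0 where "C0 = 5 * cusp_ratio \<psi> ^ Suc (DIM(real \<times> (real ^ 'm)))"
  have C0: "0 < C0" using pos by (simp add: C0_def cusp_ratio_def)
  define b where "b = 2 + \<psi> 1"
  have b: "norm z < b" if "z \<in> \<Omega>" for z
    using cusp_domain_norm_less[OF mono] that by (simp add: b_def \<Omega>_eq)
  define gr where "gr H z = C0 * enn2real (cusp_gradient (\<lambda>w. ennreal (norm (H w))) z)" for H :: "real \<times> (real ^ 'm) \<Rightarrow> real \<times> (real ^ 'm)" and z
  have gr_meas: "gr H \<in> borel_measurable (lebesgue_on \<Omega>)" if [measurable]: "H \<in> borel_measurable borel" for H
  proof -
    have "gr H \<in> borel_measurable borel" unfolding gr_def[abs_def] by measurable
    then show ?thesis by (intro measurable_restrict_space1 measurable_completion) simp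
  qed
  have gradient: "gr H \<in> hajlasz_gradients p \<Omega> u"
    if u: "u \<in> Lp p \<Omega>" and G: "has_weak_gradient \<Omega> u G"
      and H: "integrable lborel H" "AE z in lebesgue. z \<in> \<Omega> \<longrightarrow> H z = G z"
      and fin: "(\<integral>\<^sup>+z\<in>ball 0 (b + 1). cusp_gradient (\<lambda>w. ennreal (norm (H w))) z \<partial>lborel) < \<infinity>"
      and Lp: "gr H \<in> Lp p \<Omega>" for u G H
  proof -
    obtain U where U: "integrable lborel U" "AE z in lebesgue. U z = indicator \<Omega> z * u z"
      using borel_representative_real[OF \<Omega>' Lp_imp_integrable[OF \<Omega> p u]] by blast
    have Uu: "AE z in lebesgue. z \<in> \<Omega> \<longrightarrow> U z = u z" using U(2) by eventually_elim auto
    obtain E where E: "E \<in> null_sets lborel" "\<And>z1 z2. z1 \<in> \<Omega> - E \<Longrightarrow> z2 \<in> \<Omega> - E \<Longrightarrow>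
        \<bar>U z1 - U z2\<bar> \<le> norm (z1 - z2) * (gr H z1 + gr H z2)"
    proof (rule weak_gradient_imp_hajlasz[of \<psi> u G U H b])
      show "mono_on {0<..1} \<psi>" "open (cusp_domain \<psi> :: (real \<times> (real ^ 'm)) set)" "0 \<le> \<psi> 1"
        "integrable lborel U" "integrable lborel H"
        using mono pos \<open>open \<Omega>\<close> U(1) H(1) unfolding \<Omega>_eq by auto
      show "has_weak_gradient (cusp_domain \<psi>) u G" using G unfolding \<Omega>_eq .
    qed (use Uu H(2) b fin in \<open>auto simp: \<Omega>_eq gr_def C0_def\<close>)
    have "AE z in lebesgue. z \<in> \<Omega> \<longrightarrow> U z = u z \<and> z \<notin> E"
      using Uu AE_completion[OF AE_not_in[OF E(1)]] by eventually_elim auto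
    from AE_E3[OF this] obtain N where N: "N \<in> null_sets lebesgue"
      "\<And>z. z \<in> space lebesgue - N \<Longrightarrow> z \<in> \<Omega> \<longrightarrow> U z = u z \<and> z \<notin> E" by metis
    have "\<Omega> \<inter> N \<in> null_sets lebesgue"
      using N(1) by (rule null_sets_completion_subset[rotated]) auto
    moreover have "\<bar>u z1 - u z2\<bar> \<le> norm (z1 - z2) * (gr H z1 + gr H z2)"
      if "z1 \<in> \<Omega> - \<Omega> \<inter> N" "z2 \<in> \<Omega> - \<Omega> \<inter> N" for z1 z2
      using E(2)[of z1 z2] N(2)[of z1] N(2)[of z2] that by auto
    moreover have "0 \<le> gr H z" for z using C0 by (simp add: gr_def)
    ultimately show ?thesis
      unfolding hajlasz_gradients_def using Lp by (auto intro!: exI[of _ "\<Omega> \<inter> N"])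
  qed
  show ?thesis
  proof (cases "p = \<infinity>")
    case True
    show ?thesis
    proof (rule that[of "C0 * 2"])
      fix u :: "real \<times> (real ^ 'm) \<Rightarrow> real" and G
      assume u: "u \<in> Lp p \<Omega>" and G: "has_weak_gradient \<Omega> u G" and GL: "G \<in> Lp p \<Omega>"
      define B where "B = Lp_norm p \<Omega> G"
      have B: "0 \<le> B" "AE z in lebesgue_on \<Omega>. norm (G z) \<le> B"
        using Lp_infinity_iff(2,3)[OF \<Omega>' \<Omega>(2), of G] GL True by (auto simp: B_def)
      obtain H0 where H0: "integrable lborel H0" "AE z in lebesgue. H0 z = indicator \<Omega> z *\<^sub>R G z"
        using borel_representative[OF \<Omega>' Lp_imp_integrable[OF \<Omega> p GL]] by blast
      define H where "H z = (if norm (H0 z) \<le> B then H0 z else 0)" for z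
      have [measurable]: "H0 \<in> borel_measurable borel" using borel_measurable_integrable[OF H0(1)] by simp
      have [measurable]: "H \<in> borel_measurable borel" unfolding H_def by measurable
      have HB: "norm (H z) \<le> B" for z using B by (simp add: H_def)
      have Hint: "integrable lborel H"
        by (rule Bochner_Integration.integrable_bound[OF H0(1)]) (auto simp: H_def)
      have HG: "AE z in lebesgue. z \<in> \<Omega> \<longrightarrow> H z = G z"
        using H0(2) B(2)[unfolded AE_lebesgue_on_iff[OF \<Omega>']] by eventually_elim (auto simp: H_def)
      have le: "cusp_gradient (\<lambda>w. ennreal (norm (H w))) z \<le> ennreal (2 * B)" for z
        using cusp_gradient_le_const[of "\<lambda>w. ennreal (norm (H w))" "ennreal B" z] HB B(1)
        by (simp add: ennreal_leI flip: ennreal_plus)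
      have fin: "(\<integral>\<^sup>+z\<in>ball 0 (b + 1). cusp_gradient (\<lambda>w. ennreal (norm (H w))) z \<partial>lborel) < \<infinity>"
      proof -
        have "(\<integral>\<^sup>+z\<in>ball 0 (b + 1). cusp_gradient (\<lambda>w. ennreal (norm (H w))) z \<partial>lborel) \<le>
            (\<integral>\<^sup>+z\<in>ball 0 (b + 1). ennreal (2 * B) \<partial>(lborel :: (real \<times> (real ^ 'm)) measure))"
          using le by (intro nn_integral_mono mult_right_mono) auto
        also have "\<dots> < \<infinity>"
          using emeasure_ball_less_top by (subst nn_integral_cmult_indicator) (auto simp: ennreal_mult_less_top)
        finally show ?thesis .
      qed
      have "norm (gr H z) \<le> C0 * 2 * B" for z
      proof -
        have "enn2real (cusp_gradient (\<lambda>w. ennreal (norm (H w))) z) \<le> 2 * B"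
          using enn2real_mono[OF le[of z]] B(1) by simp
        then have "C0 * enn2real (cusp_gradient (\<lambda>w. ennreal (norm (H w))) z) \<le> C0 * (2 * B)"
          using C0 by (intro mult_left_mono) auto
        then show ?thesis using C0 by (simp add: gr_def abs_of_nonneg)
      qed
      then have ae: "AE z in lebesgue_on \<Omega>. norm (gr H z) \<le> C0 * 2 * B" by (intro AE_I2)
      have "0 \<le> C0 * 2 * B" using C0 B(1) by simp
      moreover have "gr H \<in> borel_measurable (lebesgue_on \<Omega>)" by (rule gr_meas) measurable
      ultimately have grL: "gr H \<in> Lp \<infinity> \<Omega>" unfolding Lp_infinity_iff(1)[OF \<Omega>' \<Omega>(2)] using ae by blast
      show "\<exists>g\<in>hajlasz_gradients p \<Omega> u. Lp_norm p \<Omega> g \<le> C0 * 2 * Lp_norm p \<Omega> G"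
        using gradient[OF u G Hint HG fin] grL Lp_infinity_iff(4)[OF \<Omega>' \<Omega>(2) grL ae] True
        by (auto simp: B_def)
    qed (use C0 in simp)
  next
    case False
    then have pf: "p < \<infinity>" by (simp add: less_top)
    let ?q = "enn2real p"
    have q: "1 < ?q" using p False by (rule enn2real_gt_1)
    obtain A where A: "0 \<le> A" "\<And>f :: real \<times> (real ^ 'm) \<Rightarrow> ennreal. f \<in> borel_measurable borel \<Longrightarrow>
      (\<integral>\<^sup>+z. ennpow (cusp_gradient f z) ?q \<partial>lborel) \<le> ennreal A * (\<integral>\<^sup>+z. ennpow (f z) ?q \<partial>lborel)"
      using cusp_gradient_strong_type[OF q] by blast
    define C where "C = (C0 powr ?q * A) powr (1 / ?q) + 1"
    show ?thesis
    proof (rule that[of C])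
      show "0 < C" by (simp add: C_def add_nonneg_pos)
      fix u :: "real \<times> (real ^ 'm) \<Rightarrow> real" and G
      assume u: "u \<in> Lp p \<Omega>" and G: "has_weak_gradient \<Omega> u G" and GL: "G \<in> Lp p \<Omega>"
      obtain H where H: "integrable lborel H" "AE z in lebesgue. H z = indicator \<Omega> z *\<^sub>R G z"
        using borel_representative[OF \<Omega>' Lp_imp_integrable[OF \<Omega> p GL]] by blast
      have [measurable]: "H \<in> borel_measurable borel" using borel_measurable_integrable[OF H(1)] by simp
      have HG: "AE z in lebesgue. z \<in> \<Omega> \<longrightarrow> H z = G z" using H(2) by eventually_elim auto
      define f where "f = (\<lambda>w. ennreal (norm (H w)))"
      have [measurable]: "f \<in> borel_measurable borel" unfolding f_def by measurable
      define h where "h = cusp_gradient f"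
      have [measurable]: "h \<in> borel_measurable borel" unfolding h_def by measurable
      have IG: "(\<integral>\<^sup>+z. ennreal (norm (G z) powr ?q) \<partial>lebesgue_on \<Omega>) < \<infinity>"
        using Lp_finite_iff(1)[OF pf] GL by auto
      have If: "(\<integral>\<^sup>+z. ennpow (f z) ?q \<partial>lborel) = (\<integral>\<^sup>+z. ennreal (norm (G z) powr ?q) \<partial>lebesgue_on \<Omega>)"
      proof -
        have "(\<integral>\<^sup>+z. ennpow (f z) ?q \<partial>lborel) = (\<integral>\<^sup>+z. ennreal (norm (H z) powr ?q) \<partial>lebesgue)"
          by (simp add: f_def nn_integral_completion)
        also have "\<dots> = (\<integral>\<^sup>+z. ennreal (norm (G z) powr ?q) * indicator \<Omega> z \<partial>lebesgue)"
        proof (rule nn_integral_cong_AE)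
          show "AE z in lebesgue. ennreal (norm (H z) powr ?q) = ennreal (norm (G z) powr ?q) * indicator \<Omega> z"
            using H(2) by eventually_elim (auto simp: indicator_def)
        qed
        also have "\<dots> = (\<integral>\<^sup>+z. ennreal (norm (G z) powr ?q) \<partial>lebesgue_on \<Omega>)"
          using \<Omega>' by (simp add: nn_integral_restrict_space)
        finally show ?thesis .
      qed
      have Ih: "(\<integral>\<^sup>+z. ennpow (h z) ?q \<partial>lborel) \<le> ennreal A * (\<integral>\<^sup>+z. ennreal (norm (G z) powr ?q) \<partial>lebesgue_on \<Omega>)"
        unfolding h_def If[symmetric] by (rule A(2)) measurable
      have Ih_fin: "(\<integral>\<^sup>+z. ennpow (h z) ?q \<partial>lborel) < \<infinity>"
        using Ih IG by (auto simp: ennreal_mult_less_top intro: le_less_trans)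
      have fin: "(\<integral>\<^sup>+z\<in>ball 0 (b + 1). h z \<partial>lborel) < \<infinity>"
      proof -
        have [measurable]: "ball (0::real \<times> (real ^ 'm)) (b + 1) \<in> sets borel" by simp
        have "(\<integral>\<^sup>+z\<in>ball 0 (b + 1). h z \<partial>lborel) \<le> (\<integral>\<^sup>+z. indicator (ball 0 (b + 1)) z + ennpow (h z) ?q \<partial>lborel)"
          using le_one_plus_ennpow[of ?q] q by (intro nn_integral_mono) (auto simp: indicator_def)
        also have "\<dots> = emeasure lborel (ball (0::real \<times> (real ^ 'm)) (b + 1)) + (\<integral>\<^sup>+z. ennpow (h z) ?q \<partial>lborel)"
          by (subst nn_integral_add) auto
        also have "\<dots> < \<infinity>" using Ih_fin emeasure_ball_less_top by simp
        finally show ?thesis .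
      qed
      have "(\<integral>\<^sup>+z. ennreal (norm (gr H z) powr ?q) \<partial>lebesgue_on \<Omega>) \<le>
          (\<integral>\<^sup>+z. ennreal (norm (gr H z) powr ?q) \<partial>lebesgue)"
        using \<Omega>' by (subst nn_integral_restrict_space) (auto intro!: nn_integral_mono simp: indicator_def)
      also have "\<dots> = (\<integral>\<^sup>+z. ennreal (norm (gr H z) powr ?q) \<partial>lborel)"
        unfolding gr_def by (rule nn_integral_completion)
      also have "\<dots> \<le> (\<integral>\<^sup>+z. ennreal (C0 powr ?q) * ennpow (h z) ?q \<partial>lborel)"
      proof (rule nn_integral_mono)
        fix z
        show "ennreal (norm (gr H z) powr ?q) \<le> ennreal (C0 powr ?q) * ennpow (h z) ?q"
        proof (cases "h z")
          case (real r)
          then have "gr H z = C0 * r" by (simp add: gr_def h_def f_def)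
          then show ?thesis using real C0 by (simp add: powr_mult flip: ennreal_mult)
        next
          case top
          then have "gr H z = 0" by (simp add: gr_def h_def f_def)
          then show ?thesis using q by simp
        qed
      qed
      also have "\<dots> = ennreal (C0 powr ?q) * (\<integral>\<^sup>+z. ennpow (h z) ?q \<partial>lborel)"
        by (rule nn_integral_cmult) measurable
      also have "\<dots> \<le> ennreal (C0 powr ?q) * (ennreal A * (\<integral>\<^sup>+z. ennreal (norm (G z) powr ?q) \<partial>lebesgue_on \<Omega>))"
        by (intro mult_left_mono Ih) simp
      also have "\<dots> = ennreal (C0 powr ?q * A) * (\<integral>\<^sup>+z. ennreal (norm (G z) powr ?q) \<partial>lebesgue_on \<Omega>)"
        using A(1) by (simp add: ennreal_mult mult.assoc)
      finally have bound: "(\<integral>\<^sup>+z. ennreal (norm (gr H z) powr ?q) \<partial>lebesgue_on \<Omega>) \<le>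
          ennreal (C0 powr ?q * A) * (\<integral>\<^sup>+z. ennreal (norm (G z) powr ?q) \<partial>lebesgue_on \<Omega>)" .
      have "gr H \<in> borel_measurable (lebesgue_on \<Omega>)" by (rule gr_meas) measurable
      note res = Lp_norm_finite_le[OF p pf GL this _ bound]
      have "Lp_norm p \<Omega> (gr H) \<le> (C0 powr ?q * A) powr (1 / ?q) * Lp_norm p \<Omega> G" using res(2) A(1) by simp
      also have "\<dots> \<le> C * Lp_norm p \<Omega> G"
        using Lp_norm_nonneg[OF \<Omega>' \<Omega>(2) GL] by (intro mult_right_mono) (auto simp: C_def)
      finally show "\<exists>g\<in>hajlasz_gradients p \<Omega> u. Lp_norm p \<Omega> g \<le> C * Lp_norm p \<Omega> G"
        using gradient[OF u G H(1) HG] fin res(1) A(1) by (auto simp: h_def f_def)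
    qed
  qed
qed

section \<open>Equality of the two spaces\<close>

theorem theorem1p5:
  fixes \<psi> :: "real \<Rightarrow> real" and \<Omega> :: "(real \<times> (real ^ 'm::finite)) set" and p :: ennreal
  assumes pos: "\<And>t. t \<in> {0<..1} \<Longrightarrow> 0 < \<psi> t"
    and increasing: "mono_on {0<..1} \<psi>"
    and left_continuous: "\<And>t. t \<in> {0<..1} \<Longrightarrow> continuous (at_left t) \<psi>"
    and \<Omega>: "\<Omega> = cusp_domain \<psi>"
    and p: "1 < p"
  shows "sobolev p \<Omega> = hajlasz_sobolev p \<Omega> \<and>
    (\<exists>C\<ge>1. \<forall>u\<in>sobolev p \<Omega>.
       inverse C * sobolev_norm p \<Omega> u \<le> hajlasz_sobolev_norm p \<Omega> u \<and>
       hajlasz_sobolev_norm p \<Omega> u \<le> C * sobolev_norm p \<Omega> u)"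
proof -
  have "open \<Omega>" unfolding \<Omega> by (rule open_cusp_domain[OF increasing left_continuous])
  have pos1: "0 < \<psi> 1" by (rule pos) simp
  have "bounded \<Omega>"
    unfolding bounded_iff \<Omega> using cusp_domain_norm_less[OF increasing] by (meson less_imp_le)
  then have lm: "\<Omega> \<in> lmeasurable" using \<open>open \<Omega>\<close> by (rule lmeasurable_open)
  then have \<Omega>': "\<Omega> \<in> sets lebesgue" by (simp add: fmeasurableD)
  have "(1, 0) \<in> \<Omega>" unfolding \<Omega> using pos1 by (simp add: cusp_domain_iff)
  then have "\<not> negligible \<Omega>" using open_not_negligible[OF \<open>open \<Omega>\<close>] by auto
  then have nz: "emeasure lebesgue \<Omega> \<noteq> 0"
    using \<Omega>' by (simp add: negligible_iff_null_sets null_sets_def)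
  obtain C1 where C1: "0 < C1" "\<And>u G. u \<in> Lp p \<Omega> \<Longrightarrow> has_weak_gradient \<Omega> u G \<Longrightarrow> G \<in> Lp p \<Omega> \<Longrightarrow>
    \<exists>g\<in>hajlasz_gradients p \<Omega> u. Lp_norm p \<Omega> g \<le> C1 * Lp_norm p \<Omega> G"
    by (rule weak_gradient_imp_hajlasz_gradient[OF increasing \<Omega> \<open>open \<Omega>\<close> pos1 lm nz p]) (rule that)
  define C2 where "C2 = 2 * real DIM(real \<times> (real ^ 'm))"
  have C2: "0 < C2" by (simp add: C2_def)
  have weak: "\<exists>G. has_weak_gradient \<Omega> u G \<and> G \<in> Lp p \<Omega> \<and> Lp_norm p \<Omega> G \<le> C2 * Lp_norm p \<Omega> g"
    if "u \<in> Lp p \<Omega>" "g \<in> hajlasz_gradients p \<Omega> u" for u g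
    by (rule hajlasz_imp_weak_gradient[OF \<open>open \<Omega>\<close> lm nz p that]) (auto simp: C2_def)
  have eq: "sobolev p \<Omega> = hajlasz_sobolev p \<Omega>"
    unfolding sobolev_def hajlasz_sobolev_def using C1(2) weak by blast
  define C where "C = max 1 (max C1 C2)"
  have C: "1 \<le> C" "C1 \<le> C" "C2 \<le> C" by (auto simp: C_def)
  have "inverse C * sobolev_norm p \<Omega> u \<le> hajlasz_sobolev_norm p \<Omega> u \<and> hajlasz_sobolev_norm p \<Omega> u \<le> C * sobolev_norm p \<Omega> u"
    if u: "u \<in> sobolev p \<Omega>" for u
  proof -
    have uL: "u \<in> Lp p \<Omega>" using u by (simp add: sobolev_def)
    obtain G where G: "has_weak_gradient \<Omega> u G" "G \<in> Lp p \<Omega>" using u by (auto simp: sobolev_def)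
    define W where "W = weak_gradient \<Omega> u"
    have W: "has_weak_gradient \<Omega> u W" unfolding W_def weak_gradient_def by (rule someI[of "has_weak_gradient \<Omega> u", OF G(1)])
    have W_le: "W \<in> Lp p \<Omega> \<and> Lp_norm p \<Omega> W \<le> Lp_norm p \<Omega> G'"
      if G': "has_weak_gradient \<Omega> u G'" "G' \<in> Lp p \<Omega>" for G'
    proof -
      have "AE z in lebesgue. z \<in> \<Omega> \<longrightarrow> W z = G' z" by (rule weak_gradient_unique[OF \<open>open \<Omega>\<close> W G'(1)])
      then have ae: "AE z in lebesgue_on \<Omega>. W z = G' z" by (simp add: AE_lebesgue_on_iff[OF \<Omega>'])
      have "W \<in> borel_measurable (lebesgue_on \<Omega>)"
      proof -
        have [measurable]: "(\<lambda>z. indicator \<Omega> z *\<^sub>R G' z) \<in> borel_measurable lebesgue"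
          using G'(2) \<Omega>' by (subst borel_measurable_restrict_space_iff[symmetric]) (auto simp: Lp_def)
        have "AE z in lebesgue. indicator \<Omega> z *\<^sub>R G' z = indicator \<Omega> z *\<^sub>R W z"
          using ae[unfolded AE_lebesgue_on_iff[OF \<Omega>']] by eventually_elim (auto simp: indicator_def)
        then have "(\<lambda>z. indicator \<Omega> z *\<^sub>R W z) \<in> borel_measurable lebesgue"
          by (rule borel_measurable_AE[rotated]) measurable
        then show ?thesis using \<Omega>' by (subst borel_measurable_restrict_space_iff) auto
      qed
      moreover have "AE z in lebesgue_on \<Omega>. norm (W z) \<le> 1 * norm (G' z)"
        using ae by eventually_elim simp
      ultimately show ?thesis using Lp_dominated[OF \<Omega>' nz p G'(2), of W 1] by simp
    qed
    have WL: "W \<in> Lp p \<Omega>" using W_le[OF G] by simp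
    have W0: "0 \<le> Lp_norm p \<Omega> W" and u0: "0 \<le> Lp_norm p \<Omega> u"
      using Lp_norm_nonneg[OF \<Omega>' nz] WL uL by auto
    obtain g where g: "g \<in> hajlasz_gradients p \<Omega> u" "Lp_norm p \<Omega> g \<le> C1 * Lp_norm p \<Omega> W"
      using C1(2)[OF uL W WL] by blast
    let ?I = "INF g\<in>hajlasz_gradients p \<Omega> u. Lp_norm p \<Omega> g"
    have "bdd_below (Lp_norm p \<Omega> ` hajlasz_gradients p \<Omega> u)"
      using Lp_norm_nonneg[OF \<Omega>' nz] by (intro bdd_belowI[of _ 0]) (auto simp: hajlasz_gradients_def)
    then have "?I \<le> Lp_norm p \<Omega> g" using g(1) by (rule cINF_lower)
    also have "\<dots> \<le> C1 * Lp_norm p \<Omega> W" by (rule g(2))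
    also have "\<dots> \<le> C * Lp_norm p \<Omega> W" using C W0 by (intro mult_right_mono) auto
    finally have I_le: "?I \<le> C * Lp_norm p \<Omega> W" .
    have "Lp_norm p \<Omega> W / C \<le> ?I"
    proof (rule cINF_greatest)
      fix g' assume g': "g' \<in> hajlasz_gradients p \<Omega> u"
      then have g'0: "0 \<le> Lp_norm p \<Omega> g'" using Lp_norm_nonneg[OF \<Omega>' nz] by (auto simp: hajlasz_gradients_def)
      obtain G' where G': "has_weak_gradient \<Omega> u G'" "G' \<in> Lp p \<Omega>" "Lp_norm p \<Omega> G' \<le> C2 * Lp_norm p \<Omega> g'"
        using weak[OF uL g'] by blast
      have "Lp_norm p \<Omega> W \<le> C2 * Lp_norm p \<Omega> g'" using W_le[OF G'(1,2)] G'(3) by simp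
      also have "\<dots> \<le> C * Lp_norm p \<Omega> g'" using C g'0 by (intro mult_right_mono) auto
      finally show "Lp_norm p \<Omega> W / C \<le> Lp_norm p \<Omega> g'" using C by (simp add: divide_le_eq mult.commute)
    qed (use g(1) in auto)
    moreover have "Lp_norm p \<Omega> u / C \<le> Lp_norm p \<Omega> u"
      using C u0 by (simp add: divide_le_eq mult_le_cancel_left1)
    ultimately have "inverse C * sobolev_norm p \<Omega> u \<le> hajlasz_sobolev_norm p \<Omega> u"
      unfolding sobolev_norm_def hajlasz_sobolev_norm_def W_def[symmetric]
      by (simp add: distrib_left divide_inverse mult.commute add_mono)
    moreover have "hajlasz_sobolev_norm p \<Omega> u \<le> C * sobolev_norm p \<Omega> u"
    proof -
      have "Lp_norm p \<Omega> u \<le> C * Lp_norm p \<Omega> u" using C u0 by (simp add: mult_le_cancel_right1)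
      then show ?thesis
        unfolding sobolev_norm_def hajlasz_sobolev_norm_def W_def[symmetric]
        using I_le by (simp add: distrib_left add_mono)
    qed
    ultimately show ?thesis by blast
  qed
  then show ?thesis using eq C(1) by blast
qed

end
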